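(* For every $\varphi\in\mathcal L$: if $\varphi$ is valid (over all bi-relational frames, equivalently over all flows with the real-valued semantics), then $\varphi\in\mathsf{GTL}$. Together with soundness, $\mathsf{GTL}=\mathsf G_{\mathrm{rel}}=\mathsf G_\mathbb R$.
   Context: $\mathcal L$: $\varphi,\psi ::= p \mid \varphi\wedge\psi \mid \varphi\vee\psi \mid \varphi\Rightarrow\psi \mid \varphi\Leftarrow\psi \mid \mathsf X\varphi \mid \mathsf Y\varphi \mid \mathsf G\varphi \mid \mathsf H\varphi \mid \varphi\,\mathsf U\,\psi \mid \varphi\,\mathsf S\,\psi$; $\top:=p_0\Rightarrow p_0$, $\bot:=p_0\Leftarrow p_0$, $\neg\varphi:=\varphi\Rightarrow\bot$, $\varphi\Leftrightarrow\psi:=(\varphi\Rightarrow\psi)\wedge(\psi\Rightarrow\varphi)$. $\mathsf{GTL}$ is the least set of $\mathcal L$-formulas containing: (I) all substitution instances of intuitionistic propositional tautologies; (II) $\varphi\Rightarrow(\psi\vee(\varphi\Leftarrow\psi))$; (III) $(\varphi\Rightarrow\psi)\vee(\psi\Rightarrow\varphi)$ and $\neg((\varphi\Leftarrow\psi)\wedge(\psi\Leftarrow\varphi))$; (IV) $\neg\mathsf X\bot$; $\mathsf X(\varphi\vee\psi)\Rightarrow(\mathsf X\varphi\vee\mathsf X\psi)$; $(\mathsf X\varphi\wedge\mathsf X\psi)\Rightarrow\mathsf X(\varphi\wedge\psi)$; $\mathsf X(\varphi\Rightarrow\psi)\Leftrightarrow(\mathsf X\varphi\Rightarrow\mathsf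 X\psi)$; $\mathsf G(\varphi\Rightarrow\psi)\Rightarrow(\mathsf G\varphi\Rightarrow\mathsf G\psi)$; $\mathsf G(\varphi\Rightarrow\psi)\Rightarrow(\theta\,\mathsf U\,\varphi\Rightarrow\theta\,\mathsf U\,\psi)$; $\mathsf G(\varphi\Rightarrow\psi)\Rightarrow(\varphi\,\mathsf U\,\theta\Rightarrow\psi\,\mathsf U\,\theta)$; $\mathsf G\varphi\Rightarrow\varphi\wedge\mathsf X\mathsf G\varphi$; $\psi\vee(\varphi\wedge\mathsf X(\varphi\,\mathsf U\,\psi))\Rightarrow\varphi\,\mathsf U\,\psi$; $\mathsf G(\varphi\Rightarrow\mathsf X\varphi)\Rightarrow(\varphi\Rightarrow\mathsf G\varphi)$; $\mathsf G(\psi\wedge\mathsf X\varphi\Rightarrow\varphi)\Rightarrow(\psi\,\mathsf U\,\varphi\Rightarrow\varphi)$; and the same eleven with $\mathsf X,\mathsf G,\mathsf U$ replaced by $\mathsf Y,\mathsf H,\mathsf S$; (V) $\varphi\Leftrightarrow\mathsf X\mathsf Y\varphi$, $\varphi\Leftrightarrow\mathsf Y\mathsf X\varphi$; closed under: from $\varphi\Rightarrow\psi$ infer $(\varphi\Leftarrow\theta)\Rightarrow(\psi\Leftarrow\theta)$; from $\varphi\Rightarrow\psi\vee\gamma$ infer $(\varphi\Leftarrow\psi)\Rightarrow\gamma$; modus ponens; necessitation for $\mathsf X,\mathsf Y,\mathsf G,\mathsf H$. Real-valued semantics: a flow $(T,S)$, $S$ a bijection; $V\colon\mathcal L\times T\to[0,1]$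 with $\min,\max$ for $\wedge,\vee$; $V(\varphi\Rightarrow\psi,t)=1$ if $V(\varphi,t)\le V(\psi,t)$ else $V(\psi,t)$; $V(\varphi\Leftarrow\psi,t)=0$ if $V(\varphi,t)\le V(\psi,t)$ else $V(\varphi,t)$; $V(\mathsf X\varphi,t)=V(\varphi,St)$; $V(\mathsf Y\varphi,t)=V(\varphi,S^{-1}t)$; $V(\mathsf G\varphi,t)=\inf_{n\ge0}V(\varphi,S^nt)$; $V(\mathsf H\varphi,t)=\inf_{n\ge0}V(\varphi,S^{-n}t)$; $V(\varphi\,\mathsf U\,\psi,t)=\sup_{n\ge0}\min\{V(\varphi,S^0t),\dots,V(\varphi,S^{n-1}t),V(\psi,S^nt)\}$; $\mathsf S$ dually with $S^{-i}$. $\mathsf G_\mathbb R$: formulas with $V=1$ everywhere for all flows and valuations. Bi-relational semantics: $(W,T,\le,S)$ with $(W,\le)$ linear; $[\![\cdot]\!]\colon\mathcal L\to2^{W\times T}$ with $[\![p]\!]$ downward closed in the first coordinate; $\cap,\cup$ for $\wedge,\vee$; $(w,t)\in[\![\varphi\Rightarrow\psi]\!]$ iff $\forall v\le w\,((v,t)\in[\![\varphi]\!]\to(v,t)\in[\![\psi]\!])$; $(w,t)\in[\![\varphi\Leftarrow\psi]\!]$ iff $\exists v\ge w\,((v,t)\in[\![\varphi]\!]\setminus[\![\psi]\!])$; $\mathsf X$: $(w,St)$; $\mathsf Y$: $(w,S^{-1}t)$; $\mathsf G$: all $(w,S^nt)$, $n\ge0$; $\mathsf H$: all $(w,S^{-n}t)$;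 $\mathsf U$: some $n\ge0$ with $\psi$ at $(w,S^nt)$ and $\varphi$ at $(w,S^it)$ for $i<n$; $\mathsf S$ dually. $\mathsf G_{\mathrm{rel}}$: formulas with $[\![\varphi]\!]=W\times T$ for all frames and valuations. *)

theory Defs
  imports Complex_Main
begin

datatype form =
    Var nat
  | And form form
  | Or form form
  | Imp form form
  | Coimp form form
  | Next form
  | Prev form
  | Glob form
  | Hist form
  | Until form form
  | Since form form

definition Top :: form where "Top = Imp (Var 0) (Var 0)"
definition Bot :: form where "Bot = Coimp (Var 0) (Var 0)"
definition Neg :: "form \<Rightarrow> form" where "Neg \<phi> = Imp \<phi> Bot"
definition Iff :: "form \<Rightarrow> form \<Rightarrow> form" where
  "Iff \<phi> \<psi> = And (Imp \<phi> \<psi>) (Imp \<psi> \<phi>)"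

datatype ipf = PVar nat | PBot | PAnd ipf ipf | POr ipf ipf | PImp ipf ipf

inductive_set IPC :: "ipf set" where
  ipc_K: "PImp A (PImp B A) \<in> IPC"
| ipc_S: "PImp (PImp A (PImp B C)) (PImp (PImp A B) (PImp A C)) \<in> IPC"
| ipc_and1: "PImp (PAnd A B) A \<in> IPC"
| ipc_and2: "PImp (PAnd A B) B \<in> IPC"
| ipc_andI: "PImp A (PImp B (PAnd A B)) \<in> IPC"
| ipc_or1: "PImp A (POr A B) \<in> IPC"
| ipc_or2: "PImp B (POr A B) \<in> IPC"
| ipc_orE: "PImp (PImp A C) (PImp (PImp B C) (PImp (POr A B) C)) \<in> IPC"
| ipc_efq: "PImp PBot A \<in> IPC"
| ipc_mp: "PImp A B \<in> IPC \<Longrightarrow> A \<in> IPC \<Longrightarrow> B \<in> IPC"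

primrec subst :: "(nat \<Rightarrow> form) \<Rightarrow> ipf \<Rightarrow> form" where
  "subst \<sigma> (PVar n) = \<sigma> n"
| "subst \<sigma> PBot = Bot"
| "subst \<sigma> (PAnd A B) = And (subst \<sigma> A) (subst \<sigma> B)"
| "subst \<sigma> (POr A B) = Or (subst \<sigma> A) (subst \<sigma> B)"
| "subst \<sigma> (PImp A B) = Imp (subst \<sigma> A) (subst \<sigma> B)"

definition temporal_axioms ::
  "(form \<Rightarrow> form) \<Rightarrow> (form \<Rightarrow> form) \<Rightarrow> (form \<Rightarrow> form \<Rightarrow> form) \<Rightarrow> form set" where
  "temporal_axioms N Gl U =
     {Neg (N Bot)}
   \<union> {Imp (N (Or \<phi> \<psi>)) (Or (N \<phi>) (N \<psi>)) | \<phi> \<psi>. True}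
   \<union> {Imp (And (N \<phi>) (N \<psi>)) (N (And \<phi> \<psi>)) | \<phi> \<psi>. True}
   \<union> {Iff (N (Imp \<phi> \<psi>)) (Imp (N \<phi>) (N \<psi>)) | \<phi> \<psi>. True}
   \<union> {Imp (Gl (Imp \<phi> \<psi>)) (Imp (Gl \<phi>) (Gl \<psi>)) | \<phi> \<psi>. True}
   \<union> {Imp (Gl (Imp \<phi> \<psi>)) (Imp (U \<theta> \<phi>) (U \<theta> \<psi>)) | \<phi> \<psi> \<theta>. True}
   \<union> {Imp (Gl (Imp \<phi> \<psi>)) (Imp (U \<phi> \<theta>) (U \<psi> \<theta>)) | \<phi> \<psi> \<theta>. True}
   \<union> {Imp (Gl \<phi>) (And \<phi> (N (Gl \<phi>))) | \<phi>. True}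
   \<union> {Imp (Or \<psi> (And \<phi> (N (U \<phi> \<psi>)))) (U \<phi> \<psi>) | \<phi> \<psi>. True}
   \<union> {Imp (Gl (Imp \<phi> (N \<phi>))) (Imp \<phi> (Gl \<phi>)) | \<phi>. True}
   \<union> {Imp (Gl (Imp (And \<psi> (N \<phi>)) \<phi>)) (Imp (U \<psi> \<phi>) \<phi>) | \<phi> \<psi>. True}"

inductive_set GTL :: "form set" where
  ax_int: "A \<in> IPC \<Longrightarrow> subst \<sigma> A \<in> GTL"
| ax_coimp: "Imp \<phi> (Or \<psi> (Coimp \<phi> \<psi>)) \<in> GTL"
| ax_prelin: "Or (Imp \<phi> \<psi>) (Imp \<psi> \<phi>) \<in> GTL"
| ax_coprelin: "Neg (And (Coimp \<phi> \<psi>) (Coimp \<psi> \<phi>)) \<in> GTL"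
| ax_future: "\<phi> \<in> temporal_axioms Next Glob Until \<Longrightarrow> \<phi> \<in> GTL"
| ax_past: "\<phi> \<in> temporal_axioms Prev Hist Since \<Longrightarrow> \<phi> \<in> GTL"
| ax_XY: "Iff \<phi> (Next (Prev \<phi>)) \<in> GTL"
| ax_YX: "Iff \<phi> (Prev (Next \<phi>)) \<in> GTL"
| rule_coimp_mono: "Imp \<phi> \<psi> \<in> GTL \<Longrightarrow> Imp (Coimp \<phi> \<theta>) (Coimp \<psi> \<theta>) \<in> GTL"
| rule_coimp_res: "Imp \<phi> (Or \<psi> \<gamma>) \<in> GTL \<Longrightarrow> Imp (Coimp \<phi> \<psi>) \<gamma> \<in> GTL"
| rule_mp: "Imp \<phi> \<psi> \<in> GTL \<Longrightarrow> \<phi> \<in> GTL \<Longrightarrow> \<psi> \<in> GTL"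
| nec_X: "\<phi> \<in> GTL \<Longrightarrow> Next \<phi> \<in> GTL"
| nec_Y: "\<phi> \<in> GTL \<Longrightarrow> Prev \<phi> \<in> GTL"
| nec_G: "\<phi> \<in> GTL \<Longrightarrow> Glob \<phi> \<in> GTL"
| nec_H: "\<phi> \<in> GTL \<Longrightarrow> Hist \<phi> \<in> GTL"

text \<open>A flow is a carrier set T with a bijection S of T; S^{-1} is inv_into T S.
  val gives the truth value of each atom at each time point.\<close>
primrec evalR :: "'t set \<Rightarrow> ('t \<Rightarrow> 't) \<Rightarrow> (nat \<Rightarrow> 't \<Rightarrow> real) \<Rightarrow> form \<Rightarrow> 't \<Rightarrow> real" where
  "evalR T S val (Var p) t = val p t"
| "evalR T S val (And \<phi> \<psi>) t = min (evalR T S val \<phi> t) (evalR T S val \<psi> t)"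
| "evalR T S val (Or \<phi> \<psi>) t = max (evalR T S val \<phi> t) (evalR T S val \<psi> t)"
| "evalR T S val (Imp \<phi> \<psi>) t =
     (if evalR T S val \<phi> t \<le> evalR T S val \<psi> t then 1 else evalR T S val \<psi> t)"
| "evalR T S val (Coimp \<phi> \<psi>) t =
     (if evalR T S val \<phi> t \<le> evalR T S val \<psi> t then 0 else evalR T S val \<phi> t)"
| "evalR T S val (Next \<phi>) t = evalR T S val \<phi> (S t)"
| "evalR T S val (Prev \<phi>) t = evalR T S val \<phi> (inv_into T S t)"
| "evalR T S val (Glob \<phi>) t = (INF n. evalR T S val \<phi> ((S ^^ n) t))"
| "evalR T S val (Hist \<phi>) t = (INF n. evalR T S val \<phi> ((inv_into T S ^^ n) t))"
| "evalR T S val (Until \<phi> \<psi>) t =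
     (SUP n. Min (insert (evalR T S val \<psi> ((S ^^ n) t))
                         ((\<lambda>i. evalR T S val \<phi> ((S ^^ i) t)) ` {..<n})))"
| "evalR T S val (Since \<phi> \<psi>) t =
     (SUP n. Min (insert (evalR T S val \<psi> ((inv_into T S ^^ n) t))
                         ((\<lambda>i. evalR T S val \<phi> ((inv_into T S ^^ i) t)) ` {..<n})))"

definition G_R :: "'t itself \<Rightarrow> form set" where
  "G_R (_::'t itself) = {\<phi>. \<forall>(T::'t set) S val.
      bij_betw S T T \<and> (\<forall>p. \<forall>t\<in>T. 0 \<le> val p t \<and> val p t \<le> 1)
      \<longrightarrow> (\<forall>t\<in>T. evalR T S val \<phi> t = 1)}"

text \<open>Frame: carrier W with linear order le ((v,w) \<in> le means v \<le> w),
  flow (T,S); P p is the truth set of atom p.\<close>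
primrec satB :: "'w set \<Rightarrow> ('w \<times> 'w) set \<Rightarrow> 't set \<Rightarrow> ('t \<Rightarrow> 't)
                 \<Rightarrow> (nat \<Rightarrow> ('w \<times> 't) set) \<Rightarrow> form \<Rightarrow> 'w \<Rightarrow> 't \<Rightarrow> bool" where
  "satB W le T S P (Var p) w t = ((w, t) \<in> P p)"
| "satB W le T S P (And \<phi> \<psi>) w t = (satB W le T S P \<phi> w t \<and> satB W le T S P \<psi> w t)"
| "satB W le T S P (Or \<phi> \<psi>) w t = (satB W le T S P \<phi> w t \<or> satB W le T S P \<psi> w t)"
| "satB W le T S P (Imp \<phi> \<psi>) w t =
     (\<forall>v\<in>W. (v, w) \<in> le \<longrightarrow> satB W le T S P \<phi> v t \<longrightarrow> satB W le T S P \<psi> v t)"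
| "satB W le T S P (Coimp \<phi> \<psi>) w t =
     (\<exists>v\<in>W. (w, v) \<in> le \<and> satB W le T S P \<phi> v t \<and> \<not> satB W le T S P \<psi> v t)"
| "satB W le T S P (Next \<phi>) w t = satB W le T S P \<phi> w (S t)"
| "satB W le T S P (Prev \<phi>) w t = satB W le T S P \<phi> w (inv_into T S t)"
| "satB W le T S P (Glob \<phi>) w t = (\<forall>n. satB W le T S P \<phi> w ((S ^^ n) t))"
| "satB W le T S P (Hist \<phi>) w t = (\<forall>n. satB W le T S P \<phi> w ((inv_into T S ^^ n) t))"
| "satB W le T S P (Until \<phi> \<psi>) w t =
     (\<exists>n. satB W le T S P \<psi> w ((S ^^ n) t) \<and> (\<forall>i<n. satB W le T S P \<phi> w ((S ^^ i) t)))"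
| "satB W le T S P (Since \<phi> \<psi>) w t =
     (\<exists>n. satB W le T S P \<psi> w ((inv_into T S ^^ n) t)
          \<and> (\<forall>i<n. satB W le T S P \<phi> w ((inv_into T S ^^ i) t)))"

definition G_rel :: "'w itself \<Rightarrow> 't itself \<Rightarrow> form set" where
  "G_rel (_::'w itself) (_::'t itself) = {\<phi>. \<forall>(W::'w set) le (T::'t set) S P.
      linear_order_on W le \<and> bij_betw S T T
      \<and> (\<forall>p. \<forall>w\<in>W. \<forall>v\<in>W. \<forall>t\<in>T. (v, w) \<in> le \<and> (w, t) \<in> P p \<longrightarrow> (v, t) \<in> P p)
      \<longrightarrow> (\<forall>w\<in>W. \<forall>t\<in>T. satB W le T S P \<phi> w t)}"

end

theory Submission
  imports Defs "HOL-Library.Countable_Set"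
begin

text \<open>
  Prime theories, ordered by inclusion, fall into linearly ordered components, and shifting by
  \<open>Next\<close> is an automorphism with inverse \<open>Prev\<close>. This canonical structure need not satisfy the
  infinitary clauses, so it is cut down to a finite set \<open>\<Sigma>\<close> of subformulas: a component leaves
  behind a moment, the finite chain of its traces on \<open>\<Sigma>\<close>. Since the Baaz delta is definable, a
  single formula expresses which moment the present component has, and then the induction axioms
  show that every pending eventuality of a point of a moment is fulfilled along some finite
  walk. A fair bi-infinite walk through the moments is a timeline on which every point
  lies on a path fulfilling all its eventualities in both directions. Paths cross only where they
  meet, so by switching at meeting points a countable linearly ordered set of such paths can be
  made to pass through every point; these paths are the worlds of a bi-relational countermodel over the
  integers. As there are countably many worlds, giving them summable weights turns downward
  closed sets into reals, which yields a real-valued countermodel as well.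
\<close>

section \<open>Prime theories\<close>

text \<open>The obstacle behind the paths is nondeterminism. Theories with equal traces on \<Sigma>
  may have shifts with different traces, so an edge between moments is a relation rather than a
  function: points can split and merge, and successors are sure to be ordered as x' \<subseteq> y'
  only if x lies strictly inside y. Hence a world has to be a whole path, not a point. A second
  obstacle is that a fair walk meets each eventuality of a point along some branch, possibly a
  different branch for each. One branch meeting all of them comes from running the same argument
  again inside the timeline, with single time-stamped points as moments
  (\<open>fulfilling_path\<close>); this works because an unmet eventuality stays pending along
  every edge. The induction axioms need invariants expressed by formulas, and what a formula defines
  is closed under passing to larger theories; classical negation is available only for properties of
  the whole component. So the invariants describe the place of a theory in its moment by comparing
  it with unfulfillable traces above it (for \<open>U\<close>) or below it (for
  \<open>Gl\<close>).\<close>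

definition deductive :: "form set \<Rightarrow> bool" where
  "deductive \<Gamma> \<longleftrightarrow> GTL \<subseteq> \<Gamma> \<and> (\<forall>a b. Imp a b \<in> \<Gamma> \<longrightarrow> a \<in> \<Gamma> \<longrightarrow> b \<in> \<Gamma>)"

definition prime_theory :: "form set \<Rightarrow> bool" where
  "prime_theory \<Gamma> \<longleftrightarrow> deductive \<Gamma> \<and> Bot \<notin> \<Gamma> \<and> (\<forall>a b. Or a b \<in> \<Gamma> \<longrightarrow> a \<in> \<Gamma> \<or> b \<in> \<Gamma>)"

definition subst3 :: "form \<Rightarrow> form \<Rightarrow> form \<Rightarrow> nat \<Rightarrow> form" where
  "subst3 a b c n = (if n = 0 then a else if n = 1 then b else c)"

context
  fixes a b c :: form
begin

lemma gtl_K: "Imp a (Imp b a) \<in> GTL"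
  using ax_int[OF ipc_K[of "PVar 0" "PVar 1"], of "subst3 a b c"] by (simp add: subst3_def)

lemma gtl_S: "Imp (Imp a (Imp b c)) (Imp (Imp a b) (Imp a c)) \<in> GTL"
  using ax_int[OF ipc_S[of "PVar 0" "PVar 1" "PVar 2"], of "subst3 a b c"] by (simp add: subst3_def)

lemma gtl_and1: "Imp (And a b) a \<in> GTL"
  using ax_int[OF ipc_and1[of "PVar 0" "PVar 1"], of "subst3 a b c"] by (simp add: subst3_def)

lemma gtl_and2: "Imp (And a b) b \<in> GTL"
  using ax_int[OF ipc_and2[of "PVar 0" "PVar 1"], of "subst3 a b c"] by (simp add: subst3_def)

lemma gtl_andI: "Imp a (Imp b (And a b)) \<in> GTL"
  using ax_int[OF ipc_andI[of "PVar 0" "PVar 1"], of "subst3 a b c"] by (simp add: subst3_def)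

lemma gtl_or1: "Imp a (Or a b) \<in> GTL"
  using ax_int[OF ipc_or1[of "PVar 0" "PVar 1"], of "subst3 a b c"] by (simp add: subst3_def)

lemma gtl_or2: "Imp b (Or a b) \<in> GTL"
  using ax_int[OF ipc_or2[of "PVar 1" "PVar 0"], of "subst3 a b c"] by (simp add: subst3_def)

lemma gtl_orE: "Imp (Imp a c) (Imp (Imp b c) (Imp (Or a b) c)) \<in> GTL"
  using ax_int[OF ipc_orE[of "PVar 0" "PVar 2" "PVar 1"], of "subst3 a b c"] by (simp add: subst3_def)

lemma gtl_efq: "Imp Bot a \<in> GTL"
  using ax_int[OF ipc_efq[of "PVar 0"], of "subst3 a b c"] by (simp add: subst3_def)

end

lemma deductive_GTL: "deductive GTL"
  unfolding deductive_def by (blast intro: rule_mp)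

lemma deductive_mp: "deductive \<Gamma> \<Longrightarrow> Imp a b \<in> \<Gamma> \<Longrightarrow> a \<in> \<Gamma> \<Longrightarrow> b \<in> \<Gamma>"
  unfolding deductive_def by blast

lemma deductive_weaken: "deductive \<Gamma> \<Longrightarrow> Imp a b \<in> GTL \<Longrightarrow> a \<in> \<Gamma> \<Longrightarrow> b \<in> \<Gamma>"
  unfolding deductive_def by blast

lemma deductive_K: "deductive \<Gamma> \<Longrightarrow> b \<in> \<Gamma> \<Longrightarrow> Imp a b \<in> \<Gamma>"
  using deductive_weaken gtl_K by blast

lemma deductive_imp_mp:
  "deductive \<Gamma> \<Longrightarrow> Imp a (Imp b c) \<in> \<Gamma> \<Longrightarrow> Imp a b \<in> \<Gamma> \<Longrightarrow> Imp a c \<in> \<Gamma>"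
  using deductive_weaken gtl_S deductive_mp by blast

lemma deductive_imp_refl: "deductive \<Gamma> \<Longrightarrow> Imp a a \<in> \<Gamma>"
  by (meson deductive_imp_mp deductive_def gtl_K subsetD)

lemma deductive_imp_trans:
  "deductive \<Gamma> \<Longrightarrow> Imp a b \<in> \<Gamma> \<Longrightarrow> Imp b c \<in> \<Gamma> \<Longrightarrow> Imp a c \<in> \<Gamma>"
  using deductive_imp_mp deductive_K by blast

text \<open>The deduction theorem: this is the theory generated by \<Gamma> and \<open>a\<close>. It
  holds because \<open>deductive\<close> asks for closure under modus ponens alone, the other rules
  being applied only to members of \<open>GTL\<close>.\<close>

lemma deductive_relative: "deductive \<Gamma> \<Longrightarrow> deductive {c. Imp a c \<in> \<Gamma>}"
  by (auto simp: deductive_def[of "{c. Imp a c \<in> \<Gamma>}"] intro: deductive_imp_mp deductive_K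
      dest: deductive_def[THEN iffD1])

lemma deductive_or_mono:
  assumes "deductive \<Gamma>" "Imp a c \<in> \<Gamma>" "Imp b d \<in> \<Gamma>"
  shows "Imp (Or a b) (Or c d) \<in> \<Gamma>"
proof -
  have G: "GTL \<subseteq> \<Gamma>" using assms(1) by (simp add: deductive_def)
  have "Imp a (Or c d) \<in> \<Gamma>"
    using deductive_imp_trans[OF assms(1,2)] gtl_or1 G by blast
  moreover have "Imp b (Or c d) \<in> \<Gamma>"
    using deductive_imp_trans[OF assms(1,3)] gtl_or2 G by blast
  ultimately show ?thesis
    using deductive_mp[OF assms(1)] deductive_weaken[OF assms(1) gtl_orE] by blast
qed

lemma deductive_Or_least:
  "deductive \<Gamma> \<Longrightarrow> Imp a c \<in> \<Gamma> \<Longrightarrow> Imp b c \<in> \<Gamma> \<Longrightarrow> Imp (Or a b) c \<in> \<Gamma>"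
  using deductive_mp deductive_weaken[OF _ gtl_orE] by blast

lemma deductive_Union_chain:
  assumes "C \<noteq> {}" "subset.chain {\<Gamma>. deductive \<Gamma>} C"
  shows "deductive (\<Union>C)"
proof -
  have ded: "\<And>\<Gamma>. \<Gamma> \<in> C \<Longrightarrow> deductive \<Gamma>"
    and tot: "\<And>x y. x \<in> C \<Longrightarrow> y \<in> C \<Longrightarrow> x \<subseteq> y \<or> y \<subseteq> x"
    using assms(2) by (auto simp: subset.chain_def)
  have "b \<in> \<Union>C" if ab: "Imp a b \<in> \<Union>C" "a \<in> \<Union>C" for a b
  proof -
    obtain x y where xy: "x \<in> C" "y \<in> C" "Imp a b \<in> x" "a \<in> y"
      using ab by blast
    then have "x \<union> y \<in> C" using tot[of x y] by (auto simp: sup.absorb1 sup.absorb2)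
    then have "b \<in> x \<union> y" using xy deductive_mp[OF ded, of "x \<union> y" a b] by simp
    then show ?thesis using xy by blast
  qed
  moreover have "GTL \<subseteq> \<Union>C"
    using assms(1) ded unfolding deductive_def by (metis Sup_upper2 all_not_in_conv)
  ultimately show ?thesis unfolding deductive_def by blast
qed

text \<open>Separation by Zorn. A theory maximal among those avoiding \<open>B\<close> is prime: if
  it missed both disjuncts, each would imply a member of \<open>B\<close>, and the disjunction would
  force a disjunction of such members.\<close>

lemma prime_extension:
  assumes F: "deductive F" "F \<inter> B = {}" and B: "B \<noteq> {}" "\<And>a b. a \<in> B \<Longrightarrow> b \<in> B \<Longrightarrow> Or a b \<in> B"
  obtains \<Gamma> where "prime_theory \<Gamma>" "F \<subseteq> \<Gamma>" "\<Gamma> \<inter> B = {}"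
proof -
  let ?A = "{\<Gamma>. deductive \<Gamma> \<and> F \<subseteq> \<Gamma> \<and> \<Gamma> \<inter> B = {}}"
  have "\<exists>M\<in>?A. \<forall>X\<in>?A. M \<subseteq> X \<longrightarrow> X = M"
  proof (rule subset_Zorn_nonempty)
    fix C assume C: "C \<noteq> {}" "subset.chain ?A C"
    then have el: "\<And>\<Gamma>. \<Gamma> \<in> C \<Longrightarrow> deductive \<Gamma> \<and> F \<subseteq> \<Gamma> \<and> \<Gamma> \<inter> B = {}"
      and ch: "subset.chain {\<Gamma>. deductive \<Gamma>} C"
      unfolding subset.chain_def by blast+
    have "F \<subseteq> \<Union>C" "\<Union>C \<inter> B = {}" using C(1) el by blast+
    then show "\<Union>C \<in> ?A" using deductive_Union_chain[OF C(1) ch] by blast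
  qed (use F in auto)
  then obtain M where M: "deductive M" "F \<subseteq> M" "M \<inter> B = {}"
    and mx: "\<And>X. deductive X \<Longrightarrow> F \<subseteq> X \<Longrightarrow> X \<inter> B = {} \<Longrightarrow> M \<subseteq> X \<Longrightarrow> X = M"
    by auto
  have out: "\<exists>c\<in>B. Imp a c \<in> M" if "a \<notin> M" for a
  proof (rule ccontr)
    assume "\<not> ?thesis"
    moreover have "M \<subseteq> {c. Imp a c \<in> M}" using deductive_K[OF M(1)] by blast
    ultimately have "{c. Imp a c \<in> M} = M"
      using M(2) by (intro mx[OF deductive_relative[OF M(1)]]) auto
    then show False using that deductive_imp_refl[OF M(1)] by blast
  qed
  have "a \<in> M \<or> b \<in> M" if "Or a b \<in> M" for a b
  proof (rule ccontr)
    assume "\<not> ?thesis"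
    then obtain c d where cd: "c \<in> B" "d \<in> B" "Imp a c \<in> M" "Imp b d \<in> M" using out by blast
    then have "Or c d \<in> M" using deductive_or_mono[OF M(1)] deductive_mp[OF M(1)] that by blast
    then show False using B(2) cd M(3) by blast
  qed
  moreover have "Bot \<notin> M" using deductive_weaken[OF M(1) gtl_efq] B(1) M(3) by blast
  ultimately show thesis using that[of M] M unfolding prime_theory_def by blast
qed

lemma prime_deductive: "prime_theory \<Gamma> \<Longrightarrow> deductive \<Gamma>"
  by (simp add: prime_theory_def)

lemma prime_avoiding:
  assumes "deductive F" "b \<notin> F"
  obtains \<Gamma> where "prime_theory \<Gamma>" "F \<subseteq> \<Gamma>" "b \<notin> \<Gamma>"
proof -
  \<comment> \<open>The singleton of \<open>b\<close> is not closed under disjunction; the ideal of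
    formulas provably below \<open>b\<close> is.\<close>
  let ?B = "{c. Imp c b \<in> GTL}"
  have dis: "F \<inter> ?B = {}" using assms deductive_weaken by blast
  have b: "b \<in> ?B" by (simp add: deductive_imp_refl deductive_GTL)
  then have ne: "?B \<noteq> {}" by blast
  have or: "Or c d \<in> ?B" if "c \<in> ?B" "d \<in> ?B" for c d
    using that by (simp add: deductive_Or_least deductive_GTL)
  obtain \<Gamma> where "prime_theory \<Gamma>" "F \<subseteq> \<Gamma>" "\<Gamma> \<inter> ?B = {}"
    by (rule prime_extension[OF assms(1) dis ne or])
  then show thesis using that b by blast
qed

lemma gtl_iff: "a \<in> GTL \<longleftrightarrow> (\<forall>\<Gamma>. prime_theory \<Gamma> \<longrightarrow> a \<in> \<Gamma>)"
proof
  assume "a \<in> GTL"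
  then show "\<forall>\<Gamma>. prime_theory \<Gamma> \<longrightarrow> a \<in> \<Gamma>"
    by (auto simp: prime_theory_def deductive_def)
next
  assume "\<forall>\<Gamma>. prime_theory \<Gamma> \<longrightarrow> a \<in> \<Gamma>"
  then show "a \<in> GTL" using prime_avoiding[OF deductive_GTL, of a] by metis
qed

lemma prime_Imp:
  assumes "prime_theory \<Gamma>"
  shows "Imp a b \<in> \<Gamma> \<longleftrightarrow> (\<forall>\<Delta>. prime_theory \<Delta> \<longrightarrow> \<Gamma> \<subseteq> \<Delta> \<longrightarrow> a \<in> \<Delta> \<longrightarrow> b \<in> \<Delta>)"
proof
  assume R: "\<forall>\<Delta>. prime_theory \<Delta> \<longrightarrow> \<Gamma> \<subseteq> \<Delta> \<longrightarrow> a \<in> \<Delta> \<longrightarrow> b \<in> \<Delta>"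
  note d = prime_deductive[OF assms]
  show "Imp a b \<in> \<Gamma>"
  proof (rule ccontr)
    assume "Imp a b \<notin> \<Gamma>"
    then obtain \<Delta> where "prime_theory \<Delta>" "{c. Imp a c \<in> \<Gamma>} \<subseteq> \<Delta>" "b \<notin> \<Delta>"
      using prime_avoiding[OF deductive_relative[OF d, of a], of b] by blast
    moreover have "\<Gamma> \<subseteq> {c. Imp a c \<in> \<Gamma>}" "a \<in> {c. Imp a c \<in> \<Gamma>}"
      using deductive_K[OF d] deductive_imp_refl[OF d] by blast+
    ultimately show False using R by blast
  qed
next
  assume "Imp a b \<in> \<Gamma>"
  then show "\<forall>\<Delta>. prime_theory \<Delta> \<longrightarrow> \<Gamma> \<subseteq> \<Delta> \<longrightarrow> a \<in> \<Delta> \<longrightarrow> b \<in> \<Delta>"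
    by (meson deductive_mp prime_deductive subsetD)
qed

text \<open>With \<open>gtl_iff\<close> this turns derivability into set reasoning, so that
  propositional derivations are replaced by the membership clauses of prime theories.\<close>

lemma gtl_Imp: "Imp a b \<in> GTL \<longleftrightarrow> (\<forall>\<Gamma>. prime_theory \<Gamma> \<longrightarrow> a \<in> \<Gamma> \<longrightarrow> b \<in> \<Gamma>)"
  unfolding gtl_iff using prime_Imp by (metis subset_refl)

lemma prime_And: "prime_theory \<Gamma> \<Longrightarrow> And a b \<in> \<Gamma> \<longleftrightarrow> a \<in> \<Gamma> \<and> b \<in> \<Gamma>"
  by (meson deductive_mp deductive_weaken gtl_and1 gtl_and2 gtl_andI prime_deductive)

lemma prime_Or: "prime_theory \<Gamma> \<Longrightarrow> Or a b \<in> \<Gamma> \<longleftrightarrow> a \<in> \<Gamma> \<or> b \<in> \<Gamma>"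
  by (meson deductive_weaken gtl_or1 gtl_or2 prime_theory_def)

lemma prime_Bot: "prime_theory \<Gamma> \<Longrightarrow> Bot \<notin> \<Gamma>"
  by (simp add: prime_theory_def)

lemma prime_Top: "prime_theory \<Gamma> \<Longrightarrow> Top \<in> \<Gamma>"
  unfolding Top_def by (simp add: deductive_imp_refl prime_deductive)

lemma gtl_Iff: "Iff a b \<in> GTL \<longleftrightarrow> Imp a b \<in> GTL \<and> Imp b a \<in> GTL"
  by (metis Iff_def gtl_iff prime_And)

lemma prime_Neg:
  "prime_theory \<Gamma> \<Longrightarrow> Neg a \<in> \<Gamma> \<longleftrightarrow> (\<forall>\<Delta>. prime_theory \<Delta> \<longrightarrow> \<Gamma> \<subseteq> \<Delta> \<longrightarrow> a \<notin> \<Delta>)"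
  unfolding Neg_def using prime_Bot by (auto simp: prime_Imp)

lemma prime_Coimp:
  assumes "prime_theory \<Gamma>"
  shows "Coimp a b \<in> \<Gamma> \<longleftrightarrow> (\<exists>\<Delta>. prime_theory \<Delta> \<and> \<Delta> \<subseteq> \<Gamma> \<and> a \<in> \<Delta> \<and> b \<notin> \<Delta>)"
proof
  assume c: "Coimp a b \<in> \<Gamma>"
  \<comment> \<open>The theory sought must lie inside \<Gamma>, so the complement of \<Gamma> has to
    be avoided as well as \<open>b\<close>. This is the ideal generated by both; it is closed under
    disjunction because \<Gamma> is prime.\<close>
  let ?B = "{c. \<exists>g. g \<notin> \<Gamma> \<and> Imp c (Or b g) \<in> GTL}"
  have or: "Or c d \<in> ?B" if cd: "c \<in> ?B" "d \<in> ?B" for c d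
  proof -
    obtain g h where gh: "g \<notin> \<Gamma>" "h \<notin> \<Gamma>" "Imp c (Or b g) \<in> GTL" "Imp d (Or b h) \<in> GTL"
      using cd by blast
    then have "Or g h \<notin> \<Gamma>" using assms prime_Or by blast
    moreover have "Imp (Or c d) (Or b (Or g h)) \<in> GTL"
      using gh by (auto simp: gtl_Imp prime_Or)
    ultimately show ?thesis by blast
  qed
  \<comment> \<open>This is where \<open>rule_coimp_res\<close> enters: a derivable
    \<open>Imp a (Or b g)\<close> and \<open>Coimp a b\<close> in \<Gamma> force \<open>g\<close>
    into \<Gamma>.\<close>
  have dis: "{c. Imp a c \<in> GTL} \<inter> ?B = {}"
  proof -
    have "g \<in> \<Gamma>" if "Imp a (Or b g) \<in> GTL" for g
      using deductive_weaken[OF prime_deductive[OF assms] rule_coimp_res[OF that] c] .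
    then show ?thesis using deductive_imp_trans[OF deductive_GTL, of a] by fast
  qed
  have bB: "b \<in> ?B" and gB: "- \<Gamma> \<subseteq> ?B"
    using prime_Bot[OF assms] gtl_or1 gtl_or2 by auto
  have ne: "?B \<noteq> {}" using bB by blast
  obtain \<Delta> where "prime_theory \<Delta>" "{c. Imp a c \<in> GTL} \<subseteq> \<Delta>" "\<Delta> \<inter> ?B = {}"
    by (rule prime_extension[OF deductive_relative[OF deductive_GTL] dis ne or])
  moreover have "a \<in> {c. Imp a c \<in> GTL}" by (simp add: deductive_imp_refl deductive_GTL)
  ultimately show "\<exists>\<Delta>. prime_theory \<Delta> \<and> \<Delta> \<subseteq> \<Gamma> \<and> a \<in> \<Delta> \<and> b \<notin> \<Delta>"
    using bB gB by blast
next
  assume "\<exists>\<Delta>. prime_theory \<Delta> \<and> \<Delta> \<subseteq> \<Gamma> \<and> a \<in> \<Delta> \<and> b \<notin> \<Delta>"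
  then obtain \<Delta> where D: "prime_theory \<Delta>" "\<Delta> \<subseteq> \<Gamma>" "a \<in> \<Delta>" "b \<notin> \<Delta>" by blast
  then show "Coimp a b \<in> \<Gamma>" using ax_coimp[of a b] unfolding gtl_Imp by (auto simp: prime_Or)
qed

section \<open>Linearly ordered components of the inclusion order\<close>

definition component :: "form set \<Rightarrow> form set set" where
  "component \<Gamma> = {\<Delta>. prime_theory \<Delta> \<and> (\<Gamma> \<subseteq> \<Delta> \<or> \<Delta> \<subseteq> \<Gamma>)}"

text \<open>Prelinearity at the common subset: one of the two implications lies in \<Gamma> and
  carries a witness of incomparability into the wrong theory.\<close>

lemma prime_supersets_comparable:
  assumes "prime_theory \<Gamma>" "prime_theory \<Delta>" "prime_theory \<Delta>'" "\<Gamma> \<subseteq> \<Delta>" "\<Gamma> \<subseteq> \<Delta>'"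
  shows "\<Delta> \<subseteq> \<Delta>' \<or> \<Delta>' \<subseteq> \<Delta>"
proof (rule ccontr)
  assume "\<not> ?thesis"
  then obtain a b where "a \<in> \<Delta>" "a \<notin> \<Delta>'" "b \<in> \<Delta>'" "b \<notin> \<Delta>" by blast
  moreover have "Imp a b \<in> \<Gamma> \<or> Imp b a \<in> \<Gamma>"
    using ax_prelin[of a b] assms(1) unfolding gtl_iff by (auto simp: prime_Or)
  ultimately show False using assms by (auto simp: prime_Imp)
qed

text \<open>Two incomparable subtheories would witness both coimplications in \<Gamma>, which dual
  prelinearity excludes.\<close>

lemma prime_subsets_comparable:
  assumes "prime_theory \<Gamma>" "prime_theory \<Delta>" "prime_theory \<Delta>'" "\<Delta> \<subseteq> \<Gamma>" "\<Delta>' \<subseteq> \<Gamma>"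
  shows "\<Delta> \<subseteq> \<Delta>' \<or> \<Delta>' \<subseteq> \<Delta>"
proof (rule ccontr)
  assume "\<not> ?thesis"
  then obtain a b where "a \<in> \<Delta>" "a \<notin> \<Delta>'" "b \<in> \<Delta>'" "b \<notin> \<Delta>" by blast
  then have "Coimp a b \<in> \<Gamma>" "Coimp b a \<in> \<Gamma>" using assms by (auto simp: prime_Coimp)
  moreover have "Neg (And (Coimp a b) (Coimp b a)) \<in> \<Gamma>"
    using ax_coprelin[of a b] assms(1) by (simp add: gtl_iff)
  ultimately show False using assms(1) by (auto simp: prime_Neg prime_And)
qed

lemma component_comparable:
  assumes "prime_theory \<Gamma>" "\<Delta> \<in> component \<Gamma>" "\<Delta>' \<in> component \<Gamma>"
  shows "\<Delta> \<subseteq> \<Delta>' \<or> \<Delta>' \<subseteq> \<Delta>"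
  using assms prime_supersets_comparable[of \<Gamma> \<Delta> \<Delta>'] prime_subsets_comparable[of \<Gamma> \<Delta> \<Delta>']
  unfolding component_def by blast

lemma component_refl: "prime_theory \<Gamma> \<Longrightarrow> \<Gamma> \<in> component \<Gamma>"
  by (simp add: component_def)

lemma component_prime: "\<Delta> \<in> component \<Gamma> \<Longrightarrow> prime_theory \<Delta>"
  by (simp add: component_def)

text \<open>Theories comparable with a common one are comparable with each other, so comparability
  is an equivalence relation and a component can be computed from any of its members.\<close>

lemma component_eq:
  assumes "prime_theory \<Gamma>" "\<Delta> \<in> component \<Gamma>"
  shows "component \<Delta> = component \<Gamma>"
proof -
  have "component \<Gamma> \<subseteq> component \<Delta>" if "prime_theory \<Gamma>" "\<Delta> \<in> component \<Gamma>" for \<Gamma> \<Delta>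
    using component_comparable[OF that(1) that(2)] component_prime
    unfolding component_def[of \<Delta>] by blast
  moreover have "\<Gamma> \<in> component \<Delta>" "prime_theory \<Delta>" using assms by (auto simp: component_def)
  ultimately show ?thesis using assms by blast
qed

text \<open>The formula \<open>Neg (Coimp Top a)\<close> is the Baaz delta of \<open>a\<close>: it takes only two values.\<close>

lemma prime_Delta:
  assumes "prime_theory \<Gamma>"
  shows "Neg (Coimp Top a) \<in> \<Gamma> \<longleftrightarrow> (\<forall>\<Delta>\<in>component \<Gamma>. a \<in> \<Delta>)"
proof
  assume L: "Neg (Coimp Top a) \<in> \<Gamma>"
  show "\<forall>\<Delta>\<in>component \<Gamma>. a \<in> \<Delta>"
  proof
    fix \<Delta> assume D: "\<Delta> \<in> component \<Gamma>"
    then have "prime_theory \<Delta>" by (rule component_prime)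
    \<comment> \<open>The union is the larger of the two theories. It lies above both, so the
      negation can be evaluated there with \<Delta> as a possible witness of the
      coimplication.\<close>
    have "\<Gamma> \<subseteq> \<Gamma> \<union> \<Delta>" "\<Delta> \<subseteq> \<Gamma> \<union> \<Delta>" "prime_theory (\<Gamma> \<union> \<Delta>)"
      using D assms by (auto simp: component_def sup.absorb1 sup.absorb2)
    then have "Coimp Top a \<notin> \<Gamma> \<union> \<Delta>" using L assms prime_Neg by blast
    then show "a \<in> \<Delta>"
      using prime_Coimp[OF \<open>prime_theory (\<Gamma> \<union> \<Delta>)\<close>] \<open>\<Delta> \<subseteq> \<Gamma> \<union> \<Delta>\<close> \<open>prime_theory \<Delta>\<close>
        prime_Top[OF \<open>prime_theory \<Delta>\<close>] by blast
  qed
next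
  assume R: "\<forall>\<Delta>\<in>component \<Gamma>. a \<in> \<Delta>"
  have "a \<in> \<Delta>'" if "prime_theory \<Delta>" "\<Gamma> \<subseteq> \<Delta>" "prime_theory \<Delta>'" "\<Delta>' \<subseteq> \<Delta>" for \<Delta> \<Delta>'
  proof -
    have "\<Delta>' \<in> component \<Delta>" "component \<Delta> = component \<Gamma>"
      using that component_eq[OF assms, of \<Delta>] by (auto simp: component_def)
    then show ?thesis using R by simp
  qed
  then show "Neg (Coimp Top a) \<in> \<Gamma>"
    using assms by (auto simp: prime_Neg prime_Coimp)
qed

section \<open>Definability\<close>

text \<open>Such properties are closed under passing to larger prime theories, so complements are
  not definable in general; \<open>definable_component_imp\<close> supplies a case where they
  are.\<close>

definition definable :: "(form set \<Rightarrow> bool) \<Rightarrow> bool" where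
  "definable Q \<longleftrightarrow> (\<exists>a. \<forall>\<Gamma>. prime_theory \<Gamma> \<longrightarrow> (Q \<Gamma> \<longleftrightarrow> a \<in> \<Gamma>))"

lemma definable_member: "definable (\<lambda>\<Gamma>. a \<in> \<Gamma>)"
  unfolding definable_def by blast

lemma definable_const: "definable (\<lambda>\<Gamma>. c)"
  unfolding definable_def using prime_Top prime_Bot by (cases c) blast+

lemma definable_conj: "definable Q \<Longrightarrow> definable R \<Longrightarrow> definable (\<lambda>\<Gamma>. Q \<Gamma> \<and> R \<Gamma>)"
  unfolding definable_def using prime_And by metis

lemma definable_disj: "definable Q \<Longrightarrow> definable R \<Longrightarrow> definable (\<lambda>\<Gamma>. Q \<Gamma> \<or> R \<Gamma>)"
  unfolding definable_def using prime_Or by metis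

lemma definable_Ball:
  assumes "finite I" "\<And>i. i \<in> I \<Longrightarrow> definable (Q i)"
  shows "definable (\<lambda>\<Gamma>. \<forall>i\<in>I. Q i \<Gamma>)"
  using assms by (induction I) (simp_all add: definable_const definable_conj)

lemma definable_Bex:
  assumes "finite I" "\<And>i. i \<in> I \<Longrightarrow> definable (Q i)"
  shows "definable (\<lambda>\<Gamma>. \<exists>i\<in>I. Q i \<Gamma>)"
  using assms by (induction I) (simp_all add: definable_const definable_disj)

text \<open>The formula is the delta of \<open>Imp a b\<close>. As its truth depends only on the
  component, its intuitionistic negation is a classical one, which makes the complement definable
  too.\<close>

lemma definable_component_imp:
  assumes "definable Q" "definable R"
  shows "definable (\<lambda>\<Gamma>. \<forall>\<Delta>\<in>component \<Gamma>. Q \<Delta> \<longrightarrow> R \<Delta>)"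
    and "definable (\<lambda>\<Gamma>. \<not> (\<forall>\<Delta>\<in>component \<Gamma>. Q \<Delta> \<longrightarrow> R \<Delta>))"
proof -
  obtain a b where a: "\<And>\<Gamma>. prime_theory \<Gamma> \<Longrightarrow> Q \<Gamma> \<longleftrightarrow> a \<in> \<Gamma>"
    and b: "\<And>\<Gamma>. prime_theory \<Gamma> \<Longrightarrow> R \<Gamma> \<longleftrightarrow> b \<in> \<Gamma>"
    using assms unfolding definable_def by blast
  let ?d = "Neg (Coimp Top (Imp a b))"
  have 1: "?d \<in> \<Gamma> \<longleftrightarrow> (\<forall>\<Delta>\<in>component \<Gamma>. Q \<Delta> \<longrightarrow> R \<Delta>)" if G: "prime_theory \<Gamma>" for \<Gamma>
  proof -
    have "(\<forall>\<Delta>\<in>component \<Gamma>. Imp a b \<in> \<Delta>) \<longleftrightarrow> (\<forall>\<Delta>\<in>component \<Gamma>. a \<in> \<Delta> \<longrightarrow> b \<in> \<Delta>)"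
    proof
      assume R: "\<forall>\<Delta>\<in>component \<Gamma>. a \<in> \<Delta> \<longrightarrow> b \<in> \<Delta>"
      show "\<forall>\<Delta>\<in>component \<Gamma>. Imp a b \<in> \<Delta>"
      proof
        fix \<Delta> assume D: "\<Delta> \<in> component \<Gamma>"
        have "\<Delta>' \<in> component \<Gamma>" if "prime_theory \<Delta>'" "\<Delta> \<subseteq> \<Delta>'" for \<Delta>'
          using component_eq[OF G D] that by (auto simp: component_def)
        then show "Imp a b \<in> \<Delta>" using R component_prime[OF D] by (auto simp: prime_Imp)
      qed
    qed (meson component_prime deductive_mp prime_deductive)
    then show ?thesis using component_prime a b G by (auto simp: prime_Delta)
  qed
  then show "definable (\<lambda>\<Gamma>. \<forall>\<Delta>\<in>component \<Gamma>. Q \<Delta> \<longrightarrow> R \<Delta>)" unfolding definable_def by blast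
  have "Neg ?d \<in> \<Gamma> \<longleftrightarrow> \<not> (\<forall>\<Delta>\<in>component \<Gamma>. Q \<Delta> \<longrightarrow> R \<Delta>)" if G: "prime_theory \<Gamma>" for \<Gamma>
  proof -
    have "?d \<in> \<Delta> \<longleftrightarrow> ?d \<in> \<Gamma>" if "prime_theory \<Delta>" "\<Gamma> \<subseteq> \<Delta>" for \<Delta>
      using component_eq[OF G, of \<Delta>] that by (simp add: 1 G) (simp add: component_def)
    then show ?thesis using G 1[OF G] prime_Neg[OF G, of ?d] by blast
  qed
  then show "definable (\<lambda>\<Gamma>. \<not> (\<forall>\<Delta>\<in>component \<Gamma>. Q \<Delta> \<longrightarrow> R \<Delta>))"
    unfolding definable_def by blast
qed

section \<open>Traces of components on a set of formulas\<close>

definition moment :: "form set \<Rightarrow> form set \<Rightarrow> form set set" where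
  "moment \<Sigma> \<Gamma> = (\<lambda>\<Delta>. \<Delta> \<inter> \<Sigma>) ` component \<Gamma>"

lemma moment_subset: "moment \<Sigma> \<Gamma> \<subseteq> Pow \<Sigma>"
  by (auto simp: moment_def)

lemma moment_member: "\<Delta> \<in> component \<Gamma> \<Longrightarrow> \<Delta> \<inter> \<Sigma> \<in> moment \<Sigma> \<Gamma>"
  unfolding moment_def by (rule image_eqI[OF refl])

lemma moment_from_component:
  "prime_theory \<Gamma> \<Longrightarrow> \<Delta> \<in> component \<Gamma> \<Longrightarrow> moment \<Sigma> \<Delta> = moment \<Sigma> \<Gamma>"
  using component_eq by (simp add: moment_def)

text \<open>If a theory with trace \<Phi> is not above \<Gamma>, it is below it; then both traces
  agree and \<Gamma> itself realises \<Phi>.\<close>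

lemma component_above:
  assumes "prime_theory \<Gamma>" "\<Phi> \<in> moment \<Sigma> \<Gamma>" "\<Gamma> \<inter> \<Sigma> \<subseteq> \<Phi>"
  obtains \<Delta> where "\<Delta> \<in> component \<Gamma>" "\<Delta> \<inter> \<Sigma> = \<Phi>" "\<Gamma> \<subseteq> \<Delta>"
proof -
  obtain \<Delta> where D: "\<Delta> \<in> component \<Gamma>" "\<Delta> \<inter> \<Sigma> = \<Phi>" using assms(2) by (auto simp: moment_def)
  show thesis
  proof (cases "\<Gamma> \<subseteq> \<Delta>")
    case False
    then have "\<Gamma> \<inter> \<Sigma> = \<Phi>" using D assms(3) by (auto simp: component_def)
    then show ?thesis using that[of \<Gamma>] component_refl[OF assms(1)] by blast
  qed (use that D in blast)
qed

lemma component_below: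
  assumes "prime_theory \<Gamma>" "\<Phi> \<in> moment \<Sigma> \<Gamma>" "\<Phi> \<subseteq> \<Gamma> \<inter> \<Sigma>"
  obtains \<Delta> where "\<Delta> \<in> component \<Gamma>" "\<Delta> \<inter> \<Sigma> = \<Phi>" "\<Delta> \<subseteq> \<Gamma>"
proof -
  obtain \<Delta> where D: "\<Delta> \<in> component \<Gamma>" "\<Delta> \<inter> \<Sigma> = \<Phi>" using assms(2) by (auto simp: moment_def)
  show thesis
  proof (cases "\<Delta> \<subseteq> \<Gamma>")
    case False
    then have "\<Gamma> \<inter> \<Sigma> = \<Phi>" using D assms(3) by (auto simp: component_def)
    then show ?thesis using that[of \<Gamma>] component_refl[OF assms(1)] by blast
  qed (use that D in blast)
qed

lemma moment_comparable:
  "prime_theory \<Gamma> \<Longrightarrow> x \<in> moment \<Sigma> \<Gamma> \<Longrightarrow> y \<in> moment \<Sigma> \<Gamma> \<Longrightarrow> x \<subseteq> y \<or> y \<subseteq> x"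
  unfolding moment_def using component_comparable by blast

lemma moment_And:
  assumes "prime_theory \<Gamma>" "x \<in> moment \<Sigma> \<Gamma>" "And a b \<in> \<Sigma>" "a \<in> \<Sigma>" "b \<in> \<Sigma>"
  shows "And a b \<in> x \<longleftrightarrow> a \<in> x \<and> b \<in> x"
  using assms component_prime by (auto simp: moment_def prime_And)

lemma moment_Or:
  assumes "prime_theory \<Gamma>" "x \<in> moment \<Sigma> \<Gamma>" "Or a b \<in> \<Sigma>" "a \<in> \<Sigma>" "b \<in> \<Sigma>"
  shows "Or a b \<in> x \<longleftrightarrow> a \<in> x \<or> b \<in> x"
  using assms component_prime by (auto simp: moment_def prime_Or)

text \<open>Comparing traces instead of theories loses nothing: by \<open>component_above\<close> a
  trace above that of \<Delta> is realised by a theory above \<Delta>. The clause for coimplication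
  is dual, by \<open>component_below\<close>.\<close>

lemma moment_Imp:
  assumes G: "prime_theory \<Gamma>" and x: "x \<in> moment \<Sigma> \<Gamma>" and S: "Imp a b \<in> \<Sigma>" "a \<in> \<Sigma>" "b \<in> \<Sigma>"
  shows "Imp a b \<in> x \<longleftrightarrow> (\<forall>y\<in>moment \<Sigma> \<Gamma>. x \<subseteq> y \<longrightarrow> a \<in> y \<longrightarrow> b \<in> y)"
proof -
  obtain \<Delta> where D: "\<Delta> \<in> component \<Gamma>" and x': "x = \<Delta> \<inter> \<Sigma>" using x by (auto simp: moment_def)
  have p: "prime_theory \<Delta>" using D by (rule component_prime)
  have m: "moment \<Sigma> \<Gamma> = moment \<Sigma> \<Delta>" using moment_from_component[OF G D] by simp
  show ?thesis
  proof
    assume "Imp a b \<in> x"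
    then have imp: "Imp a b \<in> \<Delta>" by (simp add: x')
    show "\<forall>y\<in>moment \<Sigma> \<Gamma>. x \<subseteq> y \<longrightarrow> a \<in> y \<longrightarrow> b \<in> y"
    proof (intro ballI impI)
      fix y assume y: "y \<in> moment \<Sigma> \<Gamma>" "x \<subseteq> y" "a \<in> y"
      obtain \<Delta>' where D': "\<Delta>' \<in> component \<Delta>" "\<Delta>' \<inter> \<Sigma> = y" "\<Delta> \<subseteq> \<Delta>'"
        by (rule component_above[OF p y(1)[unfolded m] y(2)[unfolded x']])
      moreover have "a \<in> \<Delta>'" using D'(2) y(3) by blast
      ultimately have "b \<in> \<Delta>'"
        using imp[unfolded prime_Imp[OF p]] component_prime[OF D'(1)] D'(3) by blast
      then show "b \<in> y" using D'(2) S(3) by blast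
    qed
  next
    assume R: "\<forall>y\<in>moment \<Sigma> \<Gamma>. x \<subseteq> y \<longrightarrow> a \<in> y \<longrightarrow> b \<in> y"
    have "b \<in> \<Delta>'" if "prime_theory \<Delta>'" "\<Delta> \<subseteq> \<Delta>'" "a \<in> \<Delta>'" for \<Delta>'
    proof -
      have "\<Delta>' \<in> component \<Delta>" using that by (simp add: component_def)
      from bspec[OF R[unfolded m] moment_member[OF this]] show ?thesis
        using that S by (auto simp: x')
    qed
    then show "Imp a b \<in> x" using S p by (simp add: x' prime_Imp)
  qed
qed

lemma moment_Coimp:
  assumes G: "prime_theory \<Gamma>" and x: "x \<in> moment \<Sigma> \<Gamma>" and S: "Coimp a b \<in> \<Sigma>" "a \<in> \<Sigma>" "b \<in> \<Sigma>"
  shows "Coimp a b \<in> x \<longleftrightarrow> (\<exists>y\<in>moment \<Sigma> \<Gamma>. y \<subseteq> x \<and> a \<in> y \<and> b \<notin> y)"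
proof -
  obtain \<Delta> where D: "\<Delta> \<in> component \<Gamma>" and x': "x = \<Delta> \<inter> \<Sigma>" using x by (auto simp: moment_def)
  have p: "prime_theory \<Delta>" using D by (rule component_prime)
  have m: "moment \<Sigma> \<Gamma> = moment \<Sigma> \<Delta>" using moment_from_component[OF G D] by simp
  show ?thesis
  proof
    assume "Coimp a b \<in> x"
    then obtain \<Delta>' where D': "prime_theory \<Delta>'" "\<Delta>' \<subseteq> \<Delta>" "a \<in> \<Delta>'" "b \<notin> \<Delta>'"
      using prime_Coimp[OF p] x' by blast
    then have "\<Delta>' \<in> component \<Delta>" by (simp add: component_def)
    then have "\<Delta>' \<inter> \<Sigma> \<in> moment \<Sigma> \<Gamma>" unfolding m by (rule moment_member)
    moreover have "\<Delta>' \<inter> \<Sigma> \<subseteq> x" "a \<in> \<Delta>' \<inter> \<Sigma>" "b \<notin> \<Delta>' \<inter> \<Sigma>" using D' S x' by auto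
    ultimately show "\<exists>y\<in>moment \<Sigma> \<Gamma>. y \<subseteq> x \<and> a \<in> y \<and> b \<notin> y" by blast
  next
    assume "\<exists>y\<in>moment \<Sigma> \<Gamma>. y \<subseteq> x \<and> a \<in> y \<and> b \<notin> y"
    then obtain y where y: "y \<in> moment \<Sigma> \<Gamma>" "y \<subseteq> x" "a \<in> y" "b \<notin> y" by blast
    obtain \<Delta>' where D': "\<Delta>' \<in> component \<Delta>" "\<Delta>' \<inter> \<Sigma> = y" "\<Delta>' \<subseteq> \<Delta>"
      by (rule component_below[OF p y(1)[unfolded m] y(2)[unfolded x']])
    have "a \<in> \<Delta>'" "b \<notin> \<Delta>'" using D'(2) y S by blast+
    then have "Coimp a b \<in> \<Delta>"
      unfolding prime_Coimp[OF p] using component_prime[OF D'(1)] D'(3) by blast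
    then show "Coimp a b \<in> x" using S by (simp add: x')
  qed
qed

text \<open>A subset \<Phi> of \<Sigma> is absent from the moment when every theory of the component
  that contains \<Phi> contains a further element of \<Sigma>; by the delta both this and its
  negation are definable. As \<Sigma> is finite, any predicate is a finite disjunction of complete
  descriptions of moments.\<close>

lemma definable_moment:
  assumes "finite \<Sigma>"
  shows "definable (\<lambda>\<Gamma>. Q (moment \<Sigma> \<Gamma>))"
proof -
  have inS: "\<Phi> \<notin> moment \<Sigma> \<Gamma> \<longleftrightarrow>
      (\<forall>\<Delta>\<in>component \<Gamma>. (\<forall>a\<in>\<Phi>. a \<in> \<Delta>) \<longrightarrow> (\<exists>a\<in>\<Sigma> - \<Phi>. a \<in> \<Delta>))" if "\<Phi> \<subseteq> \<Sigma>" for \<Phi> \<Gamma>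
    using that by (auto simp: moment_def)
  have fin: "finite \<Phi>" if "\<Phi> \<subseteq> \<Sigma>" for \<Phi> using that assms finite_subset by blast
  have def1: "definable (\<lambda>\<Gamma>. \<forall>a\<in>\<Phi>. a \<in> \<Gamma>)" "definable (\<lambda>\<Gamma>. \<exists>a\<in>\<Sigma> - \<Phi>. a \<in> \<Gamma>)"
    if "\<Phi> \<subseteq> \<Sigma>" for \<Phi>
    using fin[OF that] assms by (auto intro!: definable_Ball definable_Bex definable_member)
  have d: "definable (\<lambda>\<Gamma>. \<Phi> \<notin> moment \<Sigma> \<Gamma>)" "definable (\<lambda>\<Gamma>. \<not> \<Phi> \<notin> moment \<Sigma> \<Gamma>)"
    if "\<Phi> \<subseteq> \<Sigma>" for \<Phi>
    unfolding inS[OF that] by (intro definable_component_imp def1[OF that])+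
  then have "definable (\<lambda>\<Gamma>. \<Phi> \<in> moment \<Sigma> \<Gamma> \<longleftrightarrow> \<Phi> \<in> m)" if "\<Phi> \<subseteq> \<Sigma>" for \<Phi> m
    using that by (cases "\<Phi> \<in> m") auto
  then have "definable (\<lambda>\<Gamma>. \<exists>m\<in>{m. m \<subseteq> Pow \<Sigma> \<and> Q m}. \<forall>\<Phi>\<in>Pow \<Sigma>. \<Phi> \<in> moment \<Sigma> \<Gamma> \<longleftrightarrow> \<Phi> \<in> m)"
    using assms by (intro definable_Ball definable_Bex) auto
  moreover have "(\<exists>m\<in>{m. m \<subseteq> Pow \<Sigma> \<and> Q m}. \<forall>\<Phi>\<in>Pow \<Sigma>. \<Phi> \<in> moment \<Sigma> \<Gamma> \<longleftrightarrow> \<Phi> \<in> m)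
      \<longleftrightarrow> Q (moment \<Sigma> \<Gamma>)" for \<Gamma>
  proof -
    have "m = moment \<Sigma> \<Gamma>" if "m \<subseteq> Pow \<Sigma>" "\<forall>\<Phi>\<in>Pow \<Sigma>. \<Phi> \<in> moment \<Sigma> \<Gamma> \<longleftrightarrow> \<Phi> \<in> m" for m
      using that moment_subset[of \<Sigma> \<Gamma>] by blast
    then show ?thesis using moment_subset[of \<Sigma> \<Gamma>] by auto
  qed
  ultimately show ?thesis by simp
qed

section \<open>Fair infinite walks\<close>

text \<open>Existence of a finite walk with a branch meeting \<open>e\<close>. The moment is carried
  along with the point because the next edge must leave from exactly the moment reached.\<close>

inductive fulfillable ::
  "('p \<times> 'p) set set \<Rightarrow> ('e \<Rightarrow> 'p \<Rightarrow> bool) \<Rightarrow> 'e \<Rightarrow> 'p set \<Rightarrow> 'p \<Rightarrow> bool"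
  for \<E> met e where
  fulfillable_now: "met e x \<Longrightarrow> fulfillable \<E> met e M x"
| fulfillable_step: "E \<in> \<E> \<Longrightarrow> (x, y) \<in> E \<Longrightarrow> fulfillable \<E> met e (Range E) y
    \<Longrightarrow> fulfillable \<E> met e (Domain E) x"

text \<open>In contrast to \<open>fulfillable\<close> the sequence of edges is fixed and only the
  branch is chosen. The index type is left open to serve walks over the naturals and timelines over
  the integers.\<close>

inductive met_from ::
  "('i::{plus,one} \<Rightarrow> ('p \<times> 'p) set) \<Rightarrow> ('e \<Rightarrow> 'p \<Rightarrow> bool) \<Rightarrow> 'e \<Rightarrow> 'i \<Rightarrow> 'p \<Rightarrow> bool"
  for R met e where
  met_from_now: "met e x \<Longrightarrow> met_from R met e n x"
| met_from_step: "(x, y) \<in> R n \<Longrightarrow> met_from R met e (n + 1) y \<Longrightarrow> met_from R met e n x"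

text \<open>Here \<open>fulfillable\<close> promises each eventuality separately, on a walk of its
  own; the locale merges these promises into one walk. It is used for edges between canonical
  moments and, in \<open>fulfilling_path\<close>, for the individual steps of one timeline.\<close>

locale eventualities =
  fixes \<E> :: "('p \<times> 'p) set set" and pending met :: "'e \<Rightarrow> 'p \<Rightarrow> bool"
  assumes serial: "E \<in> \<E> \<Longrightarrow> \<exists>E'\<in>\<E>. Domain E' = Range E"
    and persist: "E \<in> \<E> \<Longrightarrow> (x, y) \<in> E \<Longrightarrow> pending e x \<Longrightarrow> \<not> met e x \<Longrightarrow> pending e y"
    and finite_pending: "E \<in> \<E> \<Longrightarrow> finite {(e, x). x \<in> Domain E \<and> pending e x}"
    and fulfillable:
      "E \<in> \<E> \<Longrightarrow> x \<in> Domain E \<Longrightarrow> pending e x \<Longrightarrow> fulfillable \<E> met e (Domain E) x"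
begin

primrec walk :: "'p set \<Rightarrow> ('p \<times> 'p) set list \<Rightarrow> 'p set \<Rightarrow> bool" where
  "walk M [] M' \<longleftrightarrow> M = M'"
| "walk M (E # Es) M' \<longleftrightarrow> E \<in> \<E> \<and> Domain E = M \<and> walk (Range E) Es M'"

primrec met_along :: "'e \<Rightarrow> ('p \<times> 'p) set list \<Rightarrow> 'p \<Rightarrow> bool" where
  "met_along e [] x \<longleftrightarrow> met e x"
| "met_along e (E # Es) x \<longleftrightarrow> met e x \<or> (\<exists>y. (x, y) \<in> E \<and> met_along e Es y)"

lemma walk_append: "walk M (Es @ Fs) M'' \<longleftrightarrow> (\<exists>M'. walk M Es M' \<and> walk M' Fs M'')"
  by (induction Es arbitrary: M) auto

lemma met_along_now: "met e x \<Longrightarrow> met_along e Es x"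
  by (cases Es) auto

lemma met_along_append: "met_along e Es x \<Longrightarrow> met_along e (Es @ Fs) x"
  by (induction Es arbitrary: x) (auto simp: met_along_now)

lemma walk_nth:
  "walk M Es M' \<Longrightarrow> n < length Es \<Longrightarrow> Es ! n \<in> \<E> \<and> walk (Domain (Es ! n)) (drop n Es) M'"
proof (induction Es arbitrary: M n)
  case (Cons E Es)
  then show ?case by (cases n) auto
qed simp

lemma walk_Suc_nth: "walk M Es M' \<Longrightarrow> Suc n < length Es \<Longrightarrow> Range (Es ! n) = Domain (Es ! Suc n)"
proof (induction Es arbitrary: M n)
  case (Cons E Es)
  then show ?case by (cases n; cases Es) auto
qed simp

lemma walk_moment: "walk M Es M' \<Longrightarrow> M \<in> Domain ` \<E> \<Longrightarrow> M' \<in> Domain ` \<E>"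
proof (induction Es arbitrary: M)
  case (Cons E Es)
  then obtain E' where "E' \<in> \<E>" "Domain E' = Range E" using serial[of E] by auto
  then have "Range E \<in> Domain ` \<E>" by (metis imageI)
  then show ?case using Cons by auto
qed simp

lemma fulfillable_walk:
  "fulfillable \<E> met e M x \<Longrightarrow> \<exists>Es M'. walk M Es M' \<and> met_along e Es x"
proof (induction rule: fulfillable.induct)
  case (fulfillable_now x M)
  then have "walk M [] M \<and> met_along e [] x" by simp
  then show ?case by blast
next
  case (fulfillable_step E x y)
  then obtain Es M' where "walk (Range E) Es M'" "met_along e Es y" by blast
  then have "walk (Domain E) (E # Es) M' \<and> met_along e (E # Es) x"
    using fulfillable_step by auto
  then show ?case by blast
qed

text \<open>An unmet eventuality stays pending along any branch, and a branch always continues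
  because the points of a moment are the domain of the next edge.\<close>

lemma pending_carry:
  assumes "walk M Es M'" "x \<in> M" "pending e x"
  shows "met_along e Es x \<or>
    (\<exists>y\<in>M'. pending e y \<and> (\<forall>Fs. met_along e Fs y \<longrightarrow> met_along e (Es @ Fs) x))"
  using assms
proof (induction Es arbitrary: M x)
  case (Cons E Es)
  show ?case
  proof (cases "met e x")
    case False
    from Cons obtain y where y: "(x, y) \<in> E" by auto
    then have "pending e y" using persist False Cons by auto
    with Cons y have "met_along e Es y \<or>
      (\<exists>z\<in>M'. pending e z \<and> (\<forall>Fs. met_along e Fs z \<longrightarrow> met_along e (Es @ Fs) y))"
      by (intro Cons.IH[of "Range E"]) auto
    then show ?thesis using y by auto
  qed simp
qed auto

text \<open>The obligations are met one after another. The next one is either met by the walk built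
  so far or still pending at its end, where \<open>fulfillable\<close> provides an extension;
  lengthening a walk undoes nothing.\<close>

lemma walk_meeting:
  assumes "M \<in> Domain ` \<E>" "finite Q" "\<forall>(e, x)\<in>Q. x \<in> M \<and> pending e x"
  shows "\<exists>Es M'. walk M Es M' \<and> (\<forall>(e, x)\<in>Q. met_along e Es x)"
  using assms(2,3)
proof (induction Q)
  case empty
  have "walk M [] M" by simp
  then show ?case by blast
next
  case (insert o' Q)
  obtain e x where o': "o' = (e, x)" by (cases o')
  from insert obtain Es M' where Es: "walk M Es M'" "\<forall>(e, x)\<in>Q. met_along e Es x" by auto
  have M': "M' \<in> Domain ` \<E>" using walk_moment Es assms(1) by blast
  have "x \<in> M" "pending e x" using insert o' by auto
  from pending_carry[OF Es(1) this]
  have "\<exists>Fs M''. walk M' Fs M'' \<and> met_along e (Es @ Fs) x"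
  proof
    assume "met_along e Es x"
    then have "walk M' [] M' \<and> met_along e (Es @ []) x" by simp
    then show ?thesis by blast
  next
    assume "\<exists>y\<in>M'. pending e y \<and> (\<forall>Fs. met_along e Fs y \<longrightarrow> met_along e (Es @ Fs) x)"
    then obtain y where y: "y \<in> M'" "pending e y"
      "\<And>Fs. met_along e Fs y \<Longrightarrow> met_along e (Es @ Fs) x" by blast
    from M' obtain E where "E \<in> \<E>" "M' = Domain E" by blast
    then have "fulfillable \<E> met e M' y" using fulfillable y(1,2) by simp
    then show ?thesis using fulfillable_walk y(3) by blast
  qed
  then obtain Fs M'' where "walk M' Fs M''" "met_along e (Es @ Fs) x" by blast
  then have "walk M (Es @ Fs) M'' \<and> (\<forall>(e, x)\<in>insert o' Q. met_along e (Es @ Fs) x)"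
    using Es o' met_along_append by (auto simp: walk_append)
  then show ?case by blast
qed

text \<open>Only what is pending at the end \<open>M'\<close> has to be served: anything pending
  earlier has been met on the way or is carried to \<open>M'\<close>.\<close>

lemma walk_extend:
  assumes "M \<in> Domain ` \<E>" "walk M Es M'"
  shows "\<exists>Fs M''. Fs \<noteq> [] \<and> walk M (Es @ Fs) M'' \<and>
    (\<forall>n e x. n < length Es \<longrightarrow> x \<in> Domain (Es ! n) \<longrightarrow> pending e x
      \<longrightarrow> met_along e (drop n (Es @ Fs)) x)"
proof -
  have M': "M' \<in> Domain ` \<E>" using walk_moment assms by blast
  then have "finite {(e, x). x \<in> M' \<and> pending e x}" using finite_pending by auto
  from walk_meeting[OF M' this] obtain Fs M''
    where Fs: "walk M' Fs M''" "\<And>e x. x \<in> M' \<Longrightarrow> pending e x \<Longrightarrow> met_along e Fs x" by auto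
  have "M'' \<in> Domain ` \<E>" using walk_moment Fs M' by blast
  then obtain E where E: "E \<in> \<E>" "M'' = Domain E" by blast
  \<comment> \<open>The extra edge makes the extension nonempty even if nothing is pending, so the
    walks grow without bound.\<close>
  let ?Fs = "Fs @ [E]"
  have "met_along e (drop n (Es @ ?Fs)) x"
    if "n < length Es" "x \<in> Domain (Es ! n)" "pending e x" for n e x
  proof -
    have "met_along e (drop n Es @ Fs) x"
      using pending_carry[of "Domain (Es ! n)" "drop n Es" M' x e] walk_nth[OF assms(2), of n]
        Fs(2) that met_along_append by blast
    then show ?thesis using that met_along_append[of e "drop n Es @ Fs" x "[E]"] by simp
  qed
  moreover have "walk M (Es @ ?Fs) (Range E)"
    using assms(2) Fs(1) E by (auto simp: walk_append)
  ultimately show ?thesis by (intro exI[of _ ?Fs] exI[of _ "Range E"]) auto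
qed

lemma met_from_if_met_along:
  fixes E :: "nat \<Rightarrow> ('p \<times> 'p) set"
  assumes "met_along e (map E [n..<m]) x" "n \<le> m"
  shows "met_from E met e n x"
  using assms(2,1)
proof (induction n arbitrary: x rule: inc_induct)
  case base
  then show ?case by (simp add: met_from_now)
next
  case (step n)
  then have "met e x \<or> (\<exists>y. (x, y) \<in> E n \<and> met_along e (map E [Suc n..<m]) y)"
    by (simp add: upt_conv_Cons)
  then show ?case using step.IH met_from_now met_from_step by (metis Suc_eq_plus1)
qed

text \<open>Each stage extends the previous one and meets all that is pending at positions inside
  it. Every position lies inside some stage, so nothing is postponed for ever.\<close>

lemma fair_walk:
  assumes M: "M \<in> Domain ` \<E>"
  obtains E :: "nat \<Rightarrow> ('p \<times> 'p) set" where "\<And>n. E n \<in> \<E>" "Domain (E 0) = M"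
    "\<And>n. Range (E n) = Domain (E (n + 1))"
    "\<And>n e x. x \<in> Domain (E n) \<Longrightarrow> pending e x \<Longrightarrow> met_from E met e n x"
proof -
  let ?P = "\<lambda>_ Es. \<exists>M'. walk M Es M'"
  let ?Q = "\<lambda>_ Es Es'. \<exists>Fs. Fs \<noteq> [] \<and> Es' = Es @ Fs \<and>
    (\<forall>n e x. n < length Es \<longrightarrow> x \<in> Domain (Es ! n) \<longrightarrow> pending e x \<longrightarrow> met_along e (drop n Es') x)"
  have "\<exists>f. \<forall>n::nat. ?P n (f n) \<and> ?Q n (f n) (f (Suc n))"
  proof (rule dependent_nat_choice)
    show "\<exists>Es. ?P 0 Es" using walk.simps(1) by blast
    show "\<exists>Es'. ?P (Suc n) Es' \<and> ?Q n Es Es'" if P: "?P n Es" for Es n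
    proof -
      from P obtain M' where "walk M Es M'" ..
      from walk_extend[OF M this] obtain Fs M'' where Fs: "Fs \<noteq> []" "walk M (Es @ Fs) M''"
        "\<forall>n e x. n < length Es \<longrightarrow> x \<in> Domain (Es ! n) \<longrightarrow> pending e x
          \<longrightarrow> met_along e (drop n (Es @ Fs)) x" by metis
      then have "?Q n Es (Es @ Fs)" by (intro exI[of _ Fs]) simp
      then show ?thesis using Fs(2) by (intro exI[of _ "Es @ Fs"]) (rule conjI, rule exI)
    qed
  qed
  then obtain f :: "nat \<Rightarrow> ('p \<times> 'p) set list" where P: "\<And>n. \<exists>M'. walk M (f n) M'"
    and Q: "\<And>k. \<exists>Fs. Fs \<noteq> [] \<and> f (Suc k) = f k @ Fs"
    and F: "\<And>k n e x. n < length (f k) \<Longrightarrow> x \<in> Domain (f k ! n) \<Longrightarrow> pending e x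
      \<Longrightarrow> met_along e (drop n (f (Suc k))) x"
    by metis
  have len: "k \<le> length (f k)" for k
  proof (induction k)
    case (Suc k)
    then show ?case using Q[of k] by (auto simp: Suc_le_eq neq_Nil_conv)
  qed simp
  have pre: "\<exists>Fs. f j = f i @ Fs" if "i \<le> j" for i j
    using that
  proof (induction j rule: dec_induct)
    case (step j)
    then show ?case using Q[of j] by auto
  qed simp
  \<comment> \<open>Stage \<open>Suc n\<close> has length at least \<open>Suc n\<close>, so it
    contains position \<open>n\<close>, and later stages do not change it.\<close>
  define E where "E n = f (Suc n) ! n" for n
  have E: "E n = f k ! n" if "n < length (f k)" for n k
  proof (cases "Suc n \<le> k")
    case True
    then show ?thesis using pre[OF True] len[of "Suc n"] by (auto simp: E_def nth_append)
  next
    case False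
    then have "k \<le> Suc n" by simp
    from pre[OF this] show ?thesis using that by (auto simp: E_def nth_append)
  qed
  have lt: "n < length (f (Suc n))" for n using len[of "Suc n"] by simp
  show thesis
  proof
    show "E n \<in> \<E>" for n
      using P[of "Suc n"] walk_nth[OF _ lt] E[OF lt] by metis
    show "Domain (E 0) = M"
      using P[of 1] lt[of 0] by (cases "f 1") (auto simp: E_def)
    show "Range (E n) = Domain (E (n + 1))" for n
    proof -
      have "Suc n < length (f (Suc (Suc n)))" "n < length (f (Suc (Suc n)))"
        using lt[of "Suc n"] by auto
      then show ?thesis using P[of "Suc (Suc n)"] walk_Suc_nth E by (metis Suc_eq_plus1)
    qed
    show "met_from E met e n x" if "x \<in> Domain (E n)" "pending e x" for n e x
    proof -
      \<comment> \<open>Position \<open>n\<close> lies inside stage \<open>Suc n\<close>; what is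
        pending there is met within the following stage.\<close>
      let ?L = "f (Suc (Suc n))"
      have "drop n ?L = map E [n..<length ?L]"
        by (rule nth_equalityI) (auto simp: E[of _ "Suc (Suc n)"])
      moreover have "met_along e (drop n ?L) x" using F[OF lt] that E[OF lt] by metis
      moreover have "n \<le> length ?L" using len[of "Suc (Suc n)"] by simp
      ultimately show ?thesis using met_from_if_met_along by simp
    qed
  qed
qed

end

text \<open>With singletons as moments a walk is a path, so a fair walk is a path meeting all its
  own eventualities.\<close>

lemma fulfilling_path:
  fixes R :: "int \<Rightarrow> ('p \<times> 'p) set" and pending met :: "'e \<Rightarrow> 'p \<Rightarrow> bool"
  assumes range: "\<And>n. Range (R n) = Domain (R (n + 1))"
    and persist: "\<And>n x y e. (x, y) \<in> R n \<Longrightarrow> pending e x \<Longrightarrow> \<not> met e x \<Longrightarrow> pending e y"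
    and fin: "\<And>x. finite {e. pending e x}"
    and met: "\<And>n x e. x \<in> Domain (R n) \<Longrightarrow> pending e x \<Longrightarrow> met_from R met e n x"
    and x: "x \<in> Domain (R n)"
  obtains y :: "nat \<Rightarrow> 'p" where "y 0 = x" "\<And>k. (y k, y (Suc k)) \<in> R (n + int k)"
    "\<And>k e. pending e (y k) \<Longrightarrow> \<exists>j\<ge>k. met e (y j)"
proof -
  \<comment> \<open>Points carry their time, so that a walk of singletons advances one step of
    \<open>R\<close> at a time.\<close>
  define \<E> where "\<E> = {{((n, x), (n + 1, y))} |n x y. (x, y) \<in> R n}"
  let ?met = "\<lambda>e p. met e (snd p)" and ?pending = "\<lambda>e p. pending e (snd p)"
  have edge: "{((n, x), (n + 1, y))} \<in> \<E>" if "(x, y) \<in> R n" for n x y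
    using that by (auto simp: \<E>_def)
  have ful: "fulfillable \<E> ?met e {(n, x)} (n, x)" if "met_from R met e n x" for n x e
    using that
  proof induction
    case (met_from_step x y n)
    then show ?case
      using fulfillable_step[OF edge, of x y n "(n, x)" "(n + 1, y)" ?met e] by simp
  qed (simp add: fulfillable_now)
  interpret eventualities \<E> ?pending ?met
  proof
    fix E assume "E \<in> \<E>"
    then obtain n x y where E: "E = {((n, x), (n + 1, y))}" and R: "(x, y) \<in> R n"
      by (auto simp: \<E>_def)
    from R range[of n] obtain z where "(y, z) \<in> R (n + 1)" by auto
    from edge[OF this] show "\<exists>E'\<in>\<E>. Domain E' = Range E" by (intro bexI) (auto simp: E)
    show "pending e (snd q)" if "(p, q) \<in> E" "pending e (snd p)" "\<not> met e (snd p)" for e p q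
      using that persist[OF R] E by simp
    have "{(e, p). p \<in> Domain E \<and> pending e (snd p)} = (\<lambda>e. (e, (n, x))) ` {e. pending e x}"
      by (auto simp: E)
    then show "finite {(e, p). p \<in> Domain E \<and> pending e (snd p)}" using fin by simp
    show "fulfillable \<E> ?met e (Domain E) p" if "p \<in> Domain E" "pending e (snd p)" for e p
      using that ful[OF met[of x n e]] R by (auto simp: E)
  qed
  obtain z where "(x, z) \<in> R n" using x by auto
  then have "{(n, x)} \<in> Domain ` \<E>" using edge by (intro image_eqI[rotated]) auto
  then obtain E :: "nat \<Rightarrow> _" where E: "\<And>k. E k \<in> \<E>" "Domain (E 0) = {(n, x)}"
    "\<And>k. Range (E k) = Domain (E (k + 1))"
    "\<And>k e p. p \<in> Domain (E k) \<Longrightarrow> pending e (snd p) \<Longrightarrow> met_from E ?met e k p"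
    by (rule fair_walk) blast
  have "\<forall>k. \<exists>i a b. E k = {((i, a), (i + 1, b))} \<and> (a, b) \<in> R i"
    using E(1) by (auto simp: \<E>_def)
  then obtain i a b where iab: "\<And>k. E k = {((i k, a k), (i k + 1, b k))}"
    "\<And>k. (a k, b k) \<in> R (i k)" by metis
  have next_point: "i (Suc k) = i k + 1 \<and> a (Suc k) = b k" for k
    using E(3)[of k] by (simp add: iab)
  have "i k = n + int k" for k
    using next_point E(2) by (induction k) (auto simp: iab)
  then have step: "(a k, a (Suc k)) \<in> R (n + int k)" for k
    using iab(2)[of k] next_point[of k] by simp
  have "\<exists>j\<ge>k. met e (a j)" if "met_from E ?met e k p" "p = (i k, a k)" for k e p
    using that
  proof induction
    case (met_from_step p q k)
    then have "q = (i (k + 1), a (k + 1))" using next_point[of k] by (simp add: iab)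
    then show ?case using met_from_step.IH by (meson add_leD1)
  qed auto
  then have "\<exists>j\<ge>k. met e (a j)" if "pending e (a k)" for k e
    using E(4)[of "(i k, a k)" k e] that by (simp add: iab)
  moreover have "a 0 = x" using E(2) by (simp add: iab)
  ultimately show thesis using that step by blast
qed

lemma met_from_int_shift:
  "met_from (\<lambda>k. R (n + int k)) met e k x \<Longrightarrow> met_from R met e (n + int k) x"
proof (induction rule: met_from.induct)
  case (met_from_step x y k)
  then show ?case by (intro met_from.met_from_step[of x y]) (auto simp: ac_simps)
qed (rule met_from_now)

text \<open>What is pending at a negative time is met before time 0 or still pending there. This is
  needed because the two halves of the timeline are built to be fair in one direction each.\<close>

lemma met_from_backwards:
  fixes R :: "int \<Rightarrow> ('p \<times> 'p) set"
  assumes range: "\<And>n. Range (R n) = Domain (R (n + 1))"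
    and persist: "\<And>n x y e. (x, y) \<in> R n \<Longrightarrow> pending e x \<Longrightarrow> \<not> met e x \<Longrightarrow> pending e y"
    and met: "\<And>n x e. 0 \<le> n \<Longrightarrow> x \<in> Domain (R n) \<Longrightarrow> pending e x \<Longrightarrow> met_from R met e n x"
    and x: "x \<in> Domain (R n)" "pending e x"
  shows "met_from R met e n x"
proof (cases "0 \<le> n")
  case False
  then have "n \<le> 0" by simp
  then show ?thesis using x
  proof (induction n arbitrary: x rule: int_le_induct)
    case (step n)
    from step(3) obtain y where y: "(x, y) \<in> R (n - 1)" by auto
    then have yR: "y \<in> Domain (R n)" using range[of "n - 1"] by auto
    show ?case
    proof (cases "met e x")
      case False
      then have "pending e y" using persist y step by blast
      then show ?thesis using met_from_step[of x y R "n - 1" met e, OF y] step.IH[OF yR] by simp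
    qed (rule met_from_now)
  qed (use met in auto)
qed (use met x in auto)

section \<open>Temporal operators on prime theories\<close>

locale tense =
  fixes N P Gl :: "form \<Rightarrow> form" and U :: "form \<Rightarrow> form \<Rightarrow> form"
  assumes axioms: "temporal_axioms N Gl U \<subseteq> GTL"
    and nec_N: "a \<in> GTL \<Longrightarrow> N a \<in> GTL"
    and nec_Gl: "a \<in> GTL \<Longrightarrow> Gl a \<in> GTL"
    and NP: "Iff a (N (P a)) \<in> GTL"
    and PN: "Iff a (P (N a)) \<in> GTL"
begin

definition shift :: "form set \<Rightarrow> form set" where
  "shift \<Gamma> = {a. N a \<in> \<Gamma>}"

definition unshift :: "form set \<Rightarrow> form set" where
  "unshift \<Gamma> = {a. P a \<in> \<Gamma>}"

lemma axiom_instances: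
  "Neg (N Bot) \<in> GTL"
  "Imp (N (Or a b)) (Or (N a) (N b)) \<in> GTL"
  "Imp (N (Imp a b)) (Imp (N a) (N b)) \<in> GTL"
  "Imp (Gl (Imp a b)) (Imp (Gl a) (Gl b)) \<in> GTL"
  "Imp (Gl (Imp a b)) (Imp (U c a) (U c b)) \<in> GTL"
  "Imp (Gl a) (And a (N (Gl a))) \<in> GTL"
  "Imp (Or b (And a (N (U a b)))) (U a b) \<in> GTL"
  "Imp (Gl (Imp a (N a))) (Imp a (Gl a)) \<in> GTL"
  "Imp (Gl (Imp (And b (N a)) a)) (Imp (U b a) a) \<in> GTL"
proof -
  have "Iff (N (Imp a b)) (Imp (N a) (N b)) \<in> GTL"
    by (rule subsetD[OF axioms]) (unfold temporal_axioms_def, blast)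
  then show "Imp (N (Imp a b)) (Imp (N a) (N b)) \<in> GTL" by (simp add: gtl_Iff)
qed (rule subsetD[OF axioms], unfold temporal_axioms_def, blast)+

lemma N_mono: "Imp a b \<in> GTL \<Longrightarrow> Imp (N a) (N b) \<in> GTL"
  by (rule rule_mp[OF axiom_instances(3) nec_N])

lemma Gl_mono: "Imp a b \<in> GTL \<Longrightarrow> Imp (Gl a) (Gl b) \<in> GTL"
  by (rule rule_mp[OF axiom_instances(4) nec_Gl])

lemma U_mono: "Imp a b \<in> GTL \<Longrightarrow> Imp (U c a) (U c b) \<in> GTL"
  by (rule rule_mp[OF axiom_instances(5) nec_Gl])

text \<open>\<open>Gl c\<close> lies above every formula that is preserved by \<open>N\<close> and
  implies \<open>c\<close>; \<open>U_induct\<close> is the dual leastness of \<open>U b c\<close>.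
  Both are the induction axioms with the \<open>Gl\<close> premise discharged by
  necessitation.\<close>

lemma Gl_induct: "Imp b (N b) \<in> GTL \<Longrightarrow> Imp b c \<in> GTL \<Longrightarrow> Imp b (Gl c) \<in> GTL"
  by (rule deductive_imp_trans[OF deductive_GTL rule_mp[OF axiom_instances(8) nec_Gl] Gl_mono])

lemma U_induct:
  "Imp (And b (N a)) a \<in> GTL \<Longrightarrow> Imp c a \<in> GTL \<Longrightarrow> Imp (U b c) a \<in> GTL"
  by (rule deductive_imp_trans[OF deductive_GTL U_mono rule_mp[OF axiom_instances(9) nec_Gl]])

text \<open>Each axiom on \<open>N\<close> gives one clause: distribution over implication gives
  modus ponens, over disjunction primeness, and \<open>Neg (N Bot)\<close> consistency.\<close>

lemma shift_prime:
  assumes "prime_theory \<Gamma>"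
  shows "prime_theory (shift \<Gamma>)"
proof -
  note d = prime_deductive[OF assms]
  have mp: "N b \<in> \<Gamma>" if "N (Imp a b) \<in> \<Gamma>" "N a \<in> \<Gamma>" for a b
    using deductive_weaken[OF d axiom_instances(3) that(1)] deductive_mp[OF d] that(2) by blast
  have gtl: "N a \<in> \<Gamma>" if "a \<in> GTL" for a
    using nec_N[OF that] assms gtl_iff by blast
  have bot: "N Bot \<notin> \<Gamma>"
    using axiom_instances(1) assms by (auto simp: gtl_iff prime_Neg)
  have or: "N a \<in> \<Gamma> \<or> N b \<in> \<Gamma>" if "N (Or a b) \<in> \<Gamma>" for a b
    using deductive_weaken[OF d axiom_instances(2) that] assms by (simp add: prime_Or)
  show ?thesis
    unfolding prime_theory_def deductive_def shift_def mem_Collect_eq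
    by (intro conjI allI impI subsetI CollectI)
      (erule (1) mp | erule gtl | rule bot | erule or)+
qed

lemma prime_NP:
  assumes "prime_theory \<Gamma>"
  shows "N (P a) \<in> \<Gamma> \<longleftrightarrow> a \<in> \<Gamma>" "P (N a) \<in> \<Gamma> \<longleftrightarrow> a \<in> \<Gamma>"
  using NP[of a] PN[of a] assms unfolding gtl_Iff gtl_Imp by metis+

lemma unshift_shift: "prime_theory \<Gamma> \<Longrightarrow> unshift (shift \<Gamma>) = \<Gamma>"
  by (simp add: shift_def unshift_def prime_NP)

lemma shift_unshift: "prime_theory \<Gamma> \<Longrightarrow> shift (unshift \<Gamma>) = \<Gamma>"
  by (simp add: shift_def unshift_def prime_NP)

lemma shift_mono: "\<Gamma> \<subseteq> \<Delta> \<Longrightarrow> shift \<Gamma> \<subseteq> shift \<Delta>"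
  by (auto simp: shift_def)

lemma unshift_mono: "\<Gamma> \<subseteq> \<Delta> \<Longrightarrow> unshift \<Gamma> \<subseteq> unshift \<Delta>"
  by (auto simp: unshift_def)

lemma member_shift: "a \<in> shift \<Gamma> \<longleftrightarrow> N a \<in> \<Gamma>"
  by (simp add: shift_def)

text \<open>The axioms state one direction. The other is the usual fixed-point argument: the
  unfolding \<open>And a (N (Gl a))\<close> is itself preserved by \<open>N\<close>, so it implies
  \<open>Gl a\<close>.\<close>

lemma Gl_unfold:
  assumes "prime_theory \<Gamma>"
  shows "Gl a \<in> \<Gamma> \<longleftrightarrow> a \<in> \<Gamma> \<and> Gl a \<in> shift \<Gamma>"
proof -
  let ?b = "And a (N (Gl a))"
  have step: "Imp ?b (N ?b) \<in> GTL"
    by (rule deductive_imp_trans[OF deductive_GTL gtl_and2 N_mono[OF axiom_instances(6)]])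
  have "Imp ?b (Gl a) \<in> GTL" by (rule Gl_induct[OF step gtl_and1])
  note weaken = deductive_weaken[OF prime_deductive[OF assms]]
  have "Gl a \<in> \<Gamma> \<longleftrightarrow> ?b \<in> \<Gamma>"
    by (rule iffI[OF weaken[OF axiom_instances(6)] weaken[OF \<open>Imp ?b (Gl a) \<in> GTL\<close>]])
  then show ?thesis using assms by (simp add: prime_And member_shift)
qed

text \<open>Dually, the unfolding \<open>?c\<close> is closed under the step defining
  \<open>U\<close>, so \<open>U a b\<close> implies it by leastness.\<close>

lemma U_unfold:
  assumes "prime_theory \<Gamma>"
  shows "U a b \<in> \<Gamma> \<longleftrightarrow> b \<in> \<Gamma> \<or> a \<in> \<Gamma> \<and> U a b \<in> shift \<Gamma>"
proof -
  let ?c = "Or b (And a (N (U a b)))"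
  have step: "Imp (And a (N ?c)) ?c \<in> GTL"
    using N_mono[OF axiom_instances(7)[of b a]] unfolding gtl_Imp by (simp add: prime_And prime_Or)
  have "Imp (U a b) ?c \<in> GTL" by (rule U_induct[OF step gtl_or1])
  note weaken = deductive_weaken[OF prime_deductive[OF assms]]
  have "U a b \<in> \<Gamma> \<longleftrightarrow> ?c \<in> \<Gamma>"
    by (rule iffI[OF weaken[OF \<open>Imp (U a b) ?c \<in> GTL\<close>] weaken[OF axiom_instances(7)]])
  then show ?thesis using assms by (simp add: prime_And prime_Or member_shift)
qed

end

text \<open>The eventuality \<open>Inl a\<close> refutes \<open>Gl a\<close>, and \<open>Inr (a, b)\<close> realises \<open>U a b\<close>.\<close>

fun realises :: "form + form \<times> form \<Rightarrow> form set \<Rightarrow> bool" where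
  "realises (Inl a) \<Phi> \<longleftrightarrow> a \<notin> \<Phi>"
| "realises (Inr (a, b)) \<Phi> \<longleftrightarrow> b \<in> \<Phi>"

text \<open>The converse of the shift is the shift of the mirrored operators, so that every fact
  about one direction of time is available for the other.\<close>

locale tense_pair = tense N P Gl U + converse: tense P N Hi Si
  for N P Gl Hi :: "form \<Rightarrow> form" and U Si :: "form \<Rightarrow> form \<Rightarrow> form"
begin

lemma unshift_converse: "unshift = converse.shift"
  by (rule ext) (simp add: unshift_def converse.shift_def)

lemma unshift_prime: "prime_theory \<Gamma> \<Longrightarrow> prime_theory (unshift \<Gamma>)"
  unfolding unshift_converse by (rule converse.shift_prime)

text \<open>The shift is an order automorphism of the prime theories with inverse
  \<open>unshift\<close>, so it maps components onto components.\<close>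

lemma component_shift:
  assumes "prime_theory \<Gamma>"
  shows "component (shift \<Gamma>) = shift ` component \<Gamma>"
proof
  show "component (shift \<Gamma>) \<subseteq> shift ` component \<Gamma>"
  proof
    fix \<Delta> assume "\<Delta> \<in> component (shift \<Gamma>)"
    then have D: "prime_theory \<Delta>" "shift \<Gamma> \<subseteq> \<Delta> \<or> \<Delta> \<subseteq> shift \<Gamma>" by (auto simp: component_def)
    then have "\<Gamma> \<subseteq> unshift \<Delta> \<or> unshift \<Delta> \<subseteq> \<Gamma>"
      using unshift_mono unshift_shift[OF assms] by metis
    then have "unshift \<Delta> \<in> component \<Gamma>" using unshift_prime[OF D(1)] by (simp add: component_def)
    then show "\<Delta> \<in> shift ` component \<Gamma>" using shift_unshift[OF D(1)] by (metis imageI)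
  qed
  show "shift ` component \<Gamma> \<subseteq> component (shift \<Gamma>)"
    by (auto simp: component_def intro: shift_prime dest: shift_mono)
qed

definition edge :: "form set \<Rightarrow> form set \<Rightarrow> (form set \<times> form set) set" where
  "edge \<Sigma> \<Gamma> = (\<lambda>\<Delta>. (\<Delta> \<inter> \<Sigma>, shift \<Delta> \<inter> \<Sigma>)) ` component \<Gamma>"

lemma Domain_edge: "Domain (edge \<Sigma> \<Gamma>) = moment \<Sigma> \<Gamma>"
  by (auto simp: edge_def moment_def)

lemma Range_edge: "prime_theory \<Gamma> \<Longrightarrow> Range (edge \<Sigma> \<Gamma>) = moment \<Sigma> (shift \<Gamma>)"
  by (auto simp: edge_def moment_def component_shift)

definition edges :: "form set \<Rightarrow> (form set \<times> form set) set set" where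
  "edges \<Sigma> = edge \<Sigma> ` Collect prime_theory"

lemma edge_from_component:
  assumes "prime_theory \<Gamma>" "\<Delta> \<in> component \<Gamma>"
  shows "edge \<Sigma> \<Delta> = edge \<Sigma> \<Gamma>"
  using component_eq[OF assms] by (simp add: edge_def)

text \<open>Used contrapositively: steps from an unfulfillable point lead only to unfulfillable
  points.\<close>

lemma fulfillable_back:
  assumes "prime_theory \<Delta>" "fulfillable (edges \<Sigma>) met e (moment \<Sigma> (shift \<Delta>)) (shift \<Delta> \<inter> \<Sigma>)"
  shows "fulfillable (edges \<Sigma>) met e (moment \<Sigma> \<Delta>) (\<Delta> \<inter> \<Sigma>)"
proof -
  have "edge \<Sigma> \<Delta> \<in> edges \<Sigma>" "(\<Delta> \<inter> \<Sigma>, shift \<Delta> \<inter> \<Sigma>) \<in> edge \<Sigma> \<Delta>"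
    using assms(1) component_refl by (auto simp: edges_def edge_def)
  from fulfillable_step[OF this] show ?thesis
    using assms by (simp add: Domain_edge Range_edge)
qed

text \<open>If no walk fulfilled the eventuality, the formula defining \<open>?A\<close> below would satisfy the
  hypotheses of the induction axiom for \<open>U\<close>.\<close>

lemma fulfillable_U:
  assumes fin: "finite \<Sigma>" and G: "prime_theory \<Gamma>" and U: "U a b \<in> \<Gamma>" and b: "b \<in> \<Sigma>"
    and met: "\<And>\<Phi>. met e \<Phi> \<longleftrightarrow> b \<in> \<Phi>"
  shows "fulfillable (edges \<Sigma>) met e (moment \<Sigma> \<Gamma>) (\<Gamma> \<inter> \<Sigma>)"
proof (rule ccontr)
  assume neg: "\<not> ?thesis"
  let ?bad = "\<lambda>\<Phi> \<Gamma>. \<Phi> \<in> moment \<Sigma> \<Gamma> \<and> \<not> fulfillable (edges \<Sigma>) met e (moment \<Sigma> \<Gamma>) \<Phi>"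
  \<comment> \<open>No unfulfillable trace of the moment lies above the trace of \<Gamma>. It is
    phrased through a formula present in \<Gamma> but missing from \<Phi>, so that only membership
    and a property of the moment occur, both definable.\<close>
  let ?A = "\<lambda>\<Gamma>. \<forall>\<Phi>\<in>Pow \<Sigma>. \<not> ?bad \<Phi> \<Gamma> \<or> (\<exists>a\<in>\<Sigma> - \<Phi>. a \<in> \<Gamma>)"
  have "definable ?A"
  proof (intro definable_Ball definable_disj definable_Bex definable_member)
    show "definable (\<lambda>\<Gamma>. \<not> ?bad \<Phi> \<Gamma>)" for \<Phi>
      using definable_moment[OF fin, of "\<lambda>m. \<not> (\<Phi> \<in> m \<and> \<not> fulfillable (edges \<Sigma>) met e m \<Phi>)"] .
  qed (use fin in auto)
  then obtain \<alpha> where \<alpha>: "\<And>\<Gamma>. prime_theory \<Gamma> \<Longrightarrow> \<alpha> \<in> \<Gamma> \<longleftrightarrow> ?A \<Gamma>"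
    unfolding definable_def by metis
  have bad: "\<exists>\<Phi>. ?bad \<Phi> \<Delta> \<and> \<Delta> \<inter> \<Sigma> \<subseteq> \<Phi>" if "prime_theory \<Delta>" "\<alpha> \<notin> \<Delta>" for \<Delta>
    using that(2) unfolding \<alpha>[OF that(1)] by blast
  have 1: "Imp b \<alpha> \<in> GTL"
  proof -
    have "\<alpha> \<in> \<Delta>" if D: "prime_theory \<Delta>" "b \<in> \<Delta>" for \<Delta>
    proof (rule ccontr)
      assume "\<alpha> \<notin> \<Delta>"
      from bad[OF D(1) this] obtain \<Phi> where "?bad \<Phi> \<Delta>" "\<Delta> \<inter> \<Sigma> \<subseteq> \<Phi>" by blast
      then show False using D b met fulfillable_now[of met e \<Phi>] by blast
    qed
    then show ?thesis by (simp add: gtl_Imp)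
  qed
  have 2: "Imp (And a (N \<alpha>)) \<alpha> \<in> GTL"
  proof -
    have "\<alpha> \<in> \<Delta>" if D: "prime_theory \<Delta>" "N \<alpha> \<in> \<Delta>" for \<Delta>
    proof (rule ccontr)
      assume "\<alpha> \<notin> \<Delta>"
      from bad[OF D(1) this] obtain \<Phi> where \<Phi>: "?bad \<Phi> \<Delta>" "\<Delta> \<inter> \<Sigma> \<subseteq> \<Phi>" by blast
      \<comment> \<open>The bad trace \<Phi> need not be that of \<Delta>. A theory above \<Delta>
        realising it still contains \<open>N \<alpha>\<close>, while its shift has an unfulfillable
        trace.\<close>
      then obtain \<Delta>' where D': "\<Delta>' \<in> component \<Delta>" "\<Delta>' \<inter> \<Sigma> = \<Phi>" "\<Delta> \<subseteq> \<Delta>'"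
        using component_above[OF D(1)] by metis
      have p: "prime_theory \<Delta>'" "prime_theory (shift \<Delta>')"
        using component_prime[OF D'(1)] shift_prime by blast+
      have "\<not> fulfillable (edges \<Sigma>) met e (moment \<Sigma> (shift \<Delta>')) (shift \<Delta>' \<inter> \<Sigma>)"
        using fulfillable_back[OF p(1)] \<Phi>(1) moment_from_component[OF D(1) D'(1)] D'(2) by metis
      then have "?bad (shift \<Delta>' \<inter> \<Sigma>) (shift \<Delta>')"
        using component_refl[OF p(2)] by (auto simp: moment_def)
      then have "\<not> ?A (shift \<Delta>')" by blast
      moreover have "\<alpha> \<in> shift \<Delta>'" using D(2) D'(3) by (auto simp: member_shift)
      ultimately show False using \<alpha>[OF p(2)] by blast
    qed
    then show ?thesis by (simp add: gtl_Imp prime_And)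
  qed
  have "\<alpha> \<in> \<Gamma>" using U_induct[OF 2 1] U G gtl_Imp by blast
  moreover have "?bad (\<Gamma> \<inter> \<Sigma>) \<Gamma>" using neg component_refl[OF G] by (auto simp: moment_def)
  ultimately show False unfolding \<alpha>[OF G] by blast
qed

text \<open>Dual to \<open>fulfillable_U\<close>: having an unfulfillable trace of the moment below
  it is definable, implies \<open>a\<close> and is preserved by \<open>N\<close>, so it would imply
  \<open>Gl a\<close>.\<close>

lemma fulfillable_Gl:
  assumes fin: "finite \<Sigma>" and G: "prime_theory \<Gamma>" and Gl: "Gl a \<notin> \<Gamma>" and a: "a \<in> \<Sigma>"
    and met: "\<And>\<Phi>. met e \<Phi> \<longleftrightarrow> a \<notin> \<Phi>"
  shows "fulfillable (edges \<Sigma>) met e (moment \<Sigma> \<Gamma>) (\<Gamma> \<inter> \<Sigma>)"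
proof (rule ccontr)
  assume neg: "\<not> ?thesis"
  let ?bad = "\<lambda>\<Phi> \<Gamma>. \<Phi> \<in> moment \<Sigma> \<Gamma> \<and> \<not> fulfillable (edges \<Sigma>) met e (moment \<Sigma> \<Gamma>) \<Phi>"
  let ?A = "\<lambda>\<Gamma>. \<exists>\<Phi>\<in>Pow \<Sigma>. ?bad \<Phi> \<Gamma> \<and> (\<forall>a\<in>\<Phi>. a \<in> \<Gamma>)"
  have "definable ?A"
  proof (intro definable_Ball definable_Bex definable_member definable_conj[of "\<lambda>\<Gamma>. _ \<Gamma> \<and> _ \<Gamma>"])
    show "definable (\<lambda>\<Gamma>. ?bad \<Phi> \<Gamma>)" for \<Phi>
      using definable_moment[OF fin, of "\<lambda>m. \<Phi> \<in> m \<and> \<not> fulfillable (edges \<Sigma>) met e m \<Phi>"] .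
  qed (use fin finite_subset in auto)
  then obtain \<beta> where \<beta>: "\<And>\<Gamma>. prime_theory \<Gamma> \<Longrightarrow> \<beta> \<in> \<Gamma> \<longleftrightarrow> ?A \<Gamma>"
    unfolding definable_def by metis
  have bad: "\<exists>\<Phi>. ?bad \<Phi> \<Delta> \<and> \<Phi> \<subseteq> \<Delta> \<inter> \<Sigma>" if "prime_theory \<Delta>" "\<beta> \<in> \<Delta>" for \<Delta>
    using that(2) unfolding \<beta>[OF that(1)] by blast
  have 1: "Imp \<beta> a \<in> GTL"
  proof -
    have "a \<in> \<Delta>" if D: "prime_theory \<Delta>" "\<beta> \<in> \<Delta>" for \<Delta>
      using bad[OF D] met fulfillable_now[of met e] by blast
    then show ?thesis by (simp add: gtl_Imp)
  qed
  have 2: "Imp \<beta> (N \<beta>) \<in> GTL"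
  proof -
    have "N \<beta> \<in> \<Delta>" if D: "prime_theory \<Delta>" "\<beta> \<in> \<Delta>" for \<Delta>
    proof -
      from bad[OF D] obtain \<Phi> where \<Phi>: "?bad \<Phi> \<Delta>" "\<Phi> \<subseteq> \<Delta> \<inter> \<Sigma>" by blast
      then obtain \<Delta>' where D': "\<Delta>' \<in> component \<Delta>" "\<Delta>' \<inter> \<Sigma> = \<Phi>" "\<Delta>' \<subseteq> \<Delta>"
        using component_below[OF D(1)] by metis
      have p: "prime_theory \<Delta>'" "prime_theory (shift \<Delta>')"
        using component_prime[OF D'(1)] shift_prime by blast+
      have "\<not> fulfillable (edges \<Sigma>) met e (moment \<Sigma> (shift \<Delta>')) (shift \<Delta>' \<inter> \<Sigma>)"
        using fulfillable_back[OF p(1)] \<Phi>(1) moment_from_component[OF D(1) D'(1)] D'(2) by metis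
      then have "?bad (shift \<Delta>' \<inter> \<Sigma>) (shift \<Delta>')"
        using component_refl[OF p(2)] by (auto simp: moment_def)
      then have "?A (shift \<Delta>')" by blast
      then have "\<beta> \<in> shift \<Delta>'" using \<beta>[OF p(2)] by blast
      then show ?thesis using D'(3) by (auto simp: member_shift)
    qed
    then show ?thesis by (simp add: gtl_Imp)
  qed
  have "?bad (\<Gamma> \<inter> \<Sigma>) \<Gamma>" using neg component_refl[OF G] by (auto simp: moment_def)
  then have "\<beta> \<in> \<Gamma>" unfolding \<beta>[OF G] by blast
  then have "Gl a \<in> \<Gamma>" using Gl_induct[OF 2 1] G gtl_Imp by blast
  then show False using Gl by contradiction
qed

fun pending :: "form set \<Rightarrow> form + form \<times> form \<Rightarrow> form set \<Rightarrow> bool" where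
  "pending \<Sigma> (Inl a) \<Phi> \<longleftrightarrow> Gl a \<in> \<Sigma> \<and> Gl a \<notin> \<Phi>"
| "pending \<Sigma> (Inr (a, b)) \<Phi> \<longleftrightarrow> U a b \<in> \<Sigma> \<and> U a b \<in> \<Phi>"

lemma edgesE:
  assumes "E \<in> edges \<Sigma>" "(x, y) \<in> E"
  obtains \<Delta> where "prime_theory \<Delta>" "E = edge \<Sigma> \<Delta>" "x = \<Delta> \<inter> \<Sigma>" "y = shift \<Delta> \<inter> \<Sigma>"
proof -
  obtain \<Gamma> where G: "prime_theory \<Gamma>" "E = edge \<Sigma> \<Gamma>" using assms(1) by (auto simp: edges_def)
  with assms(2) obtain \<Delta> where D: "\<Delta> \<in> component \<Gamma>" "x = \<Delta> \<inter> \<Sigma>" "y = shift \<Delta> \<inter> \<Sigma>"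
    by (auto simp: edge_def)
  then show thesis
    using that[of \<Delta>] component_prime edge_from_component[OF G(1) D(1)] G(2) by metis
qed

lemma edges_Gl:
  assumes "E \<in> edges \<Sigma>" "(x, y) \<in> E" "Gl a \<in> \<Sigma>" "a \<in> \<Sigma>"
  shows "Gl a \<in> x \<longleftrightarrow> a \<in> x \<and> Gl a \<in> y"
  using edgesE[OF assms(1,2)] Gl_unfold assms(3,4) by (metis Int_iff)

lemma edges_U:
  assumes "E \<in> edges \<Sigma>" "(x, y) \<in> E" "U a b \<in> \<Sigma>" "a \<in> \<Sigma>" "b \<in> \<Sigma>"
  shows "U a b \<in> x \<longleftrightarrow> b \<in> x \<or> a \<in> x \<and> U a b \<in> y"
  using edgesE[OF assms(1,2)] U_unfold assms(3-5) by (metis Int_iff)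

lemma edges_N:
  assumes "E \<in> edges \<Sigma>" "(x, y) \<in> E" "N a \<in> \<Sigma>" "a \<in> \<Sigma>"
  shows "N a \<in> x \<longleftrightarrow> a \<in> y"
  using edgesE[OF assms(1,2)] member_shift assms(3,4) by (metis Int_iff)

lemma edges_eventualities:
  assumes fin: "finite \<Sigma>"
    and sub: "\<And>a. Gl a \<in> \<Sigma> \<Longrightarrow> a \<in> \<Sigma>" "\<And>a b. U a b \<in> \<Sigma> \<Longrightarrow> a \<in> \<Sigma> \<and> b \<in> \<Sigma>"
  shows "eventualities (edges \<Sigma>) (pending \<Sigma>) realises"
proof
  fix E assume E: "E \<in> edges \<Sigma>"
  then obtain \<Gamma> where G: "prime_theory \<Gamma>" "E = edge \<Sigma> \<Gamma>" by (auto simp: edges_def)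
  show "\<exists>E'\<in>edges \<Sigma>. Domain E' = Range E"
  proof
    show "Domain (edge \<Sigma> (shift \<Gamma>)) = Range E" using G by (simp add: Domain_edge Range_edge)
    show "edge \<Sigma> (shift \<Gamma>) \<in> edges \<Sigma>"
      using shift_prime[OF G(1)] by (auto simp: edges_def)
  qed
  show "pending \<Sigma> e y" if "(x, y) \<in> E" "pending \<Sigma> e x" "\<not> realises e x" for e x y
  proof (cases e)
    case (Inl a)
    then show ?thesis using that edges_Gl[OF E that(1), of a] sub(1)[of a] by auto
  next
    case (Inr ab)
    then obtain a b where "e = Inr (a, b)" by (cases ab) auto
    then show ?thesis using that edges_U[OF E that(1), of a b] sub(2)[of a b] by auto
  qed
  have "{(e, x). x \<in> Domain E \<and> pending \<Sigma> e x} \<subseteq> (Inl ` \<Sigma> \<union> Inr ` (\<Sigma> \<times> \<Sigma>)) \<times> Pow \<Sigma>"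
  proof
    fix p assume "p \<in> {(e, x). x \<in> Domain E \<and> pending \<Sigma> e x}"
    then obtain e x z where p: "p = (e, x)" and "pending \<Sigma> e x" "(x, z) \<in> E" by auto
    moreover have "x \<subseteq> \<Sigma>" using edgesE[OF E \<open>(x, z) \<in> E\<close>] by blast
    moreover have "e \<in> Inl ` \<Sigma> \<union> Inr ` (\<Sigma> \<times> \<Sigma>)"
    proof (cases e)
      case (Inl a)
      then show ?thesis using \<open>pending \<Sigma> e x\<close> sub(1)[of a] by simp
    next
      case (Inr ab)
      then obtain a b where "e = Inr (a, b)" by (cases ab) auto
      then show ?thesis using \<open>pending \<Sigma> e x\<close> sub(2)[of a b] by simp
    qed
    ultimately show "p \<in> (Inl ` \<Sigma> \<union> Inr ` (\<Sigma> \<times> \<Sigma>)) \<times> Pow \<Sigma>" by (simp add: p)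
  qed
  then show "finite {(e, x). x \<in> Domain E \<and> pending \<Sigma> e x}"
    by (rule finite_subset) (use fin in auto)
  show "fulfillable (edges \<Sigma>) realises e (Domain E) x" if x: "x \<in> Domain E" and p: "pending \<Sigma> e x" for e x
  proof -
    obtain y where "(x, y) \<in> E" using x by blast
    then obtain \<Delta> where D: "prime_theory \<Delta>" "E = edge \<Sigma> \<Delta>" "x = \<Delta> \<inter> \<Sigma>" by (rule edgesE[OF E])
    show ?thesis
    proof (cases e)
      case (Inl a)
      then show ?thesis
        using D p sub(1)[of a] fulfillable_Gl[OF fin D(1), of a realises e] by (auto simp: Domain_edge)
    next
      case (Inr ab)
      then obtain a b where "e = Inr (a, b)" by (cases ab) auto
      then show ?thesis
        using D p sub(2)[of a b] fulfillable_U[OF fin D(1), of a b realises e] by (auto simp: Domain_edge)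
    qed
  qed
qed

end

section \<open>Both directions of time\<close>

interpretation future: tense Next Prev Glob Until
  by unfold_locales (auto intro: ax_future nec_X nec_G ax_XY ax_YX)

interpretation past: tense Prev Next Hist Since
  by unfold_locales (auto intro: ax_past nec_Y nec_H ax_XY ax_YX)

interpretation future: tense_pair Next Prev Glob Hist Until Since
  by unfold_locales

interpretation past: tense_pair Prev Next Hist Glob Since Until
  by unfold_locales

lemma past_shift: "past.shift = future.unshift"
  by (rule ext) (simp add: past.shift_def future.unshift_def)

text \<open>The past edge at \<Gamma> is the reversed future edge at its predecessor
  \<open>unshift \<Gamma>\<close>, and \<open>unshift\<close> is onto. This allows walks into the
  past to be glued to walks into the future.\<close>

lemma past_edges: "past.edges \<Sigma> = converse ` future.edges \<Sigma>"
proof -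
  have e: "past.edge \<Sigma> \<Gamma> = (future.edge \<Sigma> (future.unshift \<Gamma>))\<inverse>" if G: "prime_theory \<Gamma>" for \<Gamma>
  proof -
    have "component (future.unshift \<Gamma>) = future.unshift ` component \<Gamma>"
      using past.component_shift[OF G] by (simp add: past_shift)
    then have "future.edge \<Sigma> (future.unshift \<Gamma>) =
      (\<lambda>\<Delta>. (future.unshift \<Delta> \<inter> \<Sigma>, future.shift (future.unshift \<Delta>) \<inter> \<Sigma>)) ` component \<Gamma>"
      by (simp add: future.edge_def image_image)
    also have "\<dots> = (\<lambda>\<Delta>. (future.unshift \<Delta> \<inter> \<Sigma>, \<Delta> \<inter> \<Sigma>)) ` component \<Gamma>"
      by (rule image_cong) (auto simp: future.shift_unshift component_prime)
    finally show ?thesis by (auto simp: past.edge_def past_shift)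
  qed
  have "past.edges \<Sigma> = converse ` future.edge \<Sigma> ` future.unshift ` Collect prime_theory"
    unfolding past.edges_def image_image by (rule image_cong) (auto simp: e)
  also have "future.unshift ` Collect prime_theory = Collect prime_theory"
  proof -
    have "\<Gamma> \<in> future.unshift ` Collect prime_theory" if "prime_theory \<Gamma>" for \<Gamma>
      using future.unshift_shift[OF that, symmetric] future.shift_prime[OF that]
      by (rule image_eqI[OF _ CollectI])
    then show ?thesis using future.unshift_prime by (intro equalityI subsetI) auto
  qed
  finally show ?thesis by (simp add: future.edges_def)
qed

section \<open>Linearly ordered families of fulfilling paths\<close>

text \<open>Time reversal. Step \<open>n\<close> of the mirrored timeline leads from time
  \<open>-n\<close> to \<open>-n - 1\<close>, and the original step between these two has index
  \<open>-n - 1\<close>.\<close>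

definition mirror :: "(int \<Rightarrow> ('p \<times> 'p) set) \<Rightarrow> int \<Rightarrow> ('p \<times> 'p) set" where
  "mirror R n = (R (- n - 1))\<inverse>"

lemma mirror_iff: "(x, y) \<in> mirror R n \<longleftrightarrow> (y, x) \<in> R (- n - 1)"
  by (simp add: mirror_def)

lemma Domain_mirror: "(\<And>n. Range (R n) = Domain (R (n + 1))) \<Longrightarrow> Domain (mirror R n) = Domain (R (- n))"
  by (simp add: mirror_def)

lemma Range_mirror:
  "(\<And>n. Range (R n) = Domain (R (n + 1))) \<Longrightarrow> Range (mirror R n) = Domain (mirror R (n + 1))"
  by (simp add: mirror_def minus_diff_commute)

text \<open>\<open>monotone\<close> is restricted to distinct points, since one point may have
  several successors. Fulfilment of past eventualities is stated on the mirrored timeline.\<close>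

locale timeline =
  fixes R :: "int \<Rightarrow> ('p::order \<times> 'p) set"
    and pendF metF pendP metP :: "'e \<Rightarrow> 'p \<Rightarrow> bool"
  assumes range: "Range (R n) = Domain (R (n + 1))"
    and comparable: "x \<in> Domain (R n) \<Longrightarrow> y \<in> Domain (R n) \<Longrightarrow> x \<le> y \<or> y \<le> x"
    and monotone: "(x, x') \<in> R n \<Longrightarrow> (y, y') \<in> R n \<Longrightarrow> x < y \<Longrightarrow> x' \<le> y'"
    and finite_Domain: "finite (Domain (R n))"
    and persistF: "(x, y) \<in> R n \<Longrightarrow> pendF e x \<Longrightarrow> \<not> metF e x \<Longrightarrow> pendF e y"
    and persistP: "(x, y) \<in> R n \<Longrightarrow> pendP e y \<Longrightarrow> \<not> metP e y \<Longrightarrow> pendP e x"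
    and finF: "finite {e. pendF e x}"
    and finP: "finite {e. pendP e x}"
    and meetF: "x \<in> Domain (R n) \<Longrightarrow> pendF e x \<Longrightarrow> met_from R metF e n x"
    and meetP: "x \<in> Domain (mirror R n) \<Longrightarrow> pendP e x \<Longrightarrow> met_from (mirror R) metP e n x"
begin

definition path :: "(int \<Rightarrow> 'p) \<Rightarrow> bool" where
  "path w \<longleftrightarrow> (\<forall>n. (w n, w (n + 1)) \<in> R n)"

definition fulfilling :: "(int \<Rightarrow> 'p) \<Rightarrow> bool" where
  "fulfilling w \<longleftrightarrow> path w
    \<and> (\<forall>n e. pendF e (w n) \<longrightarrow> (\<exists>m\<ge>n. metF e (w m)))
    \<and> (\<forall>n e. pendP e (w n) \<longrightarrow> (\<exists>m\<le>n. metP e (w m)))"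

lemma pathD: "path w \<Longrightarrow> (w n, w (n + 1)) \<in> R n"
  by (simp add: path_def)

lemma path_Domain: "path w \<Longrightarrow> w n \<in> Domain (R n)"
  using pathD by blast

lemma fulfilling_pathD: "fulfilling w \<Longrightarrow> path w"
  by (simp add: fulfilling_def)

lemma fulfillingD:
  assumes "fulfilling w"
  shows "pendF e (w n) \<Longrightarrow> \<exists>m\<ge>n. metF e (w m)" "pendP e (w n) \<Longrightarrow> \<exists>m\<le>n. metP e (w m)"
  using assms unfolding fulfilling_def by blast+

lemma co_monotone: "(x, x') \<in> R n \<Longrightarrow> (y, y') \<in> R n \<Longrightarrow> x' < y' \<Longrightarrow> x \<le> y"
  using comparable[of x n y] monotone[of y y' n x x'] by (metis DomainI leD order.order_iff_strict)

lemma pendF_forward: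
  assumes "path w" "pendF e (w n)" "n \<le> m" "\<forall>i. n \<le> i \<and> i < m \<longrightarrow> \<not> metF e (w i)"
  shows "pendF e (w m)"
  using assms(3,4)
proof (induction m rule: int_ge_induct)
  case (step m)
  then have "pendF e (w m)" "\<not> metF e (w m)" by auto
  then show ?case using persistF pathD[OF assms(1)] by blast
qed (use assms in simp)

lemma pendP_backward:
  assumes "path w" "pendP e (w n)" "m \<le> n" "\<forall>i. m < i \<and> i \<le> n \<longrightarrow> \<not> metP e (w i)"
  shows "pendP e (w m)"
  using assms(3,4)
proof (induction m rule: int_le_induct)
  case (step m)
  then have "pendP e (w m)" "\<not> metP e (w m)" by auto
  then show ?case using persistP pathD[OF assms(1), of "m - 1"] by simp
qed (use assms in simp)

text \<open>A future eventuality pending before \<open>k\<close> is met on the way or still pending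
  at \<open>k\<close>, and symmetrically for the past. So only the two outer halves need checking,
  which makes gluing at \<open>k\<close> harmless.\<close>

lemma fulfilling_from_ends:
  assumes p: "path w"
    and F: "\<And>n e. k \<le> n \<Longrightarrow> pendF e (w n) \<Longrightarrow> \<exists>m\<ge>n. metF e (w m)"
    and P: "\<And>n e. n \<le> k \<Longrightarrow> pendP e (w n) \<Longrightarrow> \<exists>m\<le>n. metP e (w m)"
  shows "fulfilling w"
proof -
  have "\<exists>m\<ge>n. metF e (w m)" if e: "pendF e (w n)" for n e
  proof (cases "k \<le> n")
    case False
    show ?thesis
    proof (cases "\<exists>i. n \<le> i \<and> i < k \<and> metF e (w i)")
      case no: False
      then have "pendF e (w k)" using False by (intro pendF_forward[OF p e]) auto
      then obtain m where "k \<le> m" "metF e (w m)" using F[of k e] by blast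
      then show ?thesis using False by (intro exI[of _ m]) simp
    qed auto
  qed (use F e in simp)
  moreover have "\<exists>m\<le>n. metP e (w m)" if e: "pendP e (w n)" for n e
  proof (cases "n \<le> k")
    case False
    show ?thesis
    proof (cases "\<exists>i. k < i \<and> i \<le> n \<and> metP e (w i)")
      case no: False
      then have "pendP e (w k)" using False by (intro pendP_backward[OF p e]) auto
      then obtain m where "m \<le> k" "metP e (w m)" using P[of k e] by blast
      then show ?thesis using False by (intro exI[of _ m]) simp
    qed auto
  qed (use P e in simp)
  ultimately show ?thesis using p by (simp add: fulfilling_def)
qed

text \<open>Two one-sided paths are glued at \<open>n\<close>, the forward one meeting future and
  the backward one past eventualities; \<open>fulfilling_from_ends\<close> covers the opposite
  directions.\<close>

lemma path_through:
  assumes x: "x \<in> Domain (R n)"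
  obtains w where "fulfilling w" "w n = x"
proof -
  obtain y where y: "y 0 = x" "\<And>k. (y k, y (Suc k)) \<in> R (n + int k)"
    "\<And>k e. pendF e (y k) \<Longrightarrow> \<exists>j\<ge>k. metF e (y j)"
    by (rule fulfilling_path[of R pendF metF, OF range persistF finF meetF x]) blast+
  have x': "x \<in> Domain (mirror R (- n))" using x by (simp add: Domain_mirror range)
  have persist': "pendP e b" if "(a, b) \<in> mirror R m" "pendP e a" "\<not> metP e a" for a b m e
    using that persistP by (simp add: mirror_iff)
  obtain z where z: "z 0 = x" "\<And>k. (z k, z (Suc k)) \<in> mirror R (- n + int k)"
    "\<And>k e. pendP e (z k) \<Longrightarrow> \<exists>j\<ge>k. metP e (z j)"
    by (rule fulfilling_path[of "mirror R" pendP metP, OF Range_mirror[of R, OF range] persist' finP meetP x'])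
      blast+
  define w where "w i = (if n \<le> i then y (nat (i - n)) else z (nat (n - i)))" for i
  have wy: "w (n + int k) = y k" for k by (simp add: w_def)
  have wz: "w (n - int k) = z k" for k using y(1) z(1) by (cases "k = 0") (simp_all add: w_def)
  have above: "\<exists>k. i = n + int k" if "n \<le> i" for i using that zle_iff_zadd by blast
  have below: "\<exists>k. i = n - int k" if "i \<le> n" for i
    using that zle_iff_zadd[of i n] by (metis add_diff_cancel_right')
  have "path w"
    unfolding path_def
  proof
    fix i
    show "(w i, w (i + 1)) \<in> R i"
    proof (cases "n \<le> i")
      case True
      then obtain k where k: "i = n + int k" using above by blast
      then show ?thesis using y(2)[of k] wy[of k] wy[of "Suc k"] by (simp add: ac_simps)
    next
      case False
      then obtain k where k: "i + 1 = n - int k" using below[of "i + 1"] by auto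
      then have i: "n - int (Suc k) = i" "n - int k - 1 = i" by simp_all
      then show ?thesis using z(2)[of k] wz[of k] wz[of "Suc k"] k
        unfolding i by (simp add: mirror_iff i(2))
    qed
  qed
  moreover have "\<exists>m\<ge>i. metF e (w m)" if h: "n \<le> i" "pendF e (w i)" for i e
  proof -
    obtain k where k: "i = n + int k" using above \<open>n \<le> i\<close> by blast
    then obtain j where "k \<le> j" "metF e (y j)" using h y(3) wy by metis
    then show ?thesis using wy[of j] k by (intro exI[of _ "n + int j"]) simp
  qed
  moreover have "\<exists>m\<le>i. metP e (w m)" if h: "i \<le> n" "pendP e (w i)" for i e
  proof -
    obtain k where k: "i = n - int k" using below \<open>i \<le> n\<close> by blast
    then obtain j where "k \<le> j" "metP e (z j)" using h z(3) wz by metis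
    then show ?thesis using wz[of j] k by (intro exI[of _ "n - int j"]) simp
  qed
  ultimately have "fulfilling w" by (rule fulfilling_from_ends)
  then show thesis using that[of w] wy[of 0] y(1) by simp
qed

text \<open>From \<open>k\<close> on the future is that of \<open>v\<close>, up to \<open>k\<close>
  the past is that of \<open>w\<close>; the rest follows from
  \<open>fulfilling_from_ends\<close>.\<close>

lemma splice:
  assumes w: "fulfilling w" and v: "fulfilling v" and eq: "w k = v k"
  shows "fulfilling (\<lambda>i. if i < k then w i else v i)"
proof (rule fulfilling_from_ends[of _ k])
  let ?s = "\<lambda>i. if i < k then w i else v i"
  have s: "?s i = w i" if "i \<le> k" for i using that eq by auto
  show "path ?s"
    unfolding path_def
  proof
    fix i
    show "(?s i, ?s (i + 1)) \<in> R i"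
      using s[of i] s[of "i + 1"] pathD[OF fulfilling_pathD[OF w], of i]
        pathD[OF fulfilling_pathD[OF v], of i]
      by (cases "i < k") auto
  qed
  show "\<exists>m\<ge>n. metF e (?s m)" if "k \<le> n" "pendF e (?s n)" for n e
  proof -
    from that have "pendF e (v n)" by auto
    then obtain m where "m \<ge> n" "metF e (v m)" using fulfillingD(1)[OF v] by blast
    then show ?thesis using that by (intro exI[of _ m]) auto
  qed
  show "\<exists>m\<le>n. metP e (?s m)" if "n \<le> k" "pendP e (?s n)" for n e
  proof -
    from that have "pendP e (w n)" using s by metis
    then obtain m where "m \<le> n" "metP e (w m)" using fulfillingD(2)[OF w] by blast
    then show ?thesis using that s[of m] by (intro exI[of _ m]) auto
  qed
qed

text \<open>One step after a strict inequality the weak one holds, so the order of two paths can be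
  reversed only after a time at which they coincide.\<close>

lemma no_crossing_forward:
  assumes "path q" "path u" "q n < u n" "n \<le> m" "\<forall>i. n \<le> i \<and> i < m \<longrightarrow> q i \<noteq> u i"
  shows "q m \<le> u m"
  using assms(4,5)
proof (induction m rule: int_ge_induct)
  case (step m)
  then have "q m \<le> u m" "q m \<noteq> u m" by auto
  then show ?case using monotone[OF pathD[OF assms(1)] pathD[OF assms(2)]] by simp
qed (use assms in simp)

lemma no_crossing_backward:
  assumes "path q" "path u" "q n < u n" "m \<le> n" "\<forall>i. m < i \<and> i \<le> n \<longrightarrow> q i \<noteq> u i"
  shows "q m \<le> u m"
  using assms(4,5)
proof (induction m rule: int_le_induct)
  case (step m)
  then have "q m \<le> u m" "q m \<noteq> u m" by auto
  then show ?case
    using co_monotone[OF pathD[OF assms(1), of "m - 1"] pathD[OF assms(2), of "m - 1"]] by simp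
qed (use assms in simp)

text \<open>Two paths can only cross where they meet, so a path is made comparable with \<open>u\<close> by letting
  it follow \<open>u\<close> from the first meeting point on, in both directions of time.\<close>

lemma follow_forward:
  assumes q: "fulfilling q" and u: "fulfilling u" and ne: "q n \<noteq> u n"
  obtains v where "fulfilling v" "\<And>i. i \<le> n \<Longrightarrow> v i = q i" "\<And>i. v i = q i \<or> v i = u i"
    "\<And>i. n \<le> i \<Longrightarrow> q n < u n \<Longrightarrow> v i \<le> u i" "\<And>i. n \<le> i \<Longrightarrow> u n < q n \<Longrightarrow> u i \<le> v i"
proof -
  note paths = fulfilling_pathD[OF q] fulfilling_pathD[OF u]
  show thesis
  proof (cases "\<exists>k::nat. q (n + int k) = u (n + int k)")
    case True
    define K where "K = (LEAST k. q (n + int k) = u (n + int k))"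
    define k where "k = n + int K"
    have k: "q k = u k" unfolding k_def K_def by (rule LeastI_ex[OF True])
    have "k \<noteq> n" using k ne by metis
    then have nk: "n < k" by (simp add: k_def)
    have before: "q i \<noteq> u i" if "n \<le> i" "i < k" for i
    proof -
      have "nat (i - n) < K" "n + int (nat (i - n)) = i" using that by (simp_all add: k_def)
      then show ?thesis
        using not_less_Least[of "nat (i - n)" "\<lambda>k. q (n + int k) = u (n + int k)"]
        unfolding K_def by simp
    qed
    let ?v = "\<lambda>i. if i < k then q i else u i"
    show thesis
    proof (rule that[of ?v])
      show "fulfilling ?v" by (rule splice[OF q u k])
      show "?v i \<le> u i" if "n \<le> i" "q n < u n" for i
        using no_crossing_forward[OF paths that(2,1)] before by auto
      show "u i \<le> ?v i" if "n \<le> i" "u n < q n" for i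
        using no_crossing_forward[OF paths(2,1) that(2,1)] before by (auto simp: eq_commute)
    qed (use nk in auto)
  next
    case False
    have never: "q i \<noteq> u i" if "n \<le> i" for i
      using False that zle_iff_zadd[of n i] by auto
    show thesis
    proof (rule that[of q])
      show "q i \<le> u i" if "n \<le> i" "q n < u n" for i
        using no_crossing_forward[OF paths that(2,1)] never by auto
      show "u i \<le> q i" if "n \<le> i" "u n < q n" for i
        using no_crossing_forward[OF paths(2,1) that(2,1)] never by (auto simp: eq_commute)
    qed (use q in auto)
  qed
qed

lemma follow_backward:
  assumes q: "fulfilling q" and u: "fulfilling u" and ne: "q n \<noteq> u n"
  obtains v where "fulfilling v" "\<And>i. n \<le> i \<Longrightarrow> v i = q i" "\<And>i. v i = q i \<or> v i = u i"
    "\<And>i. i \<le> n \<Longrightarrow> q n < u n \<Longrightarrow> v i \<le> u i" "\<And>i. i \<le> n \<Longrightarrow> u n < q n \<Longrightarrow> u i \<le> v i"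
proof -
  note paths = fulfilling_pathD[OF q] fulfilling_pathD[OF u]
  show thesis
  proof (cases "\<exists>k::nat. q (n - int k) = u (n - int k)")
    case True
    define K where "K = (LEAST k. q (n - int k) = u (n - int k))"
    define k where "k = n - int K"
    have k: "q k = u k" unfolding k_def K_def by (rule LeastI_ex[OF True])
    have "k \<noteq> n" using k ne by metis
    then have nk: "k < n" by (simp add: k_def)
    have before: "q i \<noteq> u i" if "k < i" "i \<le> n" for i
    proof -
      have "nat (n - i) < K" "n - int (nat (n - i)) = i" using that by (simp_all add: k_def)
      then show ?thesis
        using not_less_Least[of "nat (n - i)" "\<lambda>k. q (n - int k) = u (n - int k)"]
        unfolding K_def by simp
    qed
    let ?v = "\<lambda>i. if i < k then u i else q i"
    show thesis
    proof (rule that[of ?v])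
      show "fulfilling ?v" by (rule splice[OF u q k[symmetric]])
      show "?v i \<le> u i" if "i \<le> n" "q n < u n" for i
        using no_crossing_backward[OF paths that(2,1)] before by auto
      show "u i \<le> ?v i" if "i \<le> n" "u n < q n" for i
        using no_crossing_backward[OF paths(2,1) that(2,1)] before by (auto simp: eq_commute)
    qed (use nk in auto)
  next
    case False
    have never: "q i \<noteq> u i" if "i \<le> n" for i
      using False that zle_iff_zadd[of i n] by (metis add_diff_cancel_right')
    show thesis
    proof (rule that[of q])
      show "q i \<le> u i" if "i \<le> n" "q n < u n" for i
        using no_crossing_backward[OF paths that(2,1)] never by auto
      show "u i \<le> q i" if "i \<le> n" "u n < q n" for i
        using no_crossing_backward[OF paths(2,1) that(2,1)] never by (auto simp: eq_commute)
    qed (use q in auto)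
  qed
qed

text \<open>The forward correction is followed by a backward one, which leaves times from
  \<open>n\<close> on unchanged. That all values come from \<open>q\<close> or \<open>u\<close> lets
  inequalities already secured survive a further correction.\<close>

lemma follow:
  assumes q: "fulfilling q" and u: "fulfilling u" and ne: "q n \<noteq> u n"
  obtains v where "fulfilling v" "v n = q n" "\<And>i. v i = q i \<or> v i = u i"
    "q n < u n \<Longrightarrow> v \<le> u" "u n < q n \<Longrightarrow> u \<le> v"
proof -
  obtain v where v: "fulfilling v" "\<And>i. i \<le> n \<Longrightarrow> v i = q i" "\<And>i. v i = q i \<or> v i = u i"
    "\<And>i. n \<le> i \<Longrightarrow> q n < u n \<Longrightarrow> v i \<le> u i" "\<And>i. n \<le> i \<Longrightarrow> u n < q n \<Longrightarrow> u i \<le> v i"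
    using follow_forward[OF q u ne] by metis
  have vn: "v n = q n" using v(2) by simp
  then have "v n \<noteq> u n" using ne by simp
  from follow_backward[OF v(1) u this] obtain v' where v': "fulfilling v'"
    "\<And>i. n \<le> i \<Longrightarrow> v' i = v i" "\<And>i. v' i = v i \<or> v' i = u i"
    "\<And>i. i \<le> n \<Longrightarrow> v n < u n \<Longrightarrow> v' i \<le> u i" "\<And>i. i \<le> n \<Longrightarrow> u n < v n \<Longrightarrow> u i \<le> v' i"
    by metis
  show thesis
  proof (rule that[of v'])
    show "v' n = q n" using v' vn by simp
    show "v' i = q i \<or> v' i = u i" for i using v(3) v'(3) by metis
    show "v' \<le> u" if "q n < u n"
    proof (rule le_funI)
      show "v' i \<le> u i" for i
        using v(4)[of i] v'(2)[of i] v'(4)[of i] vn that by (cases "n \<le> i") auto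
    qed
    show "u \<le> v'" if "u n < q n"
    proof (rule le_funI)
      show "u i \<le> v' i" for i
        using v(5)[of i] v'(2)[of i] v'(5)[of i] vn that by (cases "n \<le> i") auto
    qed
  qed (rule v'(1))
qed

section \<open>Linear families passing through all points\<close>

definition linear_family :: "(int \<Rightarrow> 'p) set \<Rightarrow> bool" where
  "linear_family F \<longleftrightarrow> (\<forall>w\<in>F. fulfilling w) \<and> (\<forall>w\<in>F. \<forall>v\<in>F. w \<le> v \<or> v \<le> w)"

lemma linear_family_finite_bound:
  assumes "linear_family F" "finite A" "A \<noteq> {}" "A \<subseteq> F"
  shows "\<exists>l\<in>A. \<forall>a\<in>A. a \<le> l" "\<exists>u\<in>A. \<forall>a\<in>A. u \<le> a"
proof -
  obtain l where "l \<in> A" "\<forall>a\<in>A. l \<le> a \<longrightarrow> l = a" using finite_has_maximal[OF assms(2,3)] by blast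
  then show "\<exists>l\<in>A. \<forall>a\<in>A. a \<le> l" using assms unfolding linear_family_def by (metis subsetD)
  obtain u where "u \<in> A" "\<forall>a\<in>A. a \<le> u \<longrightarrow> u = a" using finite_has_minimal[OF assms(2,3)] by blast
  then show "\<exists>u\<in>A. \<forall>a\<in>A. u \<le> a" using assms unfolding linear_family_def by (metis subsetD)
qed

text \<open>As \<open>F\<close> is finite, the paths passing below \<open>x\<close> at time
  \<open>n\<close> have a largest member and those above a smallest one, if there are any. It is
  enough to reroute a path through \<open>x\<close> against the former and then against the
  latter.\<close>

lemma linear_family_insert:
  assumes F: "linear_family F" "finite F" and x: "x \<in> Domain (R n)"
  obtains F' where "linear_family F'" "finite F'" "F \<subseteq> F'" "\<exists>w\<in>F'. w n = x"
proof (cases "\<exists>w\<in>F. w n = x")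
  case False
  obtain q where q: "fulfilling q" "q n = x" using path_through[OF x] by blast
  let ?L = "{f \<in> F. f n < x}" and ?U = "{f \<in> F. x < f n}"
  have fin: "finite ?L" "finite ?U" using F(2) by simp_all
  have split: "f \<in> ?L \<or> f \<in> ?U" if "f \<in> F" for f
  proof -
    have "f n \<in> Domain (R n)" using that F(1) path_Domain fulfilling_pathD
      by (auto simp: linear_family_def)
    then show ?thesis using comparable[OF _ x] that False by (auto simp: order.order_iff_strict)
  qed
  have LU: "l \<le> u" if "l \<in> ?L" "u \<in> ?U" for l u
  proof -
    have "\<not> u n \<le> l n" using that by auto
    then have "\<not> u \<le> l" by (auto simp: le_fun_def)
    then show ?thesis using F(1) that unfolding linear_family_def by blast
  qed
  obtain q1 where q1: "fulfilling q1" "q1 n = x" "\<forall>l\<in>?L. l \<le> q1"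
  proof (cases "?L = {}")
    case True
    then show thesis using that[of q] q by blast
  next
    case ne: False
    obtain l where l: "l \<in> ?L" "\<forall>a\<in>?L. a \<le> l"
      using linear_family_finite_bound(1)[OF F(1) fin(1) ne] by blast
    then have "fulfilling l" "l n < q n" using F(1) q(2) by (auto simp: linear_family_def)
    then obtain v where v: "fulfilling v" "v n = q n" "l \<le> v"
      using follow[OF q(1), of l n] by (metis less_irrefl)
    have "\<forall>a\<in>?L. a \<le> v" using l(2) v(3) order_trans by blast
    then show thesis using that[OF v(1)] v(2) q(2) by simp
  qed
  obtain q2 where q2: "fulfilling q2" "q2 n = x" "\<forall>l\<in>?L. l \<le> q2" "\<forall>u\<in>?U. q2 \<le> u"
  proof (cases "?U = {}")
    case True
    then show thesis using that[of q1] q1 by blast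
  next
    case ne: False
    obtain u where u: "u \<in> ?U" "\<forall>a\<in>?U. u \<le> a"
      using linear_family_finite_bound(2)[OF F(1) fin(2) ne] by blast
    then have "fulfilling u" "q1 n < u n" using F(1) q1(2) by (auto simp: linear_family_def)
    then obtain v where v: "fulfilling v" "v n = q1 n" "v \<le> u" "\<And>i. v i = q1 i \<or> v i = u i"
      using follow[OF q1(1), of u n] by (metis less_irrefl)
    \<comment> \<open>The second correction keeps the first: each value of \<open>v\<close> comes
      from \<open>q1\<close> or from \<open>u\<close>, and both lie above \<open>l\<close>.\<close>
    have "l \<le> v" if "l \<in> ?L" for l
    proof (rule le_funI)
      show "l i \<le> v i" for i
        using q1(3) that LU[OF that u(1)] v(4)[of i] by (auto simp: le_fun_def)
    qed
    then have "\<forall>l\<in>?L. l \<le> v" by blast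
    moreover have "\<forall>a\<in>?U. v \<le> a" using u(2) v(3) order_trans by blast
    ultimately show thesis using that[OF v(1)] v(2) q1(2) by simp
  qed
  have "linear_family (insert q2 F)"
    using F(1) q2 split unfolding linear_family_def by blast
  then show thesis using that[of "insert q2 F"] q2 F(2) by blast
qed (use that F in blast)

text \<open>The countably many points are enumerated and inserted one by one; the stages stay finite
  because insertion uses largest and smallest neighbours.\<close>

lemma covering_family:
  obtains W where "countable W" "linear_family W" "\<And>n x. x \<in> Domain (R n) \<Longrightarrow> \<exists>w\<in>W. w n = x"
proof -
  let ?X = "Sigma UNIV (\<lambda>n. Domain (R n))"
  have cX: "countable ?X"
    by (rule countable_SIGMA) (simp_all add: countable_finite finite_Domain)
  let ?x = "from_nat_into ?X"
  show thesis
  proof (cases "?X = {}")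
    case True
    then show thesis using that[of "{}"] by (auto simp: linear_family_def)
  next
    case False
    let ?P = "\<lambda>_ F. linear_family F \<and> finite F"
    let ?Q = "\<lambda>k F F'. F \<subseteq> F' \<and> (\<exists>w\<in>F'. w (fst (?x k)) = snd (?x k))"
    have "\<exists>f. \<forall>k::nat. ?P k (f k) \<and> ?Q k (f k) (f (Suc k))"
    proof (rule dependent_nat_choice)
      show "\<exists>F. linear_family F \<and> finite F" by (rule exI[of _ "{}"]) (simp add: linear_family_def)
      show "\<exists>F'. ?P (Suc k) F' \<and> ?Q k F F'" if F: "?P k F" for F k
      proof -
        have "snd (?x k) \<in> Domain (R (fst (?x k)))" using from_nat_into[OF False, of k] by auto
        from linear_family_insert[OF conjunct1[OF F] conjunct2[OF F] this] show ?thesis by metis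
      qed
    qed
    then obtain f where f: "\<And>k. linear_family (f k)" "\<And>k. finite (f k)" "\<And>k. f k \<subseteq> f (Suc k)"
      and cov: "\<And>k. \<exists>w\<in>f (Suc k). w (fst (?x k)) = snd (?x k)" by metis
    have mono: "f i \<subseteq> f j" if "i \<le> j" for i j using lift_Suc_mono_le[of f, OF f(3) that] .
    have "linear_family (\<Union>k. f k)"
      unfolding linear_family_def
    proof (intro conjI ballI)
      fix w v assume "w \<in> (\<Union>k. f k)" "v \<in> (\<Union>k. f k)"
      then obtain i j where "w \<in> f i" "v \<in> f j" by blast
      then have "w \<in> f (max i j)" "v \<in> f (max i j)" using mono[of i "max i j"] mono[of j "max i j"] by auto
      then show "w \<le> v \<or> v \<le> w" using f(1) unfolding linear_family_def by blast
    qed (use f(1) in \<open>auto simp: linear_family_def\<close>)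
    moreover have "countable (\<Union>k. f k)" using f(2) by (auto intro: countable_finite)
    moreover have "\<exists>w\<in>(\<Union>k. f k). w n = x" if x: "x \<in> Domain (R n)" for n x
    proof -
      have "(n, x) \<in> ?X" using x by auto
      then obtain k where "?x k = (n, x)" using from_nat_into_surj[OF cX] by metis
      then have "\<exists>w\<in>f (Suc k). w n = x" using cov[of k] by simp
      then show ?thesis by blast
    qed
    ultimately show thesis using that[of "\<Union>k. f k"] by metis
  qed
qed

end

section \<open>The countermodel\<close>

primrec subformulas :: "form \<Rightarrow> form set" where
  "subformulas (Var p) = {Var p}"
| "subformulas (And a b) = insert (And a b) (subformulas a \<union> subformulas b)"
| "subformulas (Or a b) = insert (Or a b) (subformulas a \<union> subformulas b)"
| "subformulas (Imp a b) = insert (Imp a b) (subformulas a \<union> subformulas b)"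
| "subformulas (Coimp a b) = insert (Coimp a b) (subformulas a \<union> subformulas b)"
| "subformulas (Next a) = insert (Next a) (subformulas a)"
| "subformulas (Prev a) = insert (Prev a) (subformulas a)"
| "subformulas (Glob a) = insert (Glob a) (subformulas a)"
| "subformulas (Hist a) = insert (Hist a) (subformulas a)"
| "subformulas (Until a b) = insert (Until a b) (subformulas a \<union> subformulas b)"
| "subformulas (Since a b) = insert (Since a b) (subformulas a \<union> subformulas b)"

lemma finite_subformulas: "finite (subformulas a)"
  by (induction a) auto

lemma subformulas_refl: "a \<in> subformulas a"
  by (cases a) auto

lemma subformulas_trans: "b \<in> subformulas a \<Longrightarrow> subformulas b \<subseteq> subformulas a"
proof (induction a)
  case (Imp a1 a2)
  then show ?case by (auto simp only: subformulas.simps)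
qed auto

locale canonical_timeline =
  fixes \<phi> :: form and R :: "int \<Rightarrow> (form set \<times> form set) set"
  assumes edge: "R n \<in> future.edges (subformulas \<phi>)"
    and timeline: "timeline R (future.pending (subformulas \<phi>)) realises
      (past.pending (subformulas \<phi>)) realises"

context
  fixes \<phi> :: form
begin

lemma subformula_closed:
  "And a b \<in> subformulas \<phi> \<Longrightarrow> a \<in> subformulas \<phi> \<and> b \<in> subformulas \<phi>" "Or a b \<in> subformulas \<phi> \<Longrightarrow> a \<in> subformulas \<phi> \<and> b \<in> subformulas \<phi>"
  "Imp a b \<in> subformulas \<phi> \<Longrightarrow> a \<in> subformulas \<phi> \<and> b \<in> subformulas \<phi>" "Coimp a b \<in> subformulas \<phi> \<Longrightarrow> a \<in> subformulas \<phi> \<and> b \<in> subformulas \<phi>"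
  "Next a \<in> subformulas \<phi> \<Longrightarrow> a \<in> subformulas \<phi>" "Prev a \<in> subformulas \<phi> \<Longrightarrow> a \<in> subformulas \<phi>"
  "Glob a \<in> subformulas \<phi> \<Longrightarrow> a \<in> subformulas \<phi>" "Hist a \<in> subformulas \<phi> \<Longrightarrow> a \<in> subformulas \<phi>"
  "Until a b \<in> subformulas \<phi> \<Longrightarrow> a \<in> subformulas \<phi> \<and> b \<in> subformulas \<phi>" "Since a b \<in> subformulas \<phi> \<Longrightarrow> a \<in> subformulas \<phi> \<and> b \<in> subformulas \<phi>"
  by (drule subformulas_trans, simp add: subsetD[OF _ subformulas_refl])+

interpretation ev_future: eventualities "future.edges (subformulas \<phi>)" "future.pending (subformulas \<phi>)" realises
  by (rule future.edges_eventualities) (fact finite_subformulas subformula_closed)+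

interpretation ev_past: eventualities "past.edges (subformulas \<phi>)" "past.pending (subformulas \<phi>)" realises
  by (rule past.edges_eventualities) (fact finite_subformulas subformula_closed)+

lemma pending_finite: "finite {e. future.pending (subformulas \<phi>) e x}" "finite {e. past.pending (subformulas \<phi>) e x}"
proof -
  let ?E = "Inl ` (subformulas \<phi>) \<union> Inr ` ((subformulas \<phi>) \<times> (subformulas \<phi>))"
  have fin: "finite ?E" by (simp add: finite_subformulas)
  have "e \<in> ?E" if "future.pending (subformulas \<phi>) e x \<or> past.pending (subformulas \<phi>) e x" for e
  proof (cases e)
    case (Inl a)
    then show ?thesis using that subformula_closed(7,8)[of a] by auto
  next
    case (Inr ab)
    then obtain a b where "e = Inr (a, b)" by (cases ab) auto
    then show ?thesis using that subformula_closed(9,10)[of a b] by auto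
  qed
  then have "{e. future.pending (subformulas \<phi>) e x} \<subseteq> ?E" "{e. past.pending (subformulas \<phi>) e x} \<subseteq> ?E" by blast+
  then show "finite {e. future.pending (subformulas \<phi>) e x}" "finite {e. past.pending (subformulas \<phi>) e x}"
    using fin finite_subset by blast+
qed

lemma edges_moment:
  assumes "E \<in> future.edges (subformulas \<phi>)"
  obtains \<Gamma> where "prime_theory \<Gamma>" "Domain E = moment (subformulas \<phi>) \<Gamma>"
  using assms by (auto simp: future.edges_def future.Domain_edge)

text \<open>Strict inclusion of traces decides the order of the underlying theories, and the shift
  preserves it; equal traces would decide nothing.\<close>

lemma edges_monotone:
  assumes E: "E \<in> future.edges (subformulas \<phi>)" and xy: "(x, x') \<in> E" "(y, y') \<in> E" "x \<subset> y"
  shows "x' \<subseteq> y'"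
proof -
  obtain \<Gamma> where G: "prime_theory \<Gamma>" "E = future.edge (subformulas \<phi>) \<Gamma>" using E by (auto simp: future.edges_def)
  then obtain \<Delta> \<Delta>' where D: "\<Delta> \<in> component \<Gamma>" "x = \<Delta> \<inter> (subformulas \<phi>)" "x' = future.shift \<Delta> \<inter> (subformulas \<phi>)"
    and D': "\<Delta>' \<in> component \<Gamma>" "y = \<Delta>' \<inter> (subformulas \<phi>)" "y' = future.shift \<Delta>' \<inter> (subformulas \<phi>)"
    using xy unfolding future.edge_def by blast
  have "\<not> \<Delta>' \<subseteq> \<Delta>" using xy(3) D(2) D'(2) by blast
  then have "future.shift \<Delta> \<subseteq> future.shift \<Delta>'"
    using component_comparable[OF G(1) D(1) D'(1)] future.shift_mono by blast
  then show ?thesis using D(3) D'(3) by blast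
qed

text \<open>A fair walk of future edges and one of past edges start at the same moment. Each is fair
  only in its own direction, and \<open>met_from_backwards\<close> extends this to the other
  half.\<close>

lemma canonical_timeline_exists:
  assumes G: "prime_theory \<Gamma>"
  obtains R where "canonical_timeline \<phi> R" "Domain (R 0) = moment (subformulas \<phi>) \<Gamma>"
proof -
  have M: "moment (subformulas \<phi>) \<Gamma> \<in> Domain ` future.edges (subformulas \<phi>)" "moment (subformulas \<phi>) \<Gamma> \<in> Domain ` past.edges (subformulas \<phi>)"
    using G unfolding future.edges_def past.edges_def
    by (metis future.Domain_edge past.Domain_edge imageI mem_Collect_eq)+
  obtain E :: "nat \<Rightarrow> _" where E: "\<And>n. E n \<in> future.edges (subformulas \<phi>)" "Domain (E 0) = moment (subformulas \<phi>) \<Gamma>"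
    "\<And>n. Range (E n) = Domain (E (n + 1))"
    "\<And>n e x. x \<in> Domain (E n) \<Longrightarrow> future.pending (subformulas \<phi>) e x \<Longrightarrow> met_from E realises e n x"
    by (rule ev_future.fair_walk[OF M(1)]) blast
  obtain F :: "nat \<Rightarrow> _" where F: "\<And>n. F n \<in> past.edges (subformulas \<phi>)" "Domain (F 0) = moment (subformulas \<phi>) \<Gamma>"
    "\<And>n. Range (F n) = Domain (F (n + 1))"
    "\<And>n e x. x \<in> Domain (F n) \<Longrightarrow> past.pending (subformulas \<phi>) e x \<Longrightarrow> met_from F realises e n x"
    by (rule ev_past.fair_walk[OF M(2)]) blast
  \<comment> \<open>\<open>F k\<close> leads from time \<open>-k\<close> to \<open>-k - 1\<close>,
    so reversed it is the step with index \<open>-k - 1\<close>.\<close>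
  define R where "R n = (if 0 \<le> n then E (nat n) else (F (nat (- n - 1)))\<inverse>)" for n :: int
  have RE: "R (int k) = E k" for k by (simp add: R_def)
  have RF: "R (- int k - 1) = (F k)\<inverse>" for k by (simp add: R_def)
  have mF: "mirror R (int k) = F k" for k by (simp add: mirror_def RF)
  have cases_int: "(\<exists>k. n = int k) \<or> (\<exists>k. n = - int k - 1)" for n :: int
    by (cases n) auto
  have "(F k)\<inverse> \<in> future.edges (subformulas \<phi>)" for k
    using F(1)[of k] by (auto simp: past_edges)
  then have edge: "R n \<in> future.edges (subformulas \<phi>)" for n
    using cases_int[of n] E(1) by (auto simp: RE RF)
  have range: "Range (R n) = Domain (R (n + 1))" for n
  proof -
    consider k where "n = int k" | "n = - 1" | k where "n = - int (Suc k) - 1"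
      using cases_int[of n] by (metis not0_implies_Suc of_nat_0 diff_0 minus_zero)
    then show ?thesis
    proof cases
      case 1
      then show ?thesis using E(3)[of k] RE[of k] RE[of "Suc k"] by (simp add: ac_simps)
    next
      case 2
      then show ?thesis using E(2) F(2) RE[of 0] RF[of 0] by simp
    next
      case (3 k)
      then have "n + 1 = - int k - 1" by simp
      then show ?thesis
        using F(3)[of k] RF[of k] RF[of "Suc k"] 3 by (metis Domain_converse
            Range_converse Suc_eq_plus1)
    qed
  qed
  have persistF: "future.pending (subformulas \<phi>) e y"
    if "(x, y) \<in> R n" "future.pending (subformulas \<phi>) e x" "\<not> realises e x" for x y n e
    using ev_future.persist[OF edge that] .
  have persistP: "past.pending (subformulas \<phi>) e x"
    if "(x, y) \<in> R n" "past.pending (subformulas \<phi>) e y" "\<not> realises e y" for x y n e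
  proof (rule ev_past.persist[OF _ _ that(2,3)])
    show "(R n)\<inverse> \<in> past.edges (subformulas \<phi>)" using edge[of n] by (auto simp: past_edges)
  qed (use that in simp)
  have meetF: "met_from R realises e n x"
    if "x \<in> Domain (R n)" "future.pending (subformulas \<phi>) e x" for x n e
  proof (rule met_from_backwards[of R "future.pending (subformulas \<phi>)", OF range persistF _ that])
    fix n :: int and x e assume h: "0 \<le> n" "x \<in> Domain (R n)" "future.pending (subformulas \<phi>) e x"
    then obtain k where k: "n = int k" using zero_le_imp_eq_int by blast
    have "met_from E realises e k x" using E(4) h by (simp add: k RE)
    moreover have "E = (\<lambda>k. R (0 + int k))" by (rule ext) (simp add: RE)
    ultimately have "met_from (\<lambda>k. R (0 + int k)) realises e k x" by simp
    from met_from_int_shift[OF this] show "met_from R realises e n x" by (simp add: k)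
  qed
  have meetP: "met_from (mirror R) realises e n x"
    if "x \<in> Domain (mirror R n)" "past.pending (subformulas \<phi>) e x" for x n e
  proof (rule met_from_backwards[of "mirror R" "past.pending (subformulas \<phi>)", OF Range_mirror[of R, OF range] _ _ that])
    show "past.pending (subformulas \<phi>) e y" if "(x, y) \<in> mirror R n" "past.pending (subformulas \<phi>) e x" "\<not> realises e x" for n x y e
      using that persistP by (simp add: mirror_iff)
    fix n :: int and x e assume h: "0 \<le> n" "x \<in> Domain (mirror R n)" "past.pending (subformulas \<phi>) e x"
    then obtain k where k: "n = int k" using zero_le_imp_eq_int by blast
    have "met_from F realises e k x" using F(4) h by (simp add: k mF)
    moreover have "F = (\<lambda>k. mirror R (0 + int k))" by (rule ext) (simp add: mF)
    ultimately have "met_from (\<lambda>k. mirror R (0 + int k)) realises e k x" by simp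
    from met_from_int_shift[OF this] show "met_from (mirror R) realises e n x" by (simp add: k)
  qed
  have "timeline R (future.pending (subformulas \<phi>)) realises (past.pending (subformulas \<phi>)) realises"
  proof
    fix n
    obtain \<Delta> where D: "prime_theory \<Delta>" "Domain (R n) = moment (subformulas \<phi>) \<Delta>" by (rule edges_moment[OF edge])
    show "x \<subseteq> y \<or> y \<subseteq> x" if "x \<in> Domain (R n)" "y \<in> Domain (R n)" for x y
      using moment_comparable[OF D(1)] that by (simp add: D(2))
    show "finite (Domain (R n))"
      unfolding D(2) by (rule finite_subset[OF moment_subset]) (simp add: finite_subformulas)
    show "x' \<subseteq> y'" if "(x, x') \<in> R n" "(y, y') \<in> R n" "x \<subset> y" for x x' y y'
      by (rule edges_monotone[OF edge that])
  qed (fact range persistF persistP pending_finite meetF meetP)+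
  then have "canonical_timeline \<phi> R" using edge by (simp add: canonical_timeline_def)
  moreover have "Domain (R 0) = moment (subformulas \<phi>) \<Gamma>" using RE[of 0] E(2) by simp
  ultimately show thesis by (rule that)
qed

end

text \<open>The unfolding equation also admits the solution that is false although \<open>a\<close>
  always holds; the fulfilled eventuality rules it out.\<close>

lemma globally_unfold:
  fixes g a :: "nat \<Rightarrow> bool"
  assumes "\<And>k. g k \<longleftrightarrow> a k \<and> g (Suc k)" "\<not> g 0 \<Longrightarrow> \<exists>j. \<not> a j"
  shows "g 0 \<longleftrightarrow> (\<forall>k. a k)"
proof
  assume "g 0"
  then have "g k" for k by (induction k) (use assms(1) in blast)+
  then show "\<forall>k. a k" using assms(1) by blast
qed (use assms(2) in blast)

text \<open>Here the spurious solution is true because \<open>a\<close> holds for ever without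
  \<open>b\<close>; the eventuality rules it out, and the first \<open>b\<close> is the
  witness.\<close>

lemma until_unfold:
  fixes u a b :: "nat \<Rightarrow> bool"
  assumes unfold: "\<And>k. u k \<longleftrightarrow> b k \<or> a k \<and> u (Suc k)" and ev: "u 0 \<Longrightarrow> \<exists>j. b j"
  shows "u 0 \<longleftrightarrow> (\<exists>k. b k \<and> (\<forall>i<k. a i))"
proof
  assume u: "u 0"
  from ev[OF u] obtain k where k: "b k" "\<forall>i<k. \<not> b i" using exists_least_iff[of b] by blast
  have u: "u i" if "i \<le> k" for i
    using that
  proof (induction i)
    case (Suc i)
    then have "u i" "\<not> b i" using k(2) by simp_all
    then show ?case using unfold[of i] by simp
  qed (simp add: u)
  have "a i" if "i < k" for i
  proof -
    have "u i" "\<not> b i" using u[of i] k(2) that by simp_all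
    then show ?thesis using unfold[of i] by simp
  qed
  then show "\<exists>k. b k \<and> (\<forall>i<k. a i)" using k(1) by (intro exI[of _ k]) simp
next
  assume "\<exists>k. b k \<and> (\<forall>i<k. a i)"
  then obtain k where k: "b k" "\<forall>i<k. a i" by blast
  \<comment> \<open>Induction back from the witness \<open>k\<close>; for \<open>i\<close> beyond
    \<open>k\<close> the truncated difference stays 0.\<close>
  have "u (k - i)" for i
  proof (induction i)
    case 0
    then show ?case using k(1) unfold[of k] by simp
  next
    case (Suc i)
    show ?case
    proof (cases "k \<le> i")
      case True
      then show ?thesis using Suc by simp
    next
      case False
      then have "Suc (k - Suc i) = k - i" "k - Suc i < k" by simp_all
      then show ?thesis using Suc k(2) unfold[of "k - Suc i"] by simp
    qed
  qed
  from this[of k] show "u 0" by simp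
qed

context canonical_timeline
begin

interpretation timeline R "future.pending (subformulas \<phi>)" realises
  "past.pending (subformulas \<phi>)" realises
  by (rule timeline)

lemma past_edge: "(R n)\<inverse> \<in> past.edges (subformulas \<phi>)"
  using edge[of n] by (auto simp: past_edges)

lemma path_Glob:
  assumes w: "fulfilling w" and S: "Glob a \<in> subformulas \<phi>"
  shows "Glob a \<in> w n \<longleftrightarrow> (\<forall>k. a \<in> w (n + int k))"
proof -
  have a: "a \<in> subformulas \<phi>" using subformula_closed(7)[OF S] .
  have "Glob a \<in> w (n + int k) \<longleftrightarrow> a \<in> w (n + int k) \<and> Glob a \<in> w (n + int (Suc k))" for k
    using future.edges_Gl[OF edge pathD[OF fulfilling_pathD[OF w]] S a, of "n + int k"]
    by (simp add: ac_simps)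
  moreover have "\<exists>j. a \<notin> w (n + int j)" if h: "Glob a \<notin> w (n + int 0)"
  proof -
    obtain m where "m \<ge> n" "a \<notin> w m" using fulfillingD(1)[OF w, of "Inl a" n] h S by auto
    then show ?thesis by (intro exI[of _ "nat (m - n)"]) simp
  qed
  ultimately show ?thesis
    using globally_unfold[of "\<lambda>k. Glob a \<in> w (n + int k)" "\<lambda>k. a \<in> w (n + int k)"] by simp
qed

lemma path_Hist:
  assumes w: "fulfilling w" and S: "Hist a \<in> subformulas \<phi>"
  shows "Hist a \<in> w n \<longleftrightarrow> (\<forall>k. a \<in> w (n - int k))"
proof -
  have a: "a \<in> subformulas \<phi>" using subformula_closed(8)[OF S] .
  have "Hist a \<in> w (n - int k) \<longleftrightarrow> a \<in> w (n - int k) \<and> Hist a \<in> w (n - int (Suc k))" for k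
  proof -
    have "n - int (Suc k) + 1 = n - int k" by simp
    then have "(w (n - int k), w (n - int (Suc k))) \<in> (R (n - int (Suc k)))\<inverse>"
      using pathD[OF fulfilling_pathD[OF w], of "n - int (Suc k)"] by simp
    from past.edges_Gl[OF past_edge this S a] show ?thesis .
  qed
  moreover have "\<exists>j. a \<notin> w (n - int j)" if h: "Hist a \<notin> w (n - int 0)"
  proof -
    obtain m where "m \<le> n" "a \<notin> w m" using fulfillingD(2)[OF w, of "Inl a" n] h S by auto
    then show ?thesis by (intro exI[of _ "nat (n - m)"]) simp
  qed
  ultimately show ?thesis
    using globally_unfold[of "\<lambda>k. Hist a \<in> w (n - int k)" "\<lambda>k. a \<in> w (n - int k)"] by simp
qed

lemma path_Until:
  assumes w: "fulfilling w" and S: "Until a b \<in> subformulas \<phi>"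
  shows "Until a b \<in> w n \<longleftrightarrow> (\<exists>k. b \<in> w (n + int k) \<and> (\<forall>i<k. a \<in> w (n + int i)))"
proof -
  have ab: "a \<in> subformulas \<phi>" "b \<in> subformulas \<phi>" using subformula_closed(9)[OF S] by auto
  have "Until a b \<in> w (n + int k) \<longleftrightarrow>
    b \<in> w (n + int k) \<or> a \<in> w (n + int k) \<and> Until a b \<in> w (n + int (Suc k))" for k
    using future.edges_U[OF edge pathD[OF fulfilling_pathD[OF w]] S ab, of "n + int k"]
    by (simp add: ac_simps)
  moreover have "\<exists>j. b \<in> w (n + int j)" if h: "Until a b \<in> w (n + int 0)"
  proof -
    obtain m where "m \<ge> n" "b \<in> w m" using fulfillingD(1)[OF w, of "Inr (a, b)" n] h S by auto
    then show ?thesis by (intro exI[of _ "nat (m - n)"]) simp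
  qed
  ultimately show ?thesis
    using until_unfold[of "\<lambda>k. Until a b \<in> w (n + int k)" "\<lambda>k. b \<in> w (n + int k)"
        "\<lambda>k. a \<in> w (n + int k)"] by simp
qed

lemma path_Since:
  assumes w: "fulfilling w" and S: "Since a b \<in> subformulas \<phi>"
  shows "Since a b \<in> w n \<longleftrightarrow> (\<exists>k. b \<in> w (n - int k) \<and> (\<forall>i<k. a \<in> w (n - int i)))"
proof -
  have ab: "a \<in> subformulas \<phi>" "b \<in> subformulas \<phi>" using subformula_closed(10)[OF S] by auto
  have "Since a b \<in> w (n - int k) \<longleftrightarrow>
    b \<in> w (n - int k) \<or> a \<in> w (n - int k) \<and> Since a b \<in> w (n - int (Suc k))" for k
  proof -
    have "n - int (Suc k) + 1 = n - int k" by simp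
    then have "(w (n - int k), w (n - int (Suc k))) \<in> (R (n - int (Suc k)))\<inverse>"
      using pathD[OF fulfilling_pathD[OF w], of "n - int (Suc k)"] by simp
    from past.edges_U[OF past_edge this S ab] show ?thesis .
  qed
  moreover have "\<exists>j. b \<in> w (n - int j)" if h: "Since a b \<in> w (n - int 0)"
  proof -
    obtain m where "m \<le> n" "b \<in> w m" using fulfillingD(2)[OF w, of "Inr (a, b)" n] h S by auto
    then show ?thesis by (intro exI[of _ "nat (n - m)"]) simp
  qed
  ultimately show ?thesis
    using until_unfold[of "\<lambda>k. Since a b \<in> w (n - int k)" "\<lambda>k. b \<in> w (n - int k)"
        "\<lambda>k. a \<in> w (n - int k)"] by simp
qed

lemma path_Next:
  assumes "fulfilling w" "Next a \<in> subformulas \<phi>"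
  shows "Next a \<in> w n \<longleftrightarrow> a \<in> w (n + 1)"
  using future.edges_N[OF edge pathD[OF fulfilling_pathD[OF assms(1)]] assms(2)]
    subformula_closed(5)[OF assms(2)] by blast

lemma path_Prev:
  assumes w: "fulfilling w" and S: "Prev a \<in> subformulas \<phi>"
  shows "Prev a \<in> w n \<longleftrightarrow> a \<in> w (n - 1)"
proof -
  have "(w n, w (n - 1)) \<in> (R (n - 1))\<inverse>" using pathD[OF fulfilling_pathD[OF w], of "n - 1"] by simp
  from past.edges_N[OF past_edge this S subformula_closed(6)[OF S]] show ?thesis .
qed

text \<open>Worlds are named by \<open>V\<close> and times by \<open>range g\<close>, so that the frame lives in any two
  prescribed infinite types.\<close>

lemma truth:
  fixes p :: "'w \<Rightarrow> int \<Rightarrow> form set" and g :: "int \<Rightarrow> 't"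
  assumes lin: "linear_family (p ` V)" and inj: "inj_on p V" "inj g"
    and cov: "\<And>n x. x \<in> Domain (R n) \<Longrightarrow> \<exists>v\<in>V. p v n = x"
    and S: "\<And>n. S (g n) = g (n + 1)" and S': "\<And>n. inv_into T S (g n) = g (n - 1)"
    and P: "\<And>q v n. (v, g n) \<in> P q \<longleftrightarrow> Var q \<in> p v n"
    and le: "\<And>v w. v \<in> V \<Longrightarrow> w \<in> V \<Longrightarrow> (v, w) \<in> le \<longleftrightarrow> p w \<le> p v"
  shows "\<psi> \<in> subformulas \<phi> \<Longrightarrow> v \<in> V \<Longrightarrow> satB V le T S P \<psi> v (g n) \<longleftrightarrow> \<psi> \<in> p v n"
proof (induction \<psi> arbitrary: v n)
  have ful: "fulfilling (p v)" if "v \<in> V" for v using lin that by (simp add: linear_family_def)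
  have Sk: "(S ^^ k) (g n) = g (n + int k)" for k n
    by (induction k) (simp_all add: S ac_simps)
  have Sk': "(inv_into T S ^^ k) (g n) = g (n - int k)" for k n
    by (induction k) (simp_all add: S' algebra_simps)
  have dom: "p v n \<in> Domain (R n)" if "v \<in> V" for v n
    using path_Domain fulfilling_pathD ful[OF that] by blast
  \<comment> \<open>Paths may touch without being equal, so inclusion at one time means inclusion of
    the paths or coincidence at that time. Coincidence adds nothing to the clauses below, as it
    reduces to the reflexive instance.\<close>
  have compare: "p v n \<subseteq> p w n \<longleftrightarrow> p v \<le> p w \<or> p v n = p w n" if "v \<in> V" "w \<in> V" for v w n
    using lin that unfolding linear_family_def by (metis imageI le_funD order_antisym order_refl)
  {
    case (Var q)
    then show ?case by (simp add: P)
  next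
    case (And a b)
    obtain \<Gamma> where G: "prime_theory \<Gamma>" "Domain (R n) = moment (subformulas \<phi>) \<Gamma>" by (rule edges_moment[OF edge])
    have "p v n \<in> moment (subformulas \<phi>) \<Gamma>" using dom[of v n] And.prems(2) G(2) by simp
    then show ?case
      using And subformula_closed(1)[OF And.prems(1)] moment_And[OF G(1) _ And.prems(1)] by simp
  next
    case (Or a b)
    obtain \<Gamma> where G: "prime_theory \<Gamma>" "Domain (R n) = moment (subformulas \<phi>) \<Gamma>" by (rule edges_moment[OF edge])
    have "p v n \<in> moment (subformulas \<phi>) \<Gamma>" using dom[of v n] Or.prems(2) G(2) by simp
    then show ?case
      using Or subformula_closed(2)[OF Or.prems(1)] moment_Or[OF G(1) _ Or.prems(1)] by simp
  next
    case (Imp a b)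
    obtain \<Gamma> where G: "prime_theory \<Gamma>" "Domain (R n) = moment (subformulas \<phi>) \<Gamma>" by (rule edges_moment[OF edge])
    have ab: "a \<in> subformulas \<phi>" "b \<in> subformulas \<phi>" using subformula_closed(3)[OF Imp.prems(1)] by auto
    have "p v n \<in> moment (subformulas \<phi>) \<Gamma>" using dom[of v n] Imp.prems(2) G(2) by simp
    note m = moment_Imp[OF G(1) this Imp.prems(1) ab]
    have "satB V le T S P (Imp a b) v (g n) \<longleftrightarrow> (\<forall>w\<in>V. p v \<le> p w \<longrightarrow> a \<in> p w n \<longrightarrow> b \<in> p w n)"
      using Imp ab le by simp
    also have "\<dots> \<longleftrightarrow> (\<forall>w\<in>V. p v n \<subseteq> p w n \<longrightarrow> a \<in> p w n \<longrightarrow> b \<in> p w n)"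
      using compare[OF Imp.prems(2)] Imp.prems(2) by (metis order_refl)
    \<comment> \<open>The family covers every point of the moment, so quantifying over worlds
      reaches the whole finite chain.\<close>
    also have "\<dots> \<longleftrightarrow> (\<forall>y\<in>Domain (R n). p v n \<subseteq> y \<longrightarrow> a \<in> y \<longrightarrow> b \<in> y)"
      using cov dom by metis
    finally show ?case using m G(2) by simp
  next
    case (Coimp a b)
    obtain \<Gamma> where G: "prime_theory \<Gamma>" "Domain (R n) = moment (subformulas \<phi>) \<Gamma>" by (rule edges_moment[OF edge])
    have ab: "a \<in> subformulas \<phi>" "b \<in> subformulas \<phi>" using subformula_closed(4)[OF Coimp.prems(1)] by auto
    have "p v n \<in> moment (subformulas \<phi>) \<Gamma>" using dom[of v n] Coimp.prems(2) G(2) by simp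
    note m = moment_Coimp[OF G(1) this Coimp.prems(1) ab]
    have "satB V le T S P (Coimp a b) v (g n) \<longleftrightarrow> (\<exists>w\<in>V. p w \<le> p v \<and> a \<in> p w n \<and> b \<notin> p w n)"
      using Coimp ab le by simp
    also have "\<dots> \<longleftrightarrow> (\<exists>w\<in>V. p w n \<subseteq> p v n \<and> a \<in> p w n \<and> b \<notin> p w n)"
      using compare[OF _ Coimp.prems(2)] Coimp.prems(2) by (metis order_refl)
    also have "\<dots> \<longleftrightarrow> (\<exists>y\<in>Domain (R n). y \<subseteq> p v n \<and> a \<in> y \<and> b \<notin> y)"
      using cov dom by metis
    finally show ?case using m G(2) by simp
  next
    case (Next a)
    then show ?case using path_Next[OF ful] subformula_closed(5)[OF Next.prems(1)] by (simp add: S)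
  next
    case (Prev a)
    then show ?case using path_Prev[OF ful] subformula_closed(6)[OF Prev.prems(1)] by (simp add: S')
  next
    case (Glob a)
    then show ?case using path_Glob[OF ful] subformula_closed(7)[OF Glob.prems(1)] by (simp add: Sk)
  next
    case (Hist a)
    then show ?case using path_Hist[OF ful] subformula_closed(8)[OF Hist.prems(1)] by (simp add: Sk')
  next
    case (Until a b)
    then show ?case using path_Until[OF ful] subformula_closed(9)[OF Until.prems(1)] by (simp add: Sk)
  next
    case (Since a b)
    then show ?case using path_Since[OF ful] subformula_closed(10)[OF Since.prems(1)] by (simp add: Sk')
  }
qed

end

lemma countermodel:
  assumes inf: "infinite (UNIV :: 'w set)" "infinite (UNIV :: 't set)" and \<phi>: "\<phi> \<notin> GTL"
  obtains V :: "'w set" and le and T :: "'t set" and S and P :: "nat \<Rightarrow> ('w \<times> 't) set"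
    and v t where
    "linear_order_on V le" "bij_betw S T T" "countable V" "v \<in> V" "t \<in> T"
    "\<And>q w v t. w \<in> V \<Longrightarrow> v \<in> V \<Longrightarrow> t \<in> T \<Longrightarrow> (v, w) \<in> le \<Longrightarrow> (w, t) \<in> P q \<Longrightarrow> (v, t) \<in> P q"
    "\<not> satB V le T S P \<phi> v t"
proof -
  obtain \<Gamma> where G: "prime_theory \<Gamma>" "\<phi> \<notin> \<Gamma>" using \<phi> by (auto simp: gtl_iff)
  obtain R where R: "canonical_timeline \<phi> R" "Domain (R 0) = moment (subformulas \<phi>) \<Gamma>"
    by (rule canonical_timeline_exists[OF G(1)])
  interpret canonical_timeline \<phi> R by (rule R(1))
  interpret timeline R "future.pending (subformulas \<phi>)" realises
    "past.pending (subformulas \<phi>)" realises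
    by (rule timeline)
  obtain W where W: "countable W" "linear_family W"
    "\<And>n x. x \<in> Domain (R n) \<Longrightarrow> \<exists>w\<in>W. w n = x" by (rule covering_family) blast
  obtain e :: "nat \<Rightarrow> 'w" where e: "inj e" using infinite_countable_subset[OF inf(1)] by blast
  obtain e' :: "nat \<Rightarrow> 't" where e': "inj e'" using infinite_countable_subset[OF inf(2)] by blast
  \<comment> \<open>Countably many worlds fit into an infinite type: \<open>f\<close> names them and
    \<open>p\<close> recovers the path of a name. Times are copied in the same way by
    \<open>g\<close>.\<close>
  define f where "f = e \<circ> to_nat_on W"
  have f: "inj_on f W"
    unfolding f_def by (rule comp_inj_on[OF inj_on_to_nat_on[OF W(1)]]) (use e in \<open>auto intro: inj_on_subset\<close>)
  define V where "V = f ` W"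
  define p where "p = inv_into W f"
  have pV: "p ` V = W" using f by (auto simp: p_def V_def image_image)
  have p: "inj_on p V" unfolding p_def V_def by (rule inj_on_inv_into) simp
  define g where "g = (e' \<circ> to_nat :: int \<Rightarrow> 't)"
  have g: "inj g" unfolding g_def by (rule inj_compose[OF e']) simp
  have ig: "inv g (g n) = n" for n using g by simp
  define S where "S t = g (inv g t + 1)" for t
  define P where "P q = {(v, t). Var q \<in> p v (inv g t)}" for q
  \<comment> \<open>Reversed inclusion: a larger theory contains more formulas, while truth sets
    have to be closed downwards.\<close>
  define le where "le = {(v, w). v \<in> V \<and> w \<in> V \<and> p w \<le> p v}"
  have Sg: "S (g n) = g (n + 1)" for n by (simp add: S_def ig)
  have S: "bij_betw S (range g) (range g)"
  proof (rule bij_betwI')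
    show "S x = S y \<longleftrightarrow> x = y" if "x \<in> range g" "y \<in> range g" for x y
      using that g by (auto simp: Sg inj_eq)
    show "\<exists>x\<in>range g. y = S x" if "y \<in> range g" for y
    proof -
      from that obtain n where "y = g n" by blast
      then show ?thesis using Sg[of "n - 1"] by (intro bexI[of _ "g (n - 1)"]) auto
    qed
  qed (auto simp: Sg)
  have S': "inv_into (range g) S (g n) = g (n - 1)" for n
    using inv_into_f_f[of S "range g" "g (n - 1)"] S Sg[of "n - 1"] by (simp add: bij_betw_def)
  have lin: "linear_order_on V le"
  proof -
    have "v = w" if "v \<in> V" "w \<in> V" "p w \<le> p v" "p v \<le> p w" for v w
      using that p by (simp add: inj_on_eq_iff[symmetric] order_antisym)
    moreover have "p w \<le> p v \<or> p v \<le> p w" if "v \<in> V" "w \<in> V" for v w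
      using that W(2) pV unfolding linear_family_def by blast
    ultimately show ?thesis
      unfolding order_on_defs refl_on_def trans_def antisym_def total_on_def le_def
      by (auto intro: order_trans)
  qed
  have "\<Gamma> \<inter> subformulas \<phi> \<in> Domain (R 0)"
    unfolding R(2) by (rule moment_member[OF component_refl[OF G(1)]])
  then obtain w where "w \<in> W" "w 0 = \<Gamma> \<inter> subformulas \<phi>" using W(3) by blast
  then obtain v where v: "v \<in> V" "p v 0 = \<Gamma> \<inter> subformulas \<phi>" using pV by blast
  have "satB V le (range g) S P \<phi> v (g 0) \<longleftrightarrow> \<phi> \<in> p v 0"
  proof (rule truth[OF _ p g _ Sg S' _ _ subformulas_refl v(1)])
    show "linear_family (p ` V)" using W(2) pV by simp
    show "\<exists>v\<in>V. p v n = x" if "x \<in> Domain (R n)" for n x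
      using W(3)[OF that] pV by blast
    show "(v, g n) \<in> P q \<longleftrightarrow> Var q \<in> p v n" for q v n by (simp add: P_def ig)
  qed (auto simp: le_def)
  then have "\<not> satB V le (range g) S P \<phi> v (g 0)" using v G(2) by simp
  moreover have "(v, t) \<in> P q" if "(v, w) \<in> le" "(w, t) \<in> P q" for q w v t
    using that by (auto simp: le_def P_def le_fun_def)
  moreover have "countable V" using W(1) by (simp add: V_def)
  ultimately show thesis using that[OF lin S _ v(1), of "g 0" P] by blast
qed

section \<open>Soundness for bi-relational frames\<close>

locale frame =
  fixes W :: "'w set" and le T S and P :: "nat \<Rightarrow> ('w \<times> 't) set"
  assumes linear: "linear_order_on W le" and bij: "bij_betw S T T"
    and downward: "w \<in> W \<Longrightarrow> v \<in> W \<Longrightarrow> t \<in> T \<Longrightarrow> (v, w) \<in> le \<Longrightarrow> (w, t) \<in> P p \<Longrightarrow> (v, t) \<in> P p"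
begin

abbreviation "sat \<equiv> satB W le T S P"

lemma le_refl: "w \<in> W \<Longrightarrow> (w, w) \<in> le"
  and le_trans: "(u, v) \<in> le \<Longrightarrow> (v, w) \<in> le \<Longrightarrow> (u, w) \<in> le"
  and le_total: "v \<in> W \<Longrightarrow> w \<in> W \<Longrightarrow> (v, w) \<in> le \<or> (w, v) \<in> le"
  using linear unfolding order_on_defs
  by (auto dest: refl_onD transD simp: total_on_def) (metis refl_onD)

lemma S_closed: "t \<in> T \<Longrightarrow> S t \<in> T" "t \<in> T \<Longrightarrow> inv_into T S t \<in> T"
  using bij bij_betw_inv_into[OF bij] by (auto simp: bij_betw_def)

lemma funpow_closed: "t \<in> T \<Longrightarrow> (S ^^ n) t \<in> T" "t \<in> T \<Longrightarrow> (inv_into T S ^^ n) t \<in> T"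
  by (induction n) (auto simp: S_closed)

text \<open>\<open>Imp\<close> looks down and \<open>Coimp\<close> looks up, so for these two
  transitivity of the order suffices; the other clauses inherit the property from their
  arguments.\<close>

lemma sat_downward:
  "sat \<phi> w t \<Longrightarrow> w \<in> W \<Longrightarrow> v \<in> W \<Longrightarrow> t \<in> T \<Longrightarrow> (v, w) \<in> le \<Longrightarrow> sat \<phi> v t"
proof (induction \<phi> arbitrary: w v t)
  case (Var p)
  then show ?case using downward by simp
next
  case (And a b)
  then show ?case by (metis satB.simps(2))
next
  case (Or a b)
  then show ?case by (metis satB.simps(3))
next
  case (Imp a b)
  show ?case using Imp.prems(1,5) le_trans[of _ v w] by simp
next
  case (Coimp a b)
  show ?case using Coimp.prems(1,5) le_trans[of v w] by auto
next
  case (Next a)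
  then show ?case using S_closed(1)[of t] by (metis satB.simps(6))
next
  case (Prev a)
  then show ?case using S_closed(2)[of t] by (metis satB.simps(7))
next
  case (Glob a)
  then show ?case using funpow_closed(1)[of t] by (metis satB.simps(8))
next
  case (Hist a)
  then show ?case using funpow_closed(2)[of t] by (metis satB.simps(9))
next
  case (Until a b)
  then obtain n where n: "sat b w ((S ^^ n) t)" "\<forall>i<n. sat a w ((S ^^ i) t)" by auto
  have "sat b v ((S ^^ n) t)" using Until.IH(2)[OF n(1)] Until.prems funpow_closed by blast
  moreover have "sat a v ((S ^^ i) t)" if "i < n" for i
    using Until.IH(1)[of w "(S ^^ i) t" v] n(2) that Until.prems funpow_closed by blast
  ultimately show ?case by auto
next
  case (Since a b)
  then obtain n where n: "sat b w ((inv_into T S ^^ n) t)" "\<forall>i<n. sat a w ((inv_into T S ^^ i) t)"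
    by auto
  have "sat b v ((inv_into T S ^^ n) t)" using Since.IH(2)[OF n(1)] Since.prems funpow_closed by blast
  moreover have "sat a v ((inv_into T S ^^ i) t)" if "i < n" for i
    using Since.IH(1)[of w "(inv_into T S ^^ i) t" v] n(2) that Since.prems funpow_closed by blast
  ultimately show ?case by auto
qed

definition valid :: "form \<Rightarrow> bool" where
  "valid \<phi> \<longleftrightarrow> (\<forall>w\<in>W. \<forall>t\<in>T. sat \<phi> w t)"

lemma valid_Imp: "valid (Imp a b) \<longleftrightarrow> (\<forall>w\<in>W. \<forall>t\<in>T. sat a w t \<longrightarrow> sat b w t)"
  unfolding valid_def using le_refl by auto

lemma not_sat_Bot: "\<not> sat Bot w t"
  by (simp add: Bot_def)

lemma sat_Imp_mp: "w \<in> W \<Longrightarrow> sat (Imp a b) w t \<Longrightarrow> sat a w t \<Longrightarrow> sat b w t"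
  using le_refl by simp

lemma sat_ImpI:
  "(\<And>v. v \<in> W \<Longrightarrow> (v, w) \<in> le \<Longrightarrow> sat a v t \<Longrightarrow> sat b v t) \<Longrightarrow> sat (Imp a b) w t"
  by simp

lemma valid_IPC: "A \<in> IPC \<Longrightarrow> valid (subst \<sigma> A)"
proof (induction rule: IPC.induct)
  case (ipc_K A B)
  show ?case unfolding valid_def subst.simps
    by (intro ballI sat_ImpI) (rule sat_downward)
next
  case (ipc_S A B C)
  show ?case unfolding valid_def subst.simps
  proof (intro ballI sat_ImpI)
    fix w t v1 v2 v3
    assume h: "t \<in> T" "v1 \<in> W" "sat (Imp (subst \<sigma> A) (Imp (subst \<sigma> B) (subst \<sigma> C))) v1 t"
      "v2 \<in> W" "(v2, v1) \<in> le" "sat (Imp (subst \<sigma> A) (subst \<sigma> B)) v2 t"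
      "v3 \<in> W" "(v3, v2) \<in> le" "sat (subst \<sigma> A) v3 t"
    have "(v3, v1) \<in> le" using le_trans h by blast
    then have "sat (Imp (subst \<sigma> B) (subst \<sigma> C)) v3 t" "sat (subst \<sigma> B) v3 t" using h by simp_all
    then show "sat (subst \<sigma> C) v3 t" using sat_Imp_mp h(7) by blast
  qed
next
  case (ipc_andI A B)
  show ?case unfolding valid_def subst.simps
    by (intro ballI sat_ImpI) (simp, rule sat_downward)
next
  case (ipc_orE A C B)
  show ?case unfolding valid_def subst.simps
  proof (intro ballI sat_ImpI)
    fix w t v1 v2 v3
    assume h: "v1 \<in> W" "sat (Imp (subst \<sigma> A) (subst \<sigma> C)) v1 t"
      "v2 \<in> W" "(v2, v1) \<in> le" "sat (Imp (subst \<sigma> B) (subst \<sigma> C)) v2 t"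
      "v3 \<in> W" "(v3, v2) \<in> le" "sat (Or (subst \<sigma> A) (subst \<sigma> B)) v3 t"
    have "(v3, v1) \<in> le" using le_trans h by blast
    then show "sat (subst \<sigma> C) v3 t" using h by auto
  qed
next
  case (ipc_efq A)
  show ?case using not_sat_Bot by (simp add: valid_def)
next
  case (ipc_mp A B)
  then show ?case by (simp add: valid_Imp) (simp add: valid_def)
qed (simp_all add: valid_def)

text \<open>\<open>f\<close> stands for \<open>S\<close> or for its inverse, so one proof covers the
  future and the past axioms.\<close>

lemma valid_temporal:
  assumes f: "\<And>t. t \<in> T \<Longrightarrow> f t \<in> T"
    and N: "\<And>a w t. sat (N a) w t \<longleftrightarrow> sat a w (f t)"
    and Gl: "\<And>a w t. sat (Gl a) w t \<longleftrightarrow> (\<forall>n. sat a w ((f ^^ n) t))"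
    and U: "\<And>a b w t. sat (U a b) w t \<longleftrightarrow>
      (\<exists>n. sat b w ((f ^^ n) t) \<and> (\<forall>i<n. sat a w ((f ^^ i) t)))"
    and ax: "\<phi> \<in> temporal_axioms N Gl U"
  shows "valid \<phi>"
proof -
  have fn: "(f ^^ n) t \<in> T" if "t \<in> T" for n t using that f by (induction n) auto
  have fsuc: "(f ^^ n) (f t) = (f ^^ Suc n) t" for n t by (simp add: funpow_swap1)
  have mp: "sat b w ((f ^^ n) t)"
    if "w \<in> W" "sat (Gl (Imp a b)) w t" "sat a w ((f ^^ n) t)" for a b w n t
    using that sat_Imp_mp unfolding Gl by blast
  have Gl_down: "sat (Gl a) v t" if "sat (Gl a) w t" "w \<in> W" "v \<in> W" "t \<in> T" "(v, w) \<in> le" for a v w t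
    using that by (rule sat_downward)
  consider "\<phi> = Neg (N Bot)" | a b where "\<phi> = Imp (N (Or a b)) (Or (N a) (N b))"
    | a b where "\<phi> = Imp (And (N a) (N b)) (N (And a b))"
    | a b where "\<phi> = Iff (N (Imp a b)) (Imp (N a) (N b))"
    | a b where "\<phi> = Imp (Gl (Imp a b)) (Imp (Gl a) (Gl b))"
    | a b c where "\<phi> = Imp (Gl (Imp a b)) (Imp (U c a) (U c b))"
    | a b c where "\<phi> = Imp (Gl (Imp a b)) (Imp (U a c) (U b c))"
    | a where "\<phi> = Imp (Gl a) (And a (N (Gl a)))"
    | a b where "\<phi> = Imp (Or b (And a (N (U a b)))) (U a b)"
    | a where "\<phi> = Imp (Gl (Imp a (N a))) (Imp a (Gl a))"
    | a b where "\<phi> = Imp (Gl (Imp (And b (N a)) a)) (Imp (U b a) a)"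
    using ax unfolding temporal_axioms_def by blast
  then show ?thesis
  proof cases
    case 1
    then show ?thesis using not_sat_Bot by (simp add: Neg_def valid_Imp N)
  next
    case (4 a b)
    then show ?thesis by (simp add: valid_def Iff_def N)
  next
    case (5 a b)
    show ?thesis unfolding 5 valid_Imp
    proof (intro ballI impI sat_ImpI)
      fix w t v assume h: "w \<in> W" "t \<in> T" "sat (Gl (Imp a b)) w t" "v \<in> W" "(v, w) \<in> le" "sat (Gl a) v t"
      then have "sat (Gl (Imp a b)) v t" using Gl_down by blast
      then show "sat (Gl b) v t" using mp h(4,6) Gl by blast
    qed
  next
    case (6 a b c)
    show ?thesis unfolding 6 valid_Imp
    proof (intro ballI impI sat_ImpI)
      fix w t v assume h: "w \<in> W" "t \<in> T" "sat (Gl (Imp a b)) w t" "v \<in> W" "(v, w) \<in> le" "sat (U c a) v t"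
      then have "sat (Gl (Imp a b)) v t" using Gl_down by blast
      from mp[OF h(4) this] show "sat (U c b) v t" using h(6) unfolding U by blast
    qed
  next
    case (7 a b c)
    show ?thesis unfolding 7 valid_Imp
    proof (intro ballI impI sat_ImpI)
      fix w t v assume h: "w \<in> W" "t \<in> T" "sat (Gl (Imp a b)) w t" "v \<in> W" "(v, w) \<in> le" "sat (U a c) v t"
      then have "sat (Gl (Imp a b)) v t" using Gl_down by blast
      from mp[OF h(4) this] show "sat (U b c) v t" using h(6) unfolding U by blast
    qed
  next
    case (8 a)
    have "sat a w t \<and> sat a w ((f ^^ n) (f t))" if "\<forall>n. sat a w ((f ^^ n) t)" for w t n
      using spec[OF that, of 0] spec[OF that, of "Suc n"] by (simp add: fsuc del: funpow.simps)
    then show ?thesis unfolding 8 valid_Imp by (simp add: N Gl)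
  next
    case (9 a b)
    show ?thesis unfolding 9 valid_Imp
    proof (intro ballI impI)
      fix w t assume "sat (Or b (And a (N (U a b)))) w t"
      then consider "sat b w t" | "sat a w t" "sat (U a b) w (f t)" by (auto simp: N)
      then show "sat (U a b) w t"
      proof cases
        case 1
        then show ?thesis unfolding U by (intro exI[of _ 0]) simp
      next
        case 2
        then obtain n where n: "sat b w ((f ^^ n) (f t))" "\<forall>i<n. sat a w ((f ^^ i) (f t))"
          unfolding U by blast
        have "sat a w ((f ^^ i) t)" if "i < Suc n" for i
          using 2(1) n(2) that by (cases i) (simp_all add: fsuc del: funpow.simps(2))
        then show ?thesis
          unfolding U using n(1) by (intro exI[of _ "Suc n"]) (simp add: fsuc del: funpow.simps(2))
      qed
    qed
  next
    case (10 a)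
    show ?thesis unfolding 10 valid_Imp
    proof (intro ballI impI sat_ImpI)
      fix w t v assume h: "w \<in> W" "t \<in> T" "sat (Gl (Imp a (N a))) w t" "v \<in> W" "(v, w) \<in> le" "sat a v t"
      then have g: "sat (Gl (Imp a (N a))) v t" using Gl_down by blast
      have "sat a v ((f ^^ n) t)" for n
      proof (induction n)
        case (Suc n)
        from mp[OF h(4) g Suc] show ?case by (simp add: N)
      qed (use h in simp)
      then show "sat (Gl a) v t" by (simp add: Gl)
    qed
  next
    case (11 a b)
    show ?thesis unfolding 11 valid_Imp
    proof (intro ballI impI sat_ImpI)
      fix w t v assume h: "w \<in> W" "t \<in> T" "sat (Gl (Imp (And b (N a)) a)) w t" "v \<in> W" "(v, w) \<in> le"
        "sat (U b a) v t"
      then have g: "sat (Gl (Imp (And b (N a)) a)) v t" using Gl_down by blast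
      obtain n where n: "sat a v ((f ^^ n) t)" "\<forall>i<n. sat b v ((f ^^ i) t)" using h(6) U by blast
      \<comment> \<open>Induction backwards from the witness \<open>n\<close> to the
        present.\<close>
      have "sat a v ((f ^^ (n - i)) t)" for i
      proof (induction i)
        case (Suc i)
        show ?case
        proof (cases "n \<le> i")
          case False
          then have s: "n - i = Suc (n - Suc i)" "n - Suc i < n" by simp_all
          then have "sat (And b (N a)) v ((f ^^ (n - Suc i)) t)" using Suc n(2) by (simp add: N)
          from mp[OF h(4) g this] show ?thesis .
        qed (use Suc in simp)
      qed (use n in simp)
      from this[of n] show "sat a v t" by simp
    qed
  qed (simp_all add: valid_Imp N)
qed

lemma valid_GTL: "\<phi> \<in> GTL \<Longrightarrow> valid \<phi>"
proof (induction rule: GTL.induct)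
  case (ax_int A \<sigma>)
  then show ?case by (rule valid_IPC)
next
  case (ax_coimp a b)
  then show ?case using le_refl by (simp add: valid_Imp) blast
next
  case (ax_prelin a b)
  have "sat (Imp a b) w t \<or> sat (Imp b a) w t" if h: "w \<in> W" "t \<in> T" for w t
  proof (rule ccontr)
    assume "\<not> ?thesis"
    then obtain u v where uv: "u \<in> W" "sat a u t" "\<not> sat b u t" "v \<in> W" "sat b v t" "\<not> sat a v t" by auto
    then show False using le_total[of u v] sat_downward h(2) by blast
  qed
  then show ?case by (simp add: valid_def)
next
  case (ax_coprelin a b)
  have "\<not> sat (And (Coimp a b) (Coimp b a)) w t" if h: "w \<in> W" "t \<in> T" for w t
  proof
    assume "sat (And (Coimp a b) (Coimp b a)) w t"
    then obtain u v where uv: "u \<in> W" "sat a u t" "\<not> sat b u t" "v \<in> W" "sat b v t" "\<not> sat a v t" by auto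
    then show False using le_total[of u v] sat_downward h(2) by blast
  qed
  then show ?case unfolding Neg_def valid_Imp by blast
next
  case (ax_future a)
  show ?case by (rule valid_temporal[OF _ _ _ _ ax_future, of S]) (simp_all add: S_closed)
next
  case (ax_past a)
  show ?case by (rule valid_temporal[OF _ _ _ _ ax_past, of "inv_into T S"]) (simp_all add: S_closed)
next
  case (ax_XY a)
  have "inv_into T S (S t) = t" if "t \<in> T" for t using bij that by (simp add: bij_betw_def)
  then show ?case by (simp add: valid_def Iff_def)
next
  case (ax_YX a)
  have "S (inv_into T S t) = t" if "t \<in> T" for t using bij that by (simp add: bij_betw_def f_inv_into_f)
  then show ?case by (simp add: valid_def Iff_def)
next
  case (rule_coimp_mono a b c)
  then show ?case unfolding valid_Imp by simp blast
next
  case (rule_coimp_res a b c)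
  show ?case unfolding valid_Imp
  proof (intro ballI impI)
    fix w t assume h: "w \<in> W" "t \<in> T" "sat (Coimp a b) w t"
    then obtain v where v: "v \<in> W" "(w, v) \<in> le" "sat a v t" "\<not> sat b v t" by auto
    then have "sat c v t" using rule_coimp_res.IH h(2) by (auto simp: valid_Imp)
    then show "sat c w t" using sat_downward v h by blast
  qed
next
  case (rule_mp a b)
  then show ?case unfolding valid_Imp by (simp add: valid_def)
next
  case (nec_X a)
  then show ?case using S_closed by (simp add: valid_def)
next
  case (nec_Y a)
  then show ?case using S_closed by (simp add: valid_def)
next
  case (nec_G a)
  then show ?case using funpow_closed by (simp add: valid_def)
next
  case (nec_H a)
  then show ?case using funpow_closed by (simp add: valid_def)
qed

end

section \<open>Soundness for real-valued flows\<close>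

text \<open>Distributivity of \<open>min\<close> over suprema, in the form used for
  \<open>U\<close>: unless \<open>c \<le> y\<close> already, every \<open>x n\<close> is at most
  \<open>y\<close>.\<close>

lemma min_SUP_le:
  fixes x :: "nat \<Rightarrow> real"
  assumes "\<And>n. min c (x n) \<le> y"
  shows "min c (SUP n. x n) \<le> y"
proof (cases "c \<le> y")
  case False
  then have "x n \<le> y" for n using assms[of n] by (auto simp: min_def split: if_splits)
  then have "(SUP n. x n) \<le> y" by (intro cSUP_least) auto
  then show ?thesis by simp
qed simp

lemma bdd_of_unit_interval:
  fixes x :: "nat \<Rightarrow> real"
  assumes "\<And>n. 0 \<le> x n \<and> x n \<le> 1"
  shows "bdd_below (range x)" "bdd_above (range x)" "0 \<le> Inf (range x)" "Inf (range x) \<le> 1"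
    "0 \<le> Sup (range x)" "Sup (range x) \<le> 1"
proof -
  show b: "bdd_below (range x)" "bdd_above (range x)"
    using assms by (auto intro: bdd_belowI[of _ 0] bdd_aboveI[of _ 1])
  show "0 \<le> Inf (range x)" "Sup (range x) \<le> 1"
    using assms by (auto intro: cINF_greatest cSUP_least)
  show "Inf (range x) \<le> 1" using cINF_lower[OF b(1), of 0] assms[of 0] by simp
  show "0 \<le> Sup (range x)" using cSUP_upper[OF _ b(2), of 0] assms[of 0] by simp
qed

locale real_flow =
  fixes T :: "'t set" and S and val :: "nat \<Rightarrow> 't \<Rightarrow> real"
  assumes bij: "bij_betw S T T"
    and unit: "t \<in> T \<Longrightarrow> 0 \<le> val p t" "t \<in> T \<Longrightarrow> val p t \<le> 1"
begin

abbreviation "ev \<equiv> evalR T S val"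

lemma S_closed: "t \<in> T \<Longrightarrow> S t \<in> T" "t \<in> T \<Longrightarrow> inv_into T S t \<in> T"
  using bij bij_betw_inv_into[OF bij] by (auto simp: bij_betw_def)

lemma funpow_closed: "t \<in> T \<Longrightarrow> (S ^^ n) t \<in> T" "t \<in> T \<Longrightarrow> (inv_into T S ^^ n) t \<in> T"
  by (induction n) (auto simp: S_closed)

lemma until_value_unit:
  fixes x y :: "nat \<Rightarrow> real"
  assumes "\<And>n. 0 \<le> x n \<and> x n \<le> 1" "\<And>n. 0 \<le> y n \<and> y n \<le> 1"
  shows "0 \<le> Min (insert (y n) (x ` {..<n}))" "Min (insert (y n) (x ` {..<n})) \<le> 1"
proof -
  show "0 \<le> Min (insert (y n) (x ` {..<n}))"
    using assms by (subst Min_ge_iff) auto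
  have "Min (insert (y n) (x ` {..<n})) \<le> y n" by (intro Min_le) auto
  then show "Min (insert (y n) (x ` {..<n})) \<le> 1" using assms(2)[of n] by linarith
qed

lemma until_SUP_unit:
  fixes x y :: "nat \<Rightarrow> real"
  assumes "\<And>n. 0 \<le> x n \<and> x n \<le> 1" "\<And>n. 0 \<le> y n \<and> y n \<le> 1"
  shows "0 \<le> (SUP n. Min (insert (y n) (x ` {..<n}))) \<and> (SUP n. Min (insert (y n) (x ` {..<n}))) \<le> 1"
  using until_value_unit[OF assms] by (intro conjI bdd_of_unit_interval)

lemma ev_unit: "t \<in> T \<Longrightarrow> 0 \<le> ev \<phi> t \<and> ev \<phi> t \<le> 1"
proof (induction \<phi> arbitrary: t)
  case (Glob a)
  then show ?case
    using bdd_of_unit_interval(3,4)[of "\<lambda>n. ev a ((S ^^ n) t)"] by (simp add: funpow_closed)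
next
  case (Hist a)
  then show ?case
    using bdd_of_unit_interval(3,4)[of "\<lambda>n. ev a ((inv_into T S ^^ n) t)"] by (simp add: funpow_closed)
next
  case (Until a b)
  then show ?case
    using until_SUP_unit[of "\<lambda>n. ev a ((S ^^ n) t)" "\<lambda>n. ev b ((S ^^ n) t)"]
    by (simp add: funpow_closed)
next
  case (Since a b)
  then show ?case
    using until_SUP_unit[of "\<lambda>n. ev a ((inv_into T S ^^ n) t)"
        "\<lambda>n. ev b ((inv_into T S ^^ n) t)"]
    by (simp add: funpow_closed)
qed (auto simp: unit S_closed min_def max_def)

lemma ev_le_1: "t \<in> T \<Longrightarrow> ev \<phi> t \<le> 1" and ev_ge_0: "t \<in> T \<Longrightarrow> 0 \<le> ev \<phi> t"
  using ev_unit by auto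

lemma ev_Bot: "ev Bot t = 0"
  by (simp add: Bot_def)

lemma ev_Imp_1: "t \<in> T \<Longrightarrow> ev (Imp a b) t = 1 \<longleftrightarrow> ev a t \<le> ev b t"
  using ev_le_1[of t a] by auto

lemma residuation: "t \<in> T \<Longrightarrow> c \<le> 1 \<Longrightarrow> c \<le> ev (Imp a b) t \<longleftrightarrow> min c (ev a t) \<le> ev b t"
  using ev_le_1[of t a] by (auto simp: min_def)

lemma ev_Neg_1: "t \<in> T \<Longrightarrow> ev (Neg a) t = 1 \<longleftrightarrow> ev a t = 0"
  unfolding Neg_def using ev_Imp_1[of t a Bot] ev_ge_0[of t a] by (auto simp: ev_Bot)

lemma ev_Iff_1: "t \<in> T \<Longrightarrow> ev (Iff a b) t = 1 \<longleftrightarrow> ev a t = ev b t"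
  unfolding Iff_def using ev_Imp_1[of t a b] ev_Imp_1[of t b a] ev_le_1[of t "Imp a b"]
    ev_le_1[of t "Imp b a"] by (auto simp del: evalR.simps(4) simp: min_def split: if_splits)

definition valid :: "form \<Rightarrow> bool" where
  "valid \<phi> \<longleftrightarrow> (\<forall>t\<in>T. ev \<phi> t = 1)"

lemma valid_Imp: "valid (Imp a b) \<longleftrightarrow> (\<forall>t\<in>T. ev a t \<le> ev b t)"
  unfolding valid_def using ev_Imp_1 by blast

lemma valid_IPC: "A \<in> IPC \<Longrightarrow> valid (subst \<sigma> A)"
proof (induction rule: IPC.induct)
  case (ipc_mp A B)
  then show ?case
    unfolding valid_def
  proof (intro ballI)
    fix t assume t: "t \<in> T"
    then have "ev (subst \<sigma> A) t = 1" "ev (subst \<sigma> A) t \<le> ev (subst \<sigma> B) t"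
      using ipc_mp.IH t unfolding subst.simps valid_Imp by (simp_all add: valid_def)
    then show "ev (subst \<sigma> B) t = 1" using ev_le_1[OF t, of "subst \<sigma> B"] by simp
  qed
qed (auto simp: valid_def ev_le_1 ev_ge_0 ev_Bot min_def max_def)

lemma valid_temporal:
  assumes f: "\<And>t. t \<in> T \<Longrightarrow> f t \<in> T"
    and N: "\<And>a t. ev (N a) t = ev a (f t)"
    and Gl: "\<And>a t. ev (Gl a) t = (INF n. ev a ((f ^^ n) t))"
    and U: "\<And>a b t. ev (U a b) t =
      (SUP n. Min (insert (ev b ((f ^^ n) t)) ((\<lambda>i. ev a ((f ^^ i) t)) ` {..<n})))"
    and ax: "\<phi> \<in> temporal_axioms N Gl U"
  shows "valid \<phi>"
proof -
  have fn: "(f ^^ n) t \<in> T" if "t \<in> T" for n t using that f by (induction n) auto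
  have fsuc: "(f ^^ n) (f t) = (f ^^ Suc n) t" for n t by (simp add: funpow_swap1)
  \<comment> \<open>The value of reaching \<open>b\<close> after exactly \<open>n\<close> steps
    through \<open>a\<close>. Peeling off the first time point in \<open>mSuc\<close> turns the
    monotonicity and induction axioms for \<open>U\<close> into inductions on
    \<open>n\<close>.\<close>
  define m where "m a b n t = Min (insert (ev b ((f ^^ n) t)) ((\<lambda>i. ev a ((f ^^ i) t)) ` {..<n}))"
    for a b n t
  have U': "ev (U a b) t = (SUP n. m a b n t)" for a b t by (simp add: U m_def)
  have m0: "m a b 0 t = ev b t" for a b t by (simp add: m_def)
  have mSuc: "m a b (Suc n) t = min (ev a t) (m a b n (f t))" for a b n t
  proof -
    have "insert (ev b ((f ^^ Suc n) t)) ((\<lambda>i. ev a ((f ^^ i) t)) ` {..<Suc n})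
      = insert (ev a t) (insert (ev b ((f ^^ n) (f t))) ((\<lambda>i. ev a ((f ^^ i) (f t))) ` {..<n}))"
      unfolding lessThan_Suc_eq_insert_0 fsuc by (auto simp: image_image)
    then show ?thesis unfolding m_def by simp
  qed
  have m_le: "m a b n t \<le> 1" if "t \<in> T" for a b n t
    using until_value_unit(2)[of "\<lambda>i. ev a ((f ^^ i) t)" "\<lambda>i. ev b ((f ^^ i) t)" n] ev_unit fn[OF that]
    by (simp add: m_def)
  have m_U: "m a b n t \<le> ev (U a b) t" if "t \<in> T" for a b n t
  proof -
    have "bdd_above (range (\<lambda>n. m a b n t))"
      by (rule bdd_aboveI[of _ 1]) (use m_le[OF that] in auto)
    from cSUP_upper[OF UNIV_I this] show ?thesis unfolding U' .
  qed
  have Gl_le: "ev (Gl a) t \<le> ev a ((f ^^ n) t)" if "t \<in> T" for a n t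
  proof -
    have "bdd_below (range (\<lambda>n. ev a ((f ^^ n) t)))"
      by (rule bdd_belowI[of _ 0]) (use ev_ge_0[OF fn[OF that]] in auto)
    from cINF_lower[OF this UNIV_I] show ?thesis unfolding Gl .
  qed
  have Gl_ge: "c \<le> ev (Gl a) t" if "\<And>n. c \<le> ev a ((f ^^ n) t)" for a t c
    unfolding Gl using that by (intro cINF_greatest) auto
  have Gl_f: "ev (Gl a) t \<le> ev (Gl a) (f t)" if "t \<in> T" for a t
    by (rule Gl_ge) (use Gl_le[OF that] in \<open>simp only: fsuc\<close>)
  have Gl_0: "ev (Gl a) t \<le> ev a t" if "t \<in> T" for a t using Gl_le[OF that, of a 0] by simp
  have mp: "min (ev (Gl (Imp a b)) t) (ev a ((f ^^ n) t)) \<le> ev b ((f ^^ n) t)" if t: "t \<in> T" for a b n t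
  proof -
    have "ev (Gl (Imp a b)) t \<le> 1"
      using Gl_le[OF t, of "Imp a b" 0] ev_le_1[OF t, of "Imp a b"] by simp
    then show ?thesis using residuation[OF fn[OF t]] Gl_le[OF t, of "Imp a b" n] by blast
  qed
  have Gl_1: "ev (Gl a) t \<le> 1" if "t \<in> T" for a t
    using Gl_0[OF that, of a] ev_le_1[OF that, of a] by simp
  have valid_ImpGl: "valid (Imp (Gl d) (Imp a b))"
    if "\<And>t. t \<in> T \<Longrightarrow> min (ev (Gl d) t) (ev a t) \<le> ev b t" for a b d
    unfolding valid_Imp using residuation[OF _ Gl_1] that by blast
  consider "\<phi> = Neg (N Bot)" | a b where "\<phi> = Imp (N (Or a b)) (Or (N a) (N b))"
    | a b where "\<phi> = Imp (And (N a) (N b)) (N (And a b))"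
    | a b where "\<phi> = Iff (N (Imp a b)) (Imp (N a) (N b))"
    | a b where "\<phi> = Imp (Gl (Imp a b)) (Imp (Gl a) (Gl b))"
    | a b c where "\<phi> = Imp (Gl (Imp a b)) (Imp (U c a) (U c b))"
    | a b c where "\<phi> = Imp (Gl (Imp a b)) (Imp (U a c) (U b c))"
    | a where "\<phi> = Imp (Gl a) (And a (N (Gl a)))"
    | a b where "\<phi> = Imp (Or b (And a (N (U a b)))) (U a b)"
    | a where "\<phi> = Imp (Gl (Imp a (N a))) (Imp a (Gl a))"
    | a b where "\<phi> = Imp (Gl (Imp (And b (N a)) a)) (Imp (U b a) a)"
    using ax unfolding temporal_axioms_def by blast
  then show ?thesis
  proof cases
    case 1
    then show ?thesis by (simp add: valid_def ev_Neg_1 N ev_Bot)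
  next
    case (4 a b)
    then show ?thesis by (simp add: valid_def ev_Iff_1 N)
  next
    case (5 a b)
    show ?thesis unfolding 5
    proof (rule valid_ImpGl, rule Gl_ge)
      fix t n assume t: "t \<in> T"
      have "min (ev (Gl (Imp a b)) t) (ev (Gl a) t) \<le> min (ev (Gl (Imp a b)) t) (ev a ((f ^^ n) t))"
        using Gl_le[OF t, of a n] by (intro min.mono) auto
      then show "min (ev (Gl (Imp a b)) t) (ev (Gl a) t) \<le> ev b ((f ^^ n) t)"
        using mp[OF t, of a b n] by linarith
    qed
  next
    case (6 a b c)
    show ?thesis unfolding 6
    proof (rule valid_ImpGl, unfold U'[of c a], rule min_SUP_le)
      fix t n assume t: "t \<in> T"
      have "min (ev (Gl (Imp a b)) t) (m c a n t) \<le> m c b n t"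
        using t
      proof (induction n arbitrary: t)
        case 0
        then show ?case using mp[of t a b 0] by (simp add: m0)
      next
        case (Suc n)
        then show ?case using Suc.IH[OF f[OF Suc.prems]] Gl_f[OF Suc.prems, of "Imp a b"]
          unfolding mSuc by linarith
      qed
      then show "min (ev (Gl (Imp a b)) t) (m c a n t) \<le> ev (U c b) t"
        using m_U[OF t, of c b n] by linarith
    qed
  next
    case (7 a b c)
    show ?thesis unfolding 7
    proof (rule valid_ImpGl, unfold U'[of a c], rule min_SUP_le)
      fix t n assume t: "t \<in> T"
      have "min (ev (Gl (Imp a b)) t) (m a c n t) \<le> m b c n t"
        using t
      proof (induction n arbitrary: t)
        case 0
        then show ?case by (simp add: m0)
      next
        case (Suc n)
        then have "min (ev (Gl (Imp a b)) t) (ev a t) \<le> ev b t" using mp[of t a b 0] by simp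
        then show ?case using Suc.IH[OF f[OF Suc.prems]] Gl_f[OF Suc.prems, of "Imp a b"]
          unfolding mSuc by linarith
      qed
      then show "min (ev (Gl (Imp a b)) t) (m a c n t) \<le> ev (U b c) t"
        using m_U[OF t, of b c n] by linarith
    qed
  next
    case (8 a)
    then show ?thesis using Gl_0 Gl_f by (simp add: valid_Imp N)
  next
    case (9 a b)
    have "ev b t \<le> ev (U a b) t" "min (ev a t) (ev (U a b) (f t)) \<le> ev (U a b) t" if t: "t \<in> T" for t
    proof -
      show "ev b t \<le> ev (U a b) t" using m_U[OF t, of a b 0] by (simp add: m0)
      show "min (ev a t) (ev (U a b) (f t)) \<le> ev (U a b) t"
        unfolding U'[of a b "f t"]
        by (rule min_SUP_le) (use m_U[OF t, of a b "Suc _"] in \<open>simp add: mSuc\<close>)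
    qed
    then show ?thesis unfolding 9 valid_Imp by (simp add: N)
  next
    case (10 a)
    show ?thesis unfolding 10
    proof (rule valid_ImpGl, rule Gl_ge)
      fix t n assume t: "t \<in> T"
      show "min (ev (Gl (Imp a (N a))) t) (ev a t) \<le> ev a ((f ^^ n) t)"
      proof (induction n)
        case (Suc n)
        have "min (ev (Gl (Imp a (N a))) t) (ev a ((f ^^ n) t)) \<le> ev a ((f ^^ Suc n) t)"
          using mp[OF t, of a "N a" n] unfolding N funpow.simps comp_def .
        then show ?case using Suc by linarith
      qed simp
    qed
  next
    case (11 a b)
    let ?d = "Imp (And b (N a)) a"
    show ?thesis unfolding 11
    proof (rule valid_ImpGl, unfold U'[of b a], rule min_SUP_le)
      fix t n assume "t \<in> T"
      then show "min (ev (Gl ?d) t) (m b a n t) \<le> ev a t"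
      proof (induction n arbitrary: t)
        case 0
        then show ?case by (simp add: m0)
      next
        case (Suc n)
        have "min (ev (Gl ?d) t) (min (ev b t) (ev a (f t))) \<le> ev a t"
          using mp[OF Suc.prems, of "And b (N a)" a 0] by (simp add: N)
        then show ?case
          using Suc.IH[OF f[OF Suc.prems]] Gl_f[OF Suc.prems, of ?d] unfolding mSuc by linarith
      qed
    qed
  qed (simp_all add: valid_Imp N)
qed

lemma valid_GTL: "\<phi> \<in> GTL \<Longrightarrow> valid \<phi>"
proof (induction rule: GTL.induct)
  case (ax_int A \<sigma>)
  then show ?case by (rule valid_IPC)
next
  case (ax_coimp a b)
  show ?case unfolding valid_Imp by (simp add: max_def)
next
  case (ax_prelin a b)
  have "ev (Or (Imp a b) (Imp b a)) t = 1" if "t \<in> T" for t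
    using ev_le_1[OF that, of a] ev_le_1[OF that, of b] by (auto simp: max_def)
  then show ?case by (simp add: valid_def)
next
  case (ax_coprelin a b)
  have "ev (And (Coimp a b) (Coimp b a)) t = 0" if "t \<in> T" for t
    using ev_ge_0[OF that, of a] ev_ge_0[OF that, of b] by (auto simp: min_def)
  then show ?case by (simp add: valid_def ev_Neg_1 del: evalR.simps)
next
  case (ax_future a)
  show ?case by (rule valid_temporal[OF _ _ _ _ ax_future, of S]) (simp_all add: S_closed)
next
  case (ax_past a)
  show ?case by (rule valid_temporal[OF _ _ _ _ ax_past, of "inv_into T S"]) (simp_all add: S_closed)
next
  case (ax_XY a)
  have "inv_into T S (S t) = t" if "t \<in> T" for t using bij that by (simp add: bij_betw_def)
  then show ?case by (simp add: valid_def ev_Iff_1)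
next
  case (ax_YX a)
  have "S (inv_into T S t) = t" if "t \<in> T" for t using bij that by (simp add: bij_betw_def f_inv_into_f)
  then show ?case by (simp add: valid_def ev_Iff_1)
next
  case (rule_coimp_mono a b c)
  have "ev (Coimp a c) t \<le> ev (Coimp b c) t" if t: "t \<in> T" for t
  proof -
    have "ev a t \<le> ev b t" using rule_coimp_mono.IH t by (simp add: valid_Imp)
    then show ?thesis using ev_ge_0[OF t, of b] by auto
  qed
  then show ?case unfolding valid_Imp by blast
next
  case (rule_coimp_res a b c)
  have "ev (Coimp a b) t \<le> ev c t" if t: "t \<in> T" for t
  proof -
    have "ev a t \<le> max (ev b t) (ev c t)" using rule_coimp_res.IH t by (simp add: valid_Imp)
    then show ?thesis using ev_ge_0[OF t, of c] by (auto simp: max_def split: if_splits)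
  qed
  then show ?case unfolding valid_Imp by blast
next
  case (rule_mp a b)
  have "ev b t = 1" if t: "t \<in> T" for t
  proof -
    have "ev a t = 1" "ev a t \<le> ev b t"
      using rule_mp.IH t unfolding valid_Imp by (auto simp: valid_def)
    then show ?thesis using ev_le_1[OF t, of b] by simp
  qed
  then show ?case by (simp add: valid_def)
next
  case (nec_X a)
  then show ?case using S_closed by (simp add: valid_def)
next
  case (nec_Y a)
  then show ?case using S_closed by (simp add: valid_def)
next
  case (nec_G a)
  then show ?case using funpow_closed by (simp add: valid_def)
next
  case (nec_H a)
  then show ?case using funpow_closed by (simp add: valid_def)
qed

end

section \<open>From countable frames to real values\<close>

text \<open>Weighting the worlds embeds the chain of downward closed sets into the unit interval;
  as the weights are summable, unions and intersections of sequences are preserved.\<close>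

definition weight :: "nat set \<Rightarrow> real" where
  "weight D = (\<Sum>n. if n \<in> D then (1 / 2) ^ n else 0)"

lemma weight_summable: "summable (\<lambda>n. if n \<in> D then (1 / 2) ^ n else (0::real))"
  by (rule summable_comparison_test'[OF summable_geometric[of "1 / 2 :: real"], of 0]) auto

lemma weight_empty: "weight {} = 0"
  by (simp add: weight_def)

lemma weight_mono: "D \<subseteq> E \<Longrightarrow> weight D \<le> weight E"
  unfolding weight_def by (rule suminf_le[OF _ weight_summable weight_summable]) auto

lemma weight_strict_mono:
  assumes "D \<subset> E"
  shows "weight D < weight E"
proof -
  obtain k where k: "k \<in> E" "k \<notin> D" using assms by blast
  let ?d = "\<lambda>n. (if n \<in> E then (1 / 2) ^ n else (0::real)) - (if n \<in> D then (1 / 2) ^ n else 0)"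
  have "0 < (\<Sum>n. ?d n)"
    by (rule suminf_pos2[of _ k]) (use k assms in \<open>auto intro: summable_diff weight_summable\<close>)
  then show ?thesis
    unfolding weight_def using suminf_diff[OF weight_summable weight_summable, of E D] by simp
qed

text \<open>The weights from \<open>N\<close> on sum to \<open>2 * (1 / 2) ^ N\<close>, so the
  elements below \<open>N\<close> determine the weight of a set up to this error.\<close>

lemma weight_tail:
  assumes "E \<inter> {..<N} \<subseteq> D"
  shows "weight E \<le> weight D + 2 * (1 / 2) ^ N"
proof -
  let ?t = "\<lambda>n. if n < N then 0 else (1 / 2 :: real) ^ n"
  have "(\<lambda>n. (1 / 2 :: real) ^ N * (1 / 2) ^ n) sums ((1 / 2) ^ N * (1 / (1 - 1 / 2)))"
    by (rule sums_mult[OF geometric_sums]) simp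
  then have "(\<lambda>n. ?t (n + N)) sums (2 * (1 / 2) ^ N)" by (simp add: power_add mult.commute)
  then have t: "?t sums (2 * (1 / 2) ^ N)" by (subst (asm) sums_zero_iff_shift) auto
  have "weight E \<le> (\<Sum>n. (if n \<in> D then (1 / 2) ^ n else 0) + ?t n)"
    unfolding weight_def
    by (rule suminf_le[OF _ weight_summable summable_add[OF weight_summable sums_summable[OF t]]])
      (use assms in auto)
  also have "\<dots> = weight D + 2 * (1 / 2) ^ N"
    unfolding weight_def using suminf_add[OF weight_summable sums_summable[OF t], of D] sums_unique[OF t]
    by simp
  finally show ?thesis .
qed

lemma le_if_le_add_power:
  fixes x y :: real
  assumes "\<And>N. x \<le> y + 2 * (1 / 2) ^ N"
  shows "x \<le> y"
proof (rule ccontr)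
  assume "\<not> x \<le> y"
  then obtain N where "(1 / 2) ^ N < (x - y) / 2" using real_arch_pow_inv[of "(x - y) / 2" "1 / 2"] by auto
  then show False using assms[of N] by simp
qed

text \<open>Only finitely many numbers lie below \<open>N\<close> and the sets form a chain, so a
  single \<open>D m\<close> already agrees with the intersection below \<open>N\<close>;
  \<open>weight_tail\<close> bounds the rest.\<close>

lemma weight_Inter:
  fixes D :: "nat \<Rightarrow> nat set"
  assumes chain: "\<And>i j. D i \<subseteq> D j \<or> D j \<subseteq> D i"
  shows "weight (\<Inter>n. D n) = (INF n. weight (D n))"
proof (rule antisym)
  show "weight (\<Inter>n. D n) \<le> (INF n. weight (D n))"
    by (rule cINF_greatest) (auto intro: weight_mono)
  have bdd: "bdd_below (range (\<lambda>n. weight (D n)))"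
    by (rule bdd_belowI[of _ "weight {}"]) (auto intro: weight_mono)
  show "(INF n. weight (D n)) \<le> weight (\<Inter>n. D n)"
  proof (rule le_if_le_add_power)
    fix N
    have "\<exists>m. D m \<inter> {..<N} \<subseteq> (\<Inter>n. D n)"
    proof (induction N)
      case (Suc N)
      then obtain m where m: "D m \<inter> {..<N} \<subseteq> (\<Inter>n. D n)" by blast
      show ?case
      proof (cases "N \<in> (\<Inter>n. D n)")
        case True
        then have "D m \<inter> {..<Suc N} \<subseteq> (\<Inter>n. D n)" using m True unfolding lessThan_Suc by blast
        then show ?thesis ..
      next
        case False
        then obtain k where k: "N \<notin> D k" by blast
        from chain[of k m] show ?thesis
        proof
          assume "D k \<subseteq> D m"
          then have "D k \<inter> {..<Suc N} \<subseteq> (\<Inter>n. D n)" using m k unfolding lessThan_Suc by blast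
          then show ?thesis ..
        next
          assume "D m \<subseteq> D k"
          then have "D m \<inter> {..<Suc N} \<subseteq> (\<Inter>n. D n)" using m k unfolding lessThan_Suc by blast
          then show ?thesis ..
        qed
      qed
    qed simp
    then obtain m where "D m \<inter> {..<N} \<subseteq> (\<Inter>n. D n)" by blast
    from weight_tail[OF this] cINF_lower[OF bdd UNIV_I, of m]
    show "(INF n. weight (D n)) \<le> weight (\<Inter>n. D n) + 2 * (1 / 2) ^ N" by linarith
  qed
qed

lemma weight_Union:
  fixes D :: "nat \<Rightarrow> nat set"
  assumes chain: "\<And>i j. D i \<subseteq> D j \<or> D j \<subseteq> D i"
  shows "weight (\<Union>n. D n) = (SUP n. weight (D n))"
proof (rule antisym)
  have bdd: "bdd_above (range (\<lambda>n. weight (D n)))"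
    by (rule bdd_aboveI[of _ "weight UNIV"]) (auto intro: weight_mono)
  show "(SUP n. weight (D n)) \<le> weight (\<Union>n. D n)"
    by (rule cSUP_least) (auto intro: weight_mono)
  show "weight (\<Union>n. D n) \<le> (SUP n. weight (D n))"
  proof (rule le_if_le_add_power)
    fix N
    have "\<exists>m. (\<Union>n. D n) \<inter> {..<N} \<subseteq> D m"
    proof (induction N)
      case (Suc N)
      then obtain m where m: "(\<Union>n. D n) \<inter> {..<N} \<subseteq> D m" by blast
      show ?case
      proof (cases "N \<in> (\<Union>n. D n)")
        case False
        then have "(\<Union>n. D n) \<inter> {..<Suc N} \<subseteq> D m" using m False unfolding lessThan_Suc by blast
        then show ?thesis ..
      next
        case True
        then obtain k where k: "N \<in> D k" by blast
        from chain[of k m] show ?thesis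
        proof
          assume "D k \<subseteq> D m"
          then have "(\<Union>n. D n) \<inter> {..<Suc N} \<subseteq> D m" using m k unfolding lessThan_Suc by blast
          then show ?thesis ..
        next
          assume "D m \<subseteq> D k"
          then have "(\<Union>n. D n) \<inter> {..<Suc N} \<subseteq> D k" using m k unfolding lessThan_Suc by blast
          then show ?thesis ..
        qed
      qed
    qed simp
    then obtain m where "(\<Union>n. D n) \<inter> {..<N} \<subseteq> D m" by blast
    from weight_tail[OF this] cSUP_upper[OF UNIV_I bdd, of m]
    show "weight (\<Union>n. D n) \<le> (SUP n. weight (D n)) + 2 * (1 / 2) ^ N" by linarith
  qed
qed

lemma scaled_INF:
  fixes x :: "nat \<Rightarrow> real"
  assumes c: "0 < c" and bdd: "bdd_below (range x)"
  shows "(INF n. x n / c) = (INF n. x n) / c"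
proof (rule antisym)
  have "(INF n. x n / c) * c \<le> (INF n. x n)"
  proof (rule cINF_greatest)
    fix n
    have "bdd_below (range (\<lambda>n. x n / c))"
      by (rule bdd_belowI[of _ "Inf (range x) / c"])
        (use cINF_lower[OF bdd UNIV_I] c in \<open>auto intro: divide_right_mono\<close>)
    from cINF_lower[OF this UNIV_I, of n] show "(INF n. x n / c) * c \<le> x n"
      using c by (simp add: field_simps)
  qed simp
  then show "(INF n. x n / c) \<le> (INF n. x n) / c" using c by (simp add: field_simps)
  show "(INF n. x n) / c \<le> (INF n. x n / c)"
    by (rule cINF_greatest) (use cINF_lower[OF bdd UNIV_I] c in \<open>auto intro: divide_right_mono\<close>)
qed

lemma scaled_SUP:
  fixes x :: "nat \<Rightarrow> real"
  assumes c: "0 < c" and bdd: "bdd_above (range x)"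
  shows "(SUP n. x n / c) = (SUP n. x n) / c"
proof (rule antisym)
  have "(SUP n. x n) \<le> (SUP n. x n / c) * c"
  proof (rule cSUP_least)
    fix n
    have "bdd_above (range (\<lambda>n. x n / c))"
      by (rule bdd_aboveI[of _ "Sup (range x) / c"])
        (use cSUP_upper[OF UNIV_I bdd] c in \<open>auto intro: divide_right_mono\<close>)
    from cSUP_upper[OF UNIV_I this, of n] show "x n \<le> (SUP n. x n / c) * c"
      using c by (simp add: field_simps)
  qed simp
  then show "(SUP n. x n) / c \<le> (SUP n. x n / c)" using c by (simp add: field_simps)
  show "(SUP n. x n / c) \<le> (SUP n. x n) / c"
    by (rule cSUP_least) (use cSUP_upper[OF UNIV_I bdd] c in \<open>auto intro: divide_right_mono\<close>)
qed

text \<open>\<open>weight\<close> divided by the weight of \<open>V\<close>, so that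
  \<open>V\<close> gets the value 1. Countability of \<open>V\<close> supplies the numbering, and
  nonemptiness makes the divisor positive.\<close>

lemma chain_embedding:
  fixes V :: "'w set"
  assumes "countable V" "V \<noteq> {}"
  obtains h :: "'w set \<Rightarrow> real" where "h V = 1" "h {} = 0"
    "\<And>D E. D \<subset> E \<Longrightarrow> E \<subseteq> V \<Longrightarrow> h D < h E"
    "\<And>D :: nat \<Rightarrow> 'w set. (\<And>n. D n \<subseteq> V) \<Longrightarrow> (\<And>i j. D i \<subseteq> D j \<or> D j \<subseteq> D i)
      \<Longrightarrow> h (\<Inter>n. D n) = (INF n. h (D n))"
    "\<And>D :: nat \<Rightarrow> 'w set. (\<And>n. D n \<subseteq> V) \<Longrightarrow> (\<And>i j. D i \<subseteq> D j \<or> D j \<subseteq> D i)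
      \<Longrightarrow> h (\<Union>n. D n) = (SUP n. h (D n))"
proof -
  let ?f = "to_nat_on V"
  have f: "inj_on ?f V" by (rule inj_on_to_nat_on[OF assms(1)])
  let ?c = "weight (?f ` V)"
  have c: "0 < ?c"
    using weight_strict_mono[of "{}" "?f ` V"] assms(2) by (auto simp: weight_empty)
  show thesis
  proof (rule that[of "\<lambda>D. weight (?f ` D) / ?c"])
    show "?c / ?c = 1" "weight (?f ` {}) / ?c = 0" using c by (simp_all add: weight_empty)
    show "weight (?f ` D) / ?c < weight (?f ` E) / ?c" if "D \<subset> E" "E \<subseteq> V" for D E
    proof -
      have "?f ` D \<subset> ?f ` E" using image_strict_mono[OF inj_on_subset[OF f that(2)] that(1)] .
      then show ?thesis using weight_strict_mono c by (simp add: divide_strict_right_mono)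
    qed
    fix D :: "nat \<Rightarrow> 'w set" assume D: "\<And>n. D n \<subseteq> V" "\<And>i j. D i \<subseteq> D j \<or> D j \<subseteq> D i"
    then have ch: "?f ` D i \<subseteq> ?f ` D j \<or> ?f ` D j \<subseteq> ?f ` D i" for i j by (meson image_mono)
    have b: "bdd_below (range (\<lambda>n. weight (?f ` D n)))" "bdd_above (range (\<lambda>n. weight (?f ` D n)))"
      by (rule bdd_belowI[of _ "weight {}"] bdd_aboveI[of _ "weight UNIV"]; auto intro: weight_mono)+
    have "?f ` (\<Inter>n. D n) = (\<Inter>n. ?f ` D n)"
      by (rule image_INT[OF f]) (use D in auto)
    then show "weight (?f ` (\<Inter>n. D n)) / ?c = (INF n. weight (?f ` D n) / ?c)"
      using weight_Inter[OF ch] scaled_INF[OF c b(1)] by simp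
    show "weight (?f ` (\<Union>n. D n)) / ?c = (SUP n. weight (?f ` D n) / ?c)"
      using weight_Union[OF ch] scaled_SUP[OF c b(2)] by (simp add: image_UN)
  qed
qed

section \<open>Real values of the truth sets of a countable frame\<close>

context frame
begin

text \<open>The value of a formula is \<open>h\<close> of its truth set. Truth sets are downward
  closed in a linear order, hence form a chain on which \<open>h\<close> is strictly monotone; so
  comparing values amounts to comparing truth sets by inclusion.\<close>

lemma real_flow_of_frame:
  assumes "countable W" "W \<noteq> {}"
  obtains val where "\<And>p t. t \<in> T \<Longrightarrow> 0 \<le> val p t \<and> val p t \<le> 1"
    "\<And>\<phi> t. t \<in> T \<Longrightarrow> evalR T S val \<phi> t = 1 \<longleftrightarrow> (\<forall>w\<in>W. sat \<phi> w t)"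
proof -
  obtain h :: "'w set \<Rightarrow> real" where h1: "h W = 1" and h0: "h {} = 0"
    and strict: "\<And>D E. D \<subset> E \<Longrightarrow> E \<subseteq> W \<Longrightarrow> h D < h E"
    and hInter: "\<And>D :: nat \<Rightarrow> 'w set. (\<And>n. D n \<subseteq> W) \<Longrightarrow> (\<And>i j. D i \<subseteq> D j \<or> D j \<subseteq> D i)
      \<Longrightarrow> h (\<Inter>n. D n) = (INF n. h (D n))"
    and hUnion: "\<And>D :: nat \<Rightarrow> 'w set. (\<And>n. D n \<subseteq> W) \<Longrightarrow> (\<And>i j. D i \<subseteq> D j \<or> D j \<subseteq> D i)
      \<Longrightarrow> h (\<Union>n. D n) = (SUP n. h (D n))"
    by (rule chain_embedding[OF assms]) blast
  have mono: "h D \<le> h E" if "D \<subseteq> E" "E \<subseteq> W" for D E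
    using strict[of D E] that by (cases "D = E") (simp_all add: psubset_eq)
  define X where "X \<phi> t = {w \<in> W. sat \<phi> w t}" for \<phi> t
  have XW: "X \<phi> t \<subseteq> W" for \<phi> t by (auto simp: X_def)
  define down where "down D \<longleftrightarrow> D \<subseteq> W \<and> (\<forall>w\<in>D. \<forall>v\<in>W. (v, w) \<in> le \<longrightarrow> v \<in> D)" for D
  have X: "down (X \<phi> t)" if "t \<in> T" for \<phi> t
    using sat_downward[OF _ _ _ that] by (auto simp: down_def X_def)
  have chain: "D \<subseteq> E \<or> E \<subseteq> D" if "down D" "down E" for D E
  proof (rule ccontr)
    assume "\<not> ?thesis"
    then obtain d e where "d \<in> D" "d \<notin> E" "e \<in> E" "e \<notin> D" by blast
    then show False using le_total[of d e] that unfolding down_def by blast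
  qed
  have h_iff: "h D \<le> h E \<longleftrightarrow> D \<subseteq> E" if "down D" "down E" for D E
    using chain[OF that] mono[of D E] strict[of E D] that unfolding down_def
    by (metis linorder_not_le psubset_eq)
  have h_Int: "h (D \<inter> E) = min (h D) (h E)" and h_Un: "h (D \<union> E) = max (h D) (h E)"
    if "down D" "down E" for D E
    using chain[OF that] h_iff[OF that] h_iff[OF that(2,1)]
    by (auto simp: min_def max_def Int_absorb1 Int_absorb2 Un_absorb1 Un_absorb2)
  have Until_value: "(SUP n. Min (insert (h (B n)) ((\<lambda>i. h (A i)) ` {..<n})))
      = h {w \<in> W. \<exists>n. w \<in> B n \<and> (\<forall>i<n. w \<in> A i)}"
    if A: "\<And>n. down (A n)" and B: "\<And>n. down (B n)" for A B :: "nat \<Rightarrow> 'w set"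
  proof -
    \<comment> \<open>The number \<open>k\<close> of conditions is separated from the witness time
      \<open>n\<close>, so that the minimum can be computed by induction on \<open>k\<close> with
      \<open>n\<close> fixed.\<close>
    define C where "C n k = B n \<inter> (\<Inter>i\<in>{..<k}. A i)" for n k
    have down_mem: "v \<in> D" if "down D" "w \<in> D" "v \<in> W" "(v, w) \<in> le" for D v w
      using that unfolding down_def by blast
    have CW: "C n k \<subseteq> W" for n k using B[of n] unfolding C_def down_def by blast
    have C: "down (C n k)" for n k
      unfolding down_def
    proof (intro conjI ballI impI CW)
      fix w v assume h: "w \<in> C n k" "v \<in> W" "(v, w) \<in> le"
      have "v \<in> B n" using down_mem[OF B _ h(2,3)] h(1) by (simp add: C_def)
      moreover have "v \<in> A i" if "i < k" for i using down_mem[OF A _ h(2,3)] h(1) that by (simp add: C_def)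
      ultimately show "v \<in> C n k" by (simp add: C_def)
    qed
    have "Min (insert (h (B n)) ((\<lambda>i. h (A i)) ` {..<k})) = h (C n k)" for n k
    proof (induction k)
      case (Suc k)
      have "C n (Suc k) = A k \<inter> C n k" by (auto simp: C_def lessThan_Suc)
      moreover have "Min (insert (h (B n)) ((\<lambda>i. h (A i)) ` {..<Suc k}))
        = min (h (A k)) (Min (insert (h (B n)) ((\<lambda>i. h (A i)) ` {..<k})))"
        by (simp add: lessThan_Suc insert_commute[of "h (B n)"] del: Min_insert) (rule Min_insert; simp)
      ultimately show ?case using Suc h_Int[OF A C] by simp
    qed (simp add: C_def)
    then have "(SUP n. Min (insert (h (B n)) ((\<lambda>i. h (A i)) ` {..<n}))) = (SUP n. h (C n n))" by simp
    also have "\<dots> = h (\<Union>n. C n n)"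
      by (rule hUnion[OF CW chain[OF C C], symmetric])
    also have "(\<Union>n. C n n) = {w \<in> W. \<exists>n. w \<in> B n \<and> (\<forall>i<n. w \<in> A i)}"
    proof
      show "(\<Union>n. C n n) \<subseteq> {w \<in> W. \<exists>n. w \<in> B n \<and> (\<forall>i<n. w \<in> A i)}"
      proof
        fix w assume "w \<in> (\<Union>n. C n n)"
        then obtain n where "w \<in> C n n" by blast
        then show "w \<in> {w \<in> W. \<exists>n. w \<in> B n \<and> (\<forall>i<n. w \<in> A i)}"
          using subsetD[OF CW, of w n n] unfolding C_def by blast
      qed
    qed (auto simp: C_def)
    finally show ?thesis .
  qed
  define val where "val p t = h (X (Var p) t)" for p t
  have ev: "evalR T S val \<phi> t = h (X \<phi> t)" if "t \<in> T" for \<phi> t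
    using that
  proof (induction \<phi> arbitrary: t)
    case (Var p)
    then show ?case by (simp add: val_def)
  next
    case (And a b)
    have "X (And a b) t = X a t \<inter> X b t" by (auto simp: X_def)
    then show ?case using And h_Int[OF X X] by simp
  next
    case (Or a b)
    have "X (Or a b) t = X a t \<union> X b t" by (auto simp: X_def)
    then show ?case using Or h_Un[OF X X] by simp
  next
    case (Imp a b)
    note XX = X[OF Imp.prems, of a] X[OF Imp.prems, of b]
    \<comment> \<open>When inclusion fails, some \<open>u\<close> satisfies \<open>a\<close> but not
      \<open>b\<close>. Worlds below \<open>u\<close> satisfy \<open>a\<close>, so there the
      implication amounts to \<open>b\<close>; at worlds above \<open>u\<close> both fail.\<close>
    have "X (Imp a b) t = (if X a t \<subseteq> X b t then W else X b t)"
    proof (cases "X a t \<subseteq> X b t")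
      case True
      then show ?thesis by (auto simp: X_def)
    next
      case False
      then obtain u where u: "u \<in> W" "sat a u t" "\<not> sat b u t" by (auto simp: X_def)
      have "sat (Imp a b) w t \<longleftrightarrow> sat b w t" if w: "w \<in> W" for w
      proof
        assume i: "sat (Imp a b) w t"
        from le_total[OF u(1) w] show "sat b w t"
        proof
          assume "(u, w) \<in> le"
          then show ?thesis using i u by auto
        next
          assume "(w, u) \<in> le"
          then have "sat a w t" using sat_downward[OF u(2,1) w Imp.prems] by simp
          then show ?thesis using sat_Imp_mp[OF w i] by simp
        qed
      qed (use sat_downward[OF _ w _ Imp.prems] in auto)
      then show ?thesis using False by (auto simp: X_def simp del: satB.simps)
    qed
    then show ?case using Imp h_iff[OF XX] h1 by auto
  next
    case (Coimp a b)
    note XX = X[OF Coimp.prems, of a] X[OF Coimp.prems, of b]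
    \<comment> \<open>Dually, \<open>u\<close> witnesses the coimplication at all worlds below it,
      while worlds above \<open>u\<close> fail \<open>b\<close> and are their own witnesses whenever
      they satisfy \<open>a\<close>.\<close>
    have "X (Coimp a b) t = (if X a t \<subseteq> X b t then {} else X a t)"
    proof (cases "X a t \<subseteq> X b t")
      case True
      then show ?thesis by (auto simp: X_def)
    next
      case False
      then obtain u where u: "u \<in> W" "sat a u t" "\<not> sat b u t" by (auto simp: X_def)
      have "sat (Coimp a b) w t \<longleftrightarrow> sat a w t" if w: "w \<in> W" for w
      proof
        assume i: "sat a w t"
        from le_total[OF u(1) w] show "sat (Coimp a b) w t"
        proof
          assume "(w, u) \<in> le"
          then show ?thesis using u by auto
        next
          assume "(u, w) \<in> le"
          then have "\<not> sat b w t" using sat_downward[OF _ w u(1) Coimp.prems] u(3) by blast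
          then show ?thesis using i w le_refl by auto
        qed
      qed (use sat_downward[OF _ _ w Coimp.prems] in auto)
      then show ?thesis using False by (auto simp: X_def simp del: satB.simps)
    qed
    then show ?case using Coimp h_iff[OF XX] h0 by auto
  next
    case (Next a)
    then show ?case by (simp add: S_closed X_def)
  next
    case (Prev a)
    then show ?case by (simp add: S_closed X_def)
  next
    case (Glob a)
    have "X (Glob a) t = (\<Inter>n. X a ((S ^^ n) t))" by (auto simp: X_def)
    moreover have "h (\<Inter>n. X a ((S ^^ n) t)) = (INF n. h (X a ((S ^^ n) t)))"
      by (rule hInter[OF XW]) (intro chain X funpow_closed Glob.prems)
    ultimately show ?case using Glob funpow_closed(1)[OF Glob.prems] by simp
  next
    case (Hist a)
    have "X (Hist a) t = (\<Inter>n. X a ((inv_into T S ^^ n) t))" by (auto simp: X_def)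
    moreover have "h (\<Inter>n. X a ((inv_into T S ^^ n) t)) = (INF n. h (X a ((inv_into T S ^^ n) t)))"
      by (rule hInter[OF XW]) (intro chain X funpow_closed Hist.prems)
    ultimately show ?case using Hist funpow_closed(2)[OF Hist.prems] by simp
  next
    case (Until a b)
    note cl = funpow_closed(1)[OF Until.prems]
    have "{w \<in> W. \<exists>n. w \<in> X b ((S ^^ n) t) \<and> (\<forall>i<n. w \<in> X a ((S ^^ i) t))} = X (Until a b) t"
      by (auto simp: X_def)
    then show ?case
      using Until.IH cl Until_value[OF X[OF cl, of a] X[OF cl, of b]] by simp
  next
    case (Since a b)
    note cl = funpow_closed(2)[OF Since.prems]
    have "{w \<in> W. \<exists>n. w \<in> X b ((inv_into T S ^^ n) t) \<and> (\<forall>i<n. w \<in> X a ((inv_into T S ^^ i) t))}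
      = X (Since a b) t"
      by (auto simp: X_def)
    then show ?case
      using Since.IH cl Until_value[OF X[OF cl, of a] X[OF cl, of b]] by simp
  qed
  show thesis
  proof (rule that[of val])
    fix t assume t: "t \<in> T"
    show "0 \<le> val p t \<and> val p t \<le> 1" for p
      unfolding val_def using mono[of "{}" "X (Var p) t"] mono[OF XW subset_refl] XW h0 h1 by simp
    show "evalR T S val \<phi> t = 1 \<longleftrightarrow> (\<forall>w\<in>W. sat \<phi> w t)" for \<phi>
    proof -
      have "h (X \<phi> t) = 1 \<longleftrightarrow> X \<phi> t = W"
        using strict[of "X \<phi> t" W] XW[of \<phi> t] h1 by (cases "X \<phi> t = W") (simp_all add: psubset_eq)
      then show ?thesis using ev[OF t] by (auto simp: X_def)
    qed
  qed
qed

end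

theorem theorem10p4:
  assumes "infinite (UNIV :: 'w set)" and "infinite (UNIV :: 't set)"
  shows "GTL = G_rel TYPE('w) TYPE('t) \<and> G_rel TYPE('w) TYPE('t) = G_R TYPE('t)"
proof -
  have sound_rel: "GTL \<subseteq> G_rel TYPE('w) TYPE('t)"
  proof
    fix \<phi> assume \<phi>: "\<phi> \<in> GTL"
    show "\<phi> \<in> G_rel TYPE('w) TYPE('t)"
      unfolding G_rel_def
    proof (intro CollectI allI impI, elim conjE)
      fix W :: "'w set" and le and T :: "'t set" and S and P :: "nat \<Rightarrow> ('w \<times> 't) set"
      assume "linear_order_on W le" "bij_betw S T T"
        "\<forall>p. \<forall>w\<in>W. \<forall>v\<in>W. \<forall>t\<in>T. (v, w) \<in> le \<and> (w, t) \<in> P p \<longrightarrow> (v, t) \<in> P p"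
      then interpret frame W le T S P by unfold_locales blast+
      show "\<forall>w\<in>W. \<forall>t\<in>T. satB W le T S P \<phi> w t" using valid_GTL[OF \<phi>] by (simp add: valid_def)
    qed
  qed
  have sound_real: "GTL \<subseteq> G_R TYPE('t)"
  proof
    fix \<phi> assume \<phi>: "\<phi> \<in> GTL"
    show "\<phi> \<in> G_R TYPE('t)"
      unfolding G_R_def
    proof (intro CollectI allI impI, elim conjE)
      fix T :: "'t set" and S and val :: "nat \<Rightarrow> 't \<Rightarrow> real"
      assume "bij_betw S T T" "\<forall>p. \<forall>t\<in>T. 0 \<le> val p t \<and> val p t \<le> 1"
      then interpret real_flow T S val by unfold_locales blast+
      show "\<forall>t\<in>T. evalR T S val \<phi> t = 1" using valid_GTL[OF \<phi>] by (simp add: valid_def)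
    qed
  qed
  \<comment> \<open>The two semantic logics are not compared directly: both equal
    \<open>GTL\<close>, because one countable frame refutes a formula relationally and, through
    \<open>real_flow_of_frame\<close>, also in the reals.\<close>
  have "\<phi> \<notin> G_rel TYPE('w) TYPE('t) \<and> \<phi> \<notin> G_R TYPE('t)" if "\<phi> \<notin> GTL" for \<phi>
  proof -
    obtain V :: "'w set" and le and T :: "'t set" and S and P :: "nat \<Rightarrow> ('w \<times> 't) set" and v t where
      V: "linear_order_on V le" "bij_betw S T T" "countable V" "v \<in> V" "t \<in> T"
      "\<And>q w v t. w \<in> V \<Longrightarrow> v \<in> V \<Longrightarrow> t \<in> T \<Longrightarrow> (v, w) \<in> le \<Longrightarrow> (w, t) \<in> P q \<Longrightarrow> (v, t) \<in> P q"
      and unsat: "\<not> satB V le T S P \<phi> v t"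
      by (rule countermodel[OF assms \<open>\<phi> \<notin> GTL\<close>]) blast
    interpret frame V le T S P by unfold_locales (fact V)+
    have "\<phi> \<notin> G_rel TYPE('w) TYPE('t)"
      unfolding G_rel_def using V unsat by blast
    moreover obtain val where val: "\<And>p t. t \<in> T \<Longrightarrow> 0 \<le> val p t \<and> val p t \<le> 1"
      "\<And>\<phi> t. t \<in> T \<Longrightarrow> evalR T S val \<phi> t = 1 \<longleftrightarrow> (\<forall>w\<in>V. satB V le T S P \<phi> w t)"
      using real_flow_of_frame V(3,4) by blast
    have "evalR T S val \<phi> t \<noteq> 1" using val(2)[OF V(5)] unsat V(4) by blast
    then have "\<phi> \<notin> G_R TYPE('t)"
      unfolding G_R_def using V(2,5) val(1) by blast
    ultimately show ?thesis by blast
  qed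
  then show ?thesis using sound_rel sound_real by blast
qed

end
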